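(* Let $T$ be a locally finite tree and let $\Gamma$ be a non-elementary discrete subgroup of $\mathrm{Aut}(T)$. Let $(\mu_x)_{x\in VT}$ be a Patterson-Sullivan measure for $\Gamma$ on $\partial T$ of dimension $\delta\in\,]0,+\infty[$ such that, for every non-trivial elliptic element $\gamma\in\Gamma$, the set of fixed points of $\gamma$ in $\partial T$ has $\mu_x$-measure zero. Let $\widetilde{\mu}_{BM}$ be the associated Bowen-Margulis measure on the space of geodesics $\mathcal{G}T$, let $\widetilde\varphi$ be the geodesic transformation of $\mathcal{G}T$, and let $(\Gamma\backslash\mathcal{G}T,\varphi,\mu_{BM})$ be the quotient by $\Gamma$ of the measured dynamical system $(\mathcal{G}T,\widetilde\varphi,\widetilde{\mu}_{BM})$. If $\mu_{BM}$ is a probability measure and $(\Gamma\backslash\mathcal{G}T,\varphi,\mu_{BM})$ is mixing, then $(\Gamma\backslash\mathcal{G}T,\varphi,\mu_{BM})$ is loosely Bernoulli.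
   Context: Trees are simplicial with edges of length $1$; $VT$ is the vertex set and $\partial T$ the space of ends of $T$. $\mathrm{Aut}(T)$ is the group of automorphisms of $T$ without inversion, with the compact-open topology. An element of $\mathrm{Aut}(T)$ is elliptic if it fixes a point of $T$. $\Gamma$ is non-elementary if it preserves no point and no pair of points of $T\cup\partial T$; then there is a unique smallest non-empty $\Gamma$-invariant subtree $T_{\Gamma,\min}$. $\mathcal{G}T$ is the space of isometries $\ell:\mathbb{R}\to T$ with $\ell(0)\in VT$, with the compact-open topology; $\ell_-,\ell_+\in\partial T$ are the origin and the endpoint at infinity of $\ell$. The geodesic transformation is $\widetilde\varphi(\ell)(t)=\ell(t+1)$. $\Gamma$ acts on $\mathcal{G}T$ by $(\gamma,\ell)\mapsto\gamma\circ\ell$; this commutes with $\widetilde\varphi$, which induces $\varphi:\Gamma\backslash\mathcal{G}T\to\Gamma\backslash\mathcal{G}T$. A Patterson-Sullivan measure for $\Gamma$ of dimension $\delta$ is a family $(\mu_x)_{x\in VT}$ of finite Borel measures on $\partial T$, with support $\partial T_{\Gamma,\min}$, such that $\gamma_*\mu_x=\mu_{\gamma x}$ for all $\gamma\in\Gamma$, and $\frac{d\mu_x}{d\mu_y}(\xi)=e^{-\delta\beta_\xi(x,y)}$ for all $x,y\in VT$, $\xi\in\partial T$, where $\beta_\xi(x,y)=d(x,z)-d(z,y)$ for any vertex $z$ close enough to $\xi$. The associated Bowen-Margulis measure on $\mathcal{G}T$: fix $y_0\in VT$; the map $\ell\mapsto(\ell_-,\ell_+,t)$, with $t$ the algebraic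 distance along $\ell$ between $\ell(0)$ and the point of $\ell$ closest to $y_0$, identifies $\mathcal{G}T$ with $\{(\xi,\eta)\in\partial T\times\partial T:\xi\ne\eta\}\times\mathbb{Z}$, and $$d\widetilde{\mu}_{BM}(\ell_-,\ell_+,t)=\frac{d\mu_{y_0}(\ell_-)\,d\mu_{y_0}(\ell_+)\,dt}{d_{y_0}(\ell_-,\ell_+)^{2\delta}},$$ where $dt$ is the counting measure and $d_{y_0}(\xi,\eta)=e^{-u}$ with $u$ the length of the intersection of the geodesic rays from $y_0$ to $\xi$ and to $\eta$. It does not depend on $y_0$, and is invariant under $\Gamma$ and $\widetilde\varphi$. The action of $\Gamma$ on $\mathcal{G}T$ is properly discontinuous, and $\mu_{BM}$ is the measure induced on $\Gamma\backslash\mathcal{G}T$, i.e. $\int f\,d\widetilde{\mu}_{BM}=\int_{\Gamma\backslash\mathcal{G}T}\sum_{\gamma\in\Gamma}f(\gamma\ell)\,d\mu_{BM}(\Gamma\ell)$ for $f\ge0$ Borel. "Loosely Bernoulli" has its usual meaning in the theory of Kakutani equivalence. *)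

theory Defs
  imports "HOL-Probability.Probability"
begin

section \<open>Topological preliminaries\<close>

definition isometric_on :: "'a::metric_space set \<Rightarrow> ('a \<Rightarrow> 'b::metric_space) \<Rightarrow> bool" where
  "isometric_on S f \<longleftrightarrow> (\<forall>x\<in>S. \<forall>y\<in>S. dist (f x) (f y) = dist x y)"

definition borel_of :: "'a topology \<Rightarrow> 'a measure" where
  "borel_of X = sigma (topspace X) {U. openin X U}"

definition compact_open_topology :: "('a::topological_space \<Rightarrow> 'b::topological_space) topology" where
  "compact_open_topology = topology_generated_by
     {{f. continuous_on UNIV f \<and> f ` K \<subseteq> U} | K U. compact K \<and> open U}"

definition quotient_topology :: "'a topology \<Rightarrow> ('a \<Rightarrow> 'b) \<Rightarrow> 'b topology" where
  "quotient_topology X p =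
     topology (\<lambda>U. U \<subseteq> p ` topspace X \<and> openin X {x \<in> topspace X. p x \<in> U})"

lemma openin_quotient_topology:
  "openin (quotient_topology X p) U \<longleftrightarrow>
     U \<subseteq> p ` topspace X \<and> openin X {x \<in> topspace X. p x \<in> U}"
proof -
  have "istopology (\<lambda>U. U \<subseteq> p ` topspace X \<and> openin X {x \<in> topspace X. p x \<in> U})"
    unfolding istopology_def
  proof (intro conjI allI impI; (elim conjE)?)
    fix S T
    assume "openin X {x \<in> topspace X. p x \<in> S}" "openin X {x \<in> topspace X. p x \<in> T}"
    then have "openin X ({x \<in> topspace X. p x \<in> S} \<inter> {x \<in> topspace X. p x \<in> T})"
      by (rule openin_Int)
    also have "{x \<in> topspace X. p x \<in> S} \<inter> {x \<in> topspace X. p x \<in> T} =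
        {x \<in> topspace X. p x \<in> S \<inter> T}" by auto
    finally show "openin X {x \<in> topspace X. p x \<in> S \<inter> T}" .
  next
    fix \<K>
    assume "\<forall>K\<in>\<K>. K \<subseteq> p ` topspace X \<and> openin X {x \<in> topspace X. p x \<in> K}"
    then have "openin X (\<Union>K\<in>\<K>. {x \<in> topspace X. p x \<in> K})"
      by (intro openin_Union) auto
    also have "(\<Union>K\<in>\<K>. {x \<in> topspace X. p x \<in> K}) = {x \<in> topspace X. p x \<in> \<Union>\<K>}" by auto
    finally show "openin X {x \<in> topspace X. p x \<in> \<Union>\<K>}" .
  qed auto
  then show ?thesis by (simp add: quotient_topology_def)
qed

definition measure_support :: "'a topology \<Rightarrow> 'a measure \<Rightarrow> 'a set" where
  "measure_support X M = {x \<in> topspace X. \<forall>U. openin X U \<and> x \<in> U \<longrightarrow> 0 < emeasure M U}"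


section \<open>Simplicial trees and their automorphisms\<close>

text \<open>
  The tree \<open>T\<close>, or rather its geometric realisation, is the metric space formed by the whole
  type \<open>'a\<close>, and \<open>V\<close> is its set of vertices.  The first two axioms say that \<open>T\<close> is a real tree (between two
  points there is a geodesic segment, and it is the only arc); the remaining ones say that \<open>V\<close>
  is the vertex set of a simplicial structure on \<open>T\<close> whose edges have length \<open>1\<close>.
\<close>

locale simplicial_tree =
  fixes V :: "'a::metric_space set"
  assumes geodesic:
      "\<exists>c. isometric_on {0..dist x y} c \<and> c 0 = x \<and> c (dist x y) = (y::'a)"
    and unique_arc:
      "arc p \<Longrightarrow> path_image p =
         {z::'a. dist (pathstart p) z + dist z (pathfinish p) = dist (pathstart p) (pathfinish p)}"
    and vertices_nonempty: "V \<noteq> {}"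
    and vertices_separated: "x \<in> V \<Longrightarrow> y \<in> V \<Longrightarrow> x \<noteq> y \<Longrightarrow> 1 \<le> dist x y"
    and open_edges: "C \<in> components (- V) \<Longrightarrow>
         \<exists>e. isometric_on {0..1::real} e \<and> e 0 \<in> V \<and> e 1 \<in> V \<and> C = e ` {0<..<1}"

definition locally_finite_tree :: "'a::metric_space set \<Rightarrow> bool" where
  "locally_finite_tree V \<longleftrightarrow>
     simplicial_tree V \<and> (\<forall>x\<in>V. finite {y\<in>V. dist x y = 1})"

definition tree_automorphisms :: "'a::metric_space set \<Rightarrow> ('a \<Rightarrow> 'a) set" where
  "tree_automorphisms V = {g. bij g \<and> isometric_on UNIV g \<and> g ` V = V \<and>
     \<not> (\<exists>x\<in>V. \<exists>y\<in>V. dist x y = 1 \<and> g x = y \<and> g y = x)}"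

text \<open>
  Automorphisms without inversion need not be closed under composition; as usual, a subgroup is
  a group of automorphisms none of whose elements is an inversion.
\<close>

definition discrete_subgroup :: "'a::metric_space set \<Rightarrow> ('a \<Rightarrow> 'a) set \<Rightarrow> bool" where
  "discrete_subgroup V \<Gamma> \<longleftrightarrow> \<Gamma> \<subseteq> tree_automorphisms V \<and>
     id \<in> \<Gamma> \<and> (\<forall>g\<in>\<Gamma>. \<forall>h\<in>\<Gamma>. g \<circ> h \<in> \<Gamma>) \<and> (\<forall>g\<in>\<Gamma>. inv g \<in> \<Gamma>) \<and>
     subtopology compact_open_topology \<Gamma> = discrete_topology \<Gamma>"

definition elliptic :: "('a \<Rightarrow> 'a) \<Rightarrow> bool" where
  "elliptic g \<longleftrightarrow> (\<exists>x. g x = x)"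


section \<open>The space of ends\<close>

text \<open>
  Rays are functions on \<open>\<real>\<close> of which only the values on \<open>[0, \<infinity>[\<close> matter; an end is a
  class of rays which eventually coincide up to a shift of the parameter.
\<close>

definition geodesic_rays :: "(real \<Rightarrow> 'a::metric_space) set" where
  "geodesic_rays = {r. isometric_on {0..} r}"

definition cofinal_rays :: "((real \<Rightarrow> 'a::metric_space) \<times> (real \<Rightarrow> 'a)) set" where
  "cofinal_rays = {(r, s). r \<in> geodesic_rays \<and> s \<in> geodesic_rays \<and>
     (\<exists>a\<ge>0. \<exists>b\<ge>0. \<forall>t\<ge>0. r (a + t) = s (b + t))}"

type_synonym 'a tree_end = "(real \<Rightarrow> 'a) set"

definition ends :: "'a::metric_space tree_end set" where
  "ends = geodesic_rays // cofinal_rays"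

definition end_of :: "(real \<Rightarrow> 'a::metric_space) \<Rightarrow> 'a tree_end" where
  "end_of r = cofinal_rays `` {r}"

definition end_action :: "('a \<Rightarrow> 'a) \<Rightarrow> 'a tree_end \<Rightarrow> 'a tree_end" where
  "end_action g \<xi> = (\<lambda>r. g \<circ> r) ` \<xi>"

text \<open>The image of the geodesic ray from \<open>x\<close> to \<open>\<xi>\<close>.\<close>

definition ray_to :: "'a::metric_space \<Rightarrow> 'a tree_end \<Rightarrow> 'a set" where
  "ray_to x \<xi> = \<Union> {r ` {0..} | r. r \<in> \<xi> \<and> r 0 = x}"

text \<open>The topology of the space of ends is generated by the shadows of vertices.\<close>

definition ends_topology :: "'a::metric_space set \<Rightarrow> 'a tree_end topology" where
  "ends_topology V = topology_generated_by {{\<xi> \<in> ends. y \<in> ray_to x \<xi>} | x y. x \<in> V \<and> y \<in> V}"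

definition compactification :: "('a::metric_space + 'a tree_end) set" where
  "compactification = Inl ` UNIV \<union> Inr ` ends"

definition non_elementary :: "('a::metric_space \<Rightarrow> 'a) set \<Rightarrow> bool" where
  "non_elementary \<Gamma> \<longleftrightarrow> \<not> (\<exists>S \<subseteq> compactification. (card S = 1 \<or> card S = 2) \<and>
     (\<forall>g\<in>\<Gamma>. map_sum g (end_action g) ` S = S))"

definition subtree :: "'a::metric_space set \<Rightarrow> 'a set \<Rightarrow> bool" where
  "subtree V S \<longleftrightarrow> connected S \<and> (\<forall>C \<in> components (- V). C \<inter> S \<noteq> {} \<longrightarrow> closure C \<subseteq> S)"

definition minimal_subtree :: "'a::metric_space set \<Rightarrow> ('a \<Rightarrow> 'a) set \<Rightarrow> 'a set" where
  "minimal_subtree V \<Gamma> = \<Inter> {S. S \<noteq> {} \<and> subtree V S \<and> (\<forall>g\<in>\<Gamma>. g ` S = S)}"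

definition ends_in :: "'a::metric_space set \<Rightarrow> 'a tree_end set" where
  "ends_in S = {\<xi> \<in> ends. \<exists>r\<in>\<xi>. r ` {0..} \<subseteq> S}"


section \<open>Patterson-Sullivan and Bowen-Margulis measures\<close>

text \<open>
  In the Busemann cocycle, the vertices \<open>z\<close> close to \<open>\<xi>\<close> are those such that the geodesic
  segment from \<open>r 0\<close> to \<open>z\<close> passes through \<open>r s\<close>, where \<open>r\<close> is a ray with end \<open>\<xi>\<close>
  and \<open>s\<close> is large.
\<close>

definition busemann :: "'a::metric_space set \<Rightarrow> 'a tree_end \<Rightarrow> 'a \<Rightarrow> 'a \<Rightarrow> real" where
  "busemann V \<xi> x y = (THE b. \<exists>r\<in>\<xi>. \<exists>s\<ge>0. \<forall>z\<in>V.
     dist (r 0) (r s) + dist (r s) z = dist (r 0) z \<longrightarrow> dist x z - dist z y = b)"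

definition patterson_sullivan ::
  "'a::metric_space set \<Rightarrow> ('a \<Rightarrow> 'a) set \<Rightarrow> real \<Rightarrow> ('a \<Rightarrow> 'a tree_end measure) \<Rightarrow> bool" where
  "patterson_sullivan V \<Gamma> \<delta> \<mu> \<longleftrightarrow>
     (\<forall>x\<in>V. sets (\<mu> x) = sets (borel_of (ends_topology V)) \<and> finite_measure (\<mu> x) \<and>
        measure_support (ends_topology V) (\<mu> x) = ends_in (minimal_subtree V \<Gamma>)) \<and>
     (\<forall>g\<in>\<Gamma>. \<forall>x\<in>V. distr (\<mu> x) (borel_of (ends_topology V)) (end_action g) = \<mu> (g x)) \<and>
     (\<forall>x\<in>V. \<forall>y\<in>V. \<mu> x = density (\<mu> y) (\<lambda>\<xi>. ennreal (exp (- \<delta> * busemann V \<xi> x y))))"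

definition geodesics :: "'a::metric_space set \<Rightarrow> (real \<Rightarrow> 'a) set" where
  "geodesics V = {l. isometric_on UNIV l \<and> l 0 \<in> V}"

definition geodesics_topology :: "'a::metric_space set \<Rightarrow> (real \<Rightarrow> 'a) topology" where
  "geodesics_topology V = subtopology compact_open_topology (geodesics V)"

definition geodesic_shift :: "(real \<Rightarrow> 'a) \<Rightarrow> (real \<Rightarrow> 'a)" where
  "geodesic_shift l = (\<lambda>t. l (t + 1))"

definition origin :: "(real \<Rightarrow> 'a::metric_space) \<Rightarrow> 'a tree_end" where
  "origin l = end_of (\<lambda>t. l (- t))"

text \<open>
  The point of a geodesic line closest to a vertex is a vertex, so that the last component of
  the parametrisation is an integer.
\<close>

definition hopf_param ::
  "'a::metric_space \<Rightarrow> (real \<Rightarrow> 'a) \<Rightarrow> 'a tree_end \<times> 'a tree_end \<times> int" where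
  "hopf_param y0 l = (origin l, end_of l,
     (THE n. \<forall>s. dist y0 (l (of_int n)) \<le> dist y0 (l s)))"

text \<open>The length of a segment is its diameter.\<close>

definition visual_dist :: "'a::metric_space \<Rightarrow> 'a tree_end \<Rightarrow> 'a tree_end \<Rightarrow> real" where
  "visual_dist y0 \<xi> \<eta> = exp (- diameter (ray_to y0 \<xi> \<inter> ray_to y0 \<eta>))"

definition bowen_margulis ::
  "'a::metric_space set \<Rightarrow> real \<Rightarrow> ('a \<Rightarrow> 'a tree_end measure) \<Rightarrow> 'a \<Rightarrow> (real \<Rightarrow> 'a) measure" where
  "bowen_margulis V \<delta> \<mu> y0 =
     distr
       (density
         (restrict_space (\<mu> y0 \<Otimes>\<^sub>M (\<mu> y0 \<Otimes>\<^sub>M count_space (UNIV :: int set))) {(\<xi>, \<eta>, t). \<xi> \<noteq> \<eta>})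
         (\<lambda>(\<xi>, \<eta>, t). ennreal (1 / visual_dist y0 \<xi> \<eta> powr (2 * \<delta>))))
       (borel_of (geodesics_topology V))
       (the_inv_into (geodesics V) (hopf_param y0))"


section \<open>The quotient system\<close>

definition orbit :: "('a \<Rightarrow> 'a) set \<Rightarrow> (real \<Rightarrow> 'a) \<Rightarrow> (real \<Rightarrow> 'a) set" where
  "orbit \<Gamma> l = (\<lambda>g. g \<circ> l) ` \<Gamma>"

definition quotient_borel ::
  "'a::metric_space set \<Rightarrow> ('a \<Rightarrow> 'a) set \<Rightarrow> (real \<Rightarrow> 'a) set measure" where
  "quotient_borel V \<Gamma> = borel_of (quotient_topology (geodesics_topology V) (orbit \<Gamma>))"

text \<open>The elements of \<open>\<Gamma>\<close>, and not those of the orbit, index the sum: stabilisers count.\<close>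

definition induced_on_quotient ::
  "'a::metric_space set \<Rightarrow> ('a \<Rightarrow> 'a) set \<Rightarrow> (real \<Rightarrow> 'a) measure \<Rightarrow> (real \<Rightarrow> 'a) set measure \<Rightarrow> bool"
  where
  "induced_on_quotient V \<Gamma> M Q \<longleftrightarrow> sets Q = sets (quotient_borel V \<Gamma>) \<and>
     (\<forall>f F. f \<in> borel_measurable M \<longrightarrow>
        (\<forall>l \<in> geodesics V. F (orbit \<Gamma> l) = (\<integral>\<^sup>+ g. f (g \<circ> l) \<partial>count_space \<Gamma>)) \<longrightarrow>
        (\<integral>\<^sup>+ l. f l \<partial>M) = (\<integral>\<^sup>+ q. F q \<partial>Q))"

definition quotient_shift :: "(real \<Rightarrow> 'a) set \<Rightarrow> (real \<Rightarrow> 'a) set" where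
  "quotient_shift q = geodesic_shift ` q"


section \<open>Mixing, Kakutani equivalence, loosely Bernoulli systems\<close>

definition mixing :: "'a measure \<Rightarrow> ('a \<Rightarrow> 'a) \<Rightarrow> bool" where
  "mixing M T \<longleftrightarrow> (\<forall>A\<in>sets M. \<forall>B\<in>sets M.
     (\<lambda>n. measure M ((T ^^ n) -` A \<inter> B)) \<longlonglongrightarrow> measure M A * measure M B)"

definition ergodic_automorphism :: "'a measure \<Rightarrow> ('a \<Rightarrow> 'a) \<Rightarrow> bool" where
  "ergodic_automorphism M T \<longleftrightarrow> prob_space M \<and>
     T \<in> measurable M M \<and> bij_betw T (space M) (space M) \<and>
     the_inv_into (space M) T \<in> measurable M M \<and> distr M M T = M \<and>
     (\<forall>A\<in>sets M. T -` A \<inter> space M = A \<longrightarrow> measure M A = 0 \<or> measure M A = 1)"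

definition isomorphic_mod_null ::
  "'a measure \<Rightarrow> ('a \<Rightarrow> 'a) \<Rightarrow> 'b measure \<Rightarrow> ('b \<Rightarrow> 'b) \<Rightarrow> bool" where
  "isomorphic_mod_null M S N R \<longleftrightarrow> (\<exists>X\<in>sets M. \<exists>Y\<in>sets N. \<exists>\<theta>.
     space M - X \<in> null_sets M \<and> space N - Y \<in> null_sets N \<and>
     S \<in> X \<rightarrow> X \<and> R \<in> Y \<rightarrow> Y \<and> bij_betw \<theta> X Y \<and>
     \<theta> \<in> measurable (restrict_space M X) (restrict_space N Y) \<and>
     the_inv_into X \<theta> \<in> measurable (restrict_space N Y) (restrict_space M X) \<and>
     distr (restrict_space M X) (restrict_space N Y) \<theta> = restrict_space N Y \<and>
     (\<forall>x\<in>X. \<theta> (S x) = R (\<theta> x)))"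

definition induced_measure :: "'a measure \<Rightarrow> 'a set \<Rightarrow> 'a measure" where
  "induced_measure M A = scale_measure (inverse (emeasure M A)) (restrict_space M A)"

definition first_return :: "('a \<Rightarrow> 'a) \<Rightarrow> 'a set \<Rightarrow> 'a \<Rightarrow> 'a" where
  "first_return T A x = (T ^^ (LEAST n. 0 < n \<and> (T ^^ n) x \<in> A)) x"

definition kakutani_equivalent ::
  "'a measure \<Rightarrow> ('a \<Rightarrow> 'a) \<Rightarrow> 'b measure \<Rightarrow> ('b \<Rightarrow> 'b) \<Rightarrow> bool" where
  "kakutani_equivalent M S N R \<longleftrightarrow> ergodic_automorphism M S \<and> ergodic_automorphism N R \<and>
     (\<exists>A\<in>sets M. \<exists>B\<in>sets N. 0 < emeasure M A \<and> 0 < emeasure N B \<and>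
        isomorphic_mod_null (induced_measure M A) (first_return S A)
                            (induced_measure N B) (first_return R B))"

text \<open>
  A Bernoulli shift has as its base any non-trivial standard probability space; up to
  isomorphism this is a Borel probability measure on the real line.  In the theory of Kakutani
  equivalence one sometimes also calls loosely Bernoulli the zero entropy systems which are
  Kakutani equivalent to an irrational rotation; these are not included here.
\<close>

definition loosely_bernoulli :: "'a measure \<Rightarrow> ('a \<Rightarrow> 'a) \<Rightarrow> bool" where
  "loosely_bernoulli M T \<longleftrightarrow> (\<exists>P :: real measure.
     prob_space P \<and> sets P = sets borel \<and> (\<exists>A\<in>sets P. 0 < measure P A \<and> measure P A < 1) \<and>
     kakutani_equivalent M T (PiM (UNIV :: int set) (\<lambda>_. P)) (\<lambda>x i. x (i + 1)))"

end

theory Submission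
  imports Defs
begin

text \<open>
  The Markov structure of the geodesic transformation is exploited by inducing. For almost every end
  no non-trivial element of the finite stabiliser of a vertex fixes it, so there is a
  finite path \<open>c\<close> in the tree with trivial stabiliser through which lines of positive measure pass. Let
  \<open>A\<close> be the set of \<open>\<Gamma>\<close>-orbits of lines starting with \<open>c\<close>. When such a line first traverses a translate
  of \<open>c\<close> again, say \<open>g c\<close>, the element \<open>g\<close> is unique. Whether \<open>g\<close> is the first one depends only on the segment
  between \<open>c\<close> and \<open>g c\<close>, and the Bowen-Margulis measure is a product on the lines through \<open>c\<close>; by
  conformality the successive elements \<open>g\<close> are therefore independent, of law \<open>exp (- \<delta> |g|)\<close>, where \<open>|g|\<close> is the
  return time. As segments overlapping in an edge concatenate to geodesics, every two-sided sequence of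
  these elements comes from exactly one line. Hence the first return map to \<open>A\<close> is a Bernoulli shift
  on a countable alphabet, which is the required Kakutani equivalence.
\<close>

section \<open>Geometry of simplicial trees\<close>

text \<open>The obstacle is independence. Prescribing n successive symbols looks like a complicated
  condition on a line, but translates of \<open>c\<close> that prolong one another compose: the
  condition says that the line through \<open>c\<close> also traverses one single translate
  \<open>g c\<close>, with \<open>g\<close> the product of the symbols. Such a set is again a
  cylinder of lines, of mass \<open>exp (- \<delta> k)\<close> times that of the lines through
  \<open>c\<close>, where \<open>k\<close> is the total time; the exponential turns this sum of
  return times into a product. The factor comes from the forward shadow only: pulled back by
  \<open>g\<close> it is the forward shadow of \<open>c\<close>, measured from a base point
  \<open>k\<close> steps further back. That the weights sum to one is not computed, it is Poincare
  recurrence. The trivial stabiliser acts twice: it makes the symbols well defined, and it makes the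
  lines starting with \<open>c\<close> inject into the quotient, so that no multiplicity enters the
  measure of \<open>A\<close>. Mixing yields invariance and both ergodicity statements. Infinitely
  many visits in both directions single out the set on which the coding is an honest
  bijection.\<close>

definition btw :: "'a::metric_space \<Rightarrow> 'a \<Rightarrow> 'a \<Rightarrow> bool" where
  "btw x y z \<longleftrightarrow> dist x z = dist x y + dist y z"

lemma btw_sym: "btw x y z \<longleftrightarrow> btw z y x"
  by (auto simp: btw_def dist_commute)

lemma btw_refl [simp]: "btw x x z" "btw x z z"
  by (auto simp: btw_def)

lemma btw_split:
  assumes "btw x y z" "btw x w y"
  shows "btw x w z" "btw w y z"
  using assms dist_triangle[of w z y] dist_triangle[of x z w] unfolding btw_def by auto

lemma btw_split':
  assumes "btw x y z" "btw y w z"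
  shows "btw x w z" "btw x y w"
  using btw_split[of z y x w] assms by (auto simp: btw_sym)

lemma isometric_continuous: "isometric_on S f \<Longrightarrow> continuous_on S f"
  unfolding isometric_on_def continuous_on_iff by metis

lemma isometric_onD: "isometric_on S f \<Longrightarrow> x \<in> S \<Longrightarrow> y \<in> S \<Longrightarrow> dist (f x) (f y) = dist x y"
  by (simp add: isometric_on_def)

lemma isometric_on_subset: "isometric_on S f \<Longrightarrow> S' \<subseteq> S \<Longrightarrow> isometric_on S' f"
  by (auto simp: isometric_on_def)

context simplicial_tree
begin

lemma geodesic_obtain:
  obtains c where "isometric_on {0..dist x y} c" "c 0 = x" "c (dist x y) = (y::'a)"
  using geodesic by blast

text \<open>An \<open>arc\<close> is parametrised by the unit interval, so the segment is rescaled
  by its length; this makes \<open>unique_arc\<close> applicable to isometric segments.\<close>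

lemma segment_arc:
  assumes "isometric_on {0..dist x y} c" "c 0 = x" "c (dist x y) = (y::'a)" "x \<noteq> y"
  shows "\<exists>p. arc p \<and> pathstart p = x \<and> pathfinish p = y \<and> path_image p = c ` {0..dist x y}"
proof -
  define d where "d = dist x y"
  have d: "d > 0" using assms by (simp add: d_def)
  define p where "p = (\<lambda>t. c (d * t))"
  have im: "(\<lambda>t. d * t) ` {0..1} = {0..d}"
    using d by (auto simp: image_iff intro!: bexI[of _ "_ / d"] mult_left_le)
  have "continuous_on {0..1} p" unfolding p_def
    by (rule continuous_on_compose2[of "{0..d}" c])
      (use im isometric_continuous assms d_def in \<open>auto intro!: continuous_intros\<close>)
  moreover have "inj_on p {0..1}"
  proof (rule inj_onI)
    fix s t assume st: "s \<in> {0..1}" "t \<in> {0..1}" "p s = p t"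
    have "d * s \<in> {0..d}" "d * t \<in> {0..d}" using st im by blast+
    then have "dist (d * s) (d * t) = 0"
      using isometric_onD[OF assms(1), of "d * s" "d * t"] st by (simp add: p_def d_def)
    then show "s = t" using d by simp
  qed
  ultimately have "arc p" by (simp add: arc_def path_def)
  moreover have "path_image p = c ` {0..d}"
    unfolding path_image_def p_def im[symmetric] by (simp add: image_image)
  ultimately show ?thesis using assms d_def
    by (intro exI[of _ p]) (auto simp: pathstart_def pathfinish_def p_def)
qed

lemma segment_image:
  assumes "isometric_on {0..dist x y} c" "c 0 = x" "c (dist x y) = (y::'a)"
  shows "c ` {0..dist x y} = {z. btw x z y}"
proof (cases "x = y")
  case True
  then show ?thesis using assms(2) by (auto simp: btw_def dist_commute)
next
  case False
  obtain p where p: "arc p" "pathstart p = x" "pathfinish p = y" "path_image p = c ` {0..dist x y}"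
    using segment_arc[OF assms False] by blast
  have "path_image p = {z. dist x z + dist z y = dist x y}" using unique_arc[OF p(1)] unfolding p(2,3) .
  then show ?thesis unfolding p(4) btw_def by (simp only: eq_commute)
qed

lemma segment_param:
  assumes "isometric_on {0..dist x y} c" "c 0 = x" "c (dist x y) = (y::'a)" "btw x z y"
  shows "dist x z \<in> {0..dist x y}" "z = c (dist x z)"
proof -
  obtain t where t: "t \<in> {0..dist x y}" "z = c t" using segment_image[OF assms(1-3)] assms(4) by blast
  then have "dist x z = t" using assms(2) isometric_onD[OF assms(1), of 0 t] by auto
  then show "dist x z \<in> {0..dist x y}" "z = c (dist x z)" using t by auto
qed

lemma segment_dist:
  assumes "btw x z y" "btw x z' (y::'a)"
  shows "dist z z' = \<bar>dist x z - dist x z'\<bar>"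
proof -
  obtain c where c: "isometric_on {0..dist x y} c" "c 0 = x" "c (dist x y) = y"
    by (rule geodesic_obtain)
  from segment_image[OF c] assms obtain t t' where
    t: "t \<in> {0..dist x y}" "z = c t" "t' \<in> {0..dist x y}" "z' = c t'" by (smt (verit) imageE mem_Collect_eq)
  then have "dist x z = t" "dist x z' = t'" "dist z z' = \<bar>t - t'\<bar>"
    using c isometric_onD[OF c(1), of 0 t] isometric_onD[OF c(1), of 0 t']
      isometric_onD[OF c(1), of t t'] by (auto simp: dist_real_def)
  then show ?thesis by simp
qed

lemma segment_unique:
  assumes "btw x z y" "btw x z' (y::'a)" "dist x z = dist x z'"
  shows "z = z'"
  using segment_dist[OF assms(1,2)] assms(3) by simp

lemma segment_exists:
  assumes "0 \<le> t" "t \<le> dist x (y::'a)"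
  shows "\<exists>z. btw x z y \<and> dist x z = t"
proof -
  obtain c where c: "isometric_on {0..dist x y} c" "c 0 = x" "c (dist x y) = y"
    by (rule geodesic_obtain)
  have "c t \<in> {z. btw x z y}" unfolding segment_image[OF c, symmetric] using assms by auto
  moreover have "dist x (c t) = t" using isometric_onD[OF c(1), of 0 t] c assms by auto
  ultimately show ?thesis by auto
qed

text \<open>Two segments that meet only in \<open>y\<close> concatenate to an arc, and
  \<open>unique_arc\<close> forces every point of that arc, \<open>y\<close> included, onto the
  geodesic.\<close>

lemma btw_join:
  assumes "\<And>p. btw x p y \<Longrightarrow> btw y p z \<Longrightarrow> p = (y::'a)"
  shows "btw x y z"
proof (cases "x = y \<or> y = z")
  case False
  obtain c where c: "isometric_on {0..dist x y} c" "c 0 = x" "c (dist x y) = y"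
    by (rule geodesic_obtain)
  obtain c' where c': "isometric_on {0..dist y z} c'" "c' 0 = y" "c' (dist y z) = z"
    by (rule geodesic_obtain)
  obtain p where p: "arc p" "pathstart p = x" "pathfinish p = y" "path_image p = c ` {0..dist x y}"
    using segment_arc[OF c] False by blast
  obtain q where q: "arc q" "pathstart q = y" "pathfinish q = z" "path_image q = c' ` {0..dist y z}"
    using segment_arc[OF c'] False by blast
  have "path_image p \<inter> path_image q \<subseteq> {pathstart q}"
    unfolding p(4) q(4) segment_image[OF c] segment_image[OF c'] using assms q by auto
  then have a: "arc (p +++ q)" using p q by (intro arc_join) auto
  have "y \<in> path_image (p +++ q)"
    using p q by (metis UnI2 path_image_join pathstart_in_path_image)
  then show ?thesis using unique_arc[OF a] p q by (auto simp: btw_def)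
qed auto

text \<open>The local-to-global principle on which all later concatenations rest; the overlap
  \<open>[b, c]\<close> must be non-degenerate. If \<open>[c, a]\<close> and \<open>[c, d]\<close>
  shared a point besides \<open>c\<close>, they would share an initial piece of
  \<open>[c, b]\<close>, and the way from \<open>b\<close> to \<open>d\<close> could be cut short
  there.\<close>

lemma btw_local_global:
  assumes ab: "btw a b c" and bc: "btw b c d" and ne: "b \<noteq> (c::'a)"
  shows "btw a c d"
proof (rule btw_join, rule ccontr)
  fix p assume p: "btw a p c" "btw c p d" "p \<noteq> c"
  \<comment> \<open>\<open>e\<close> is bounded by both lengths so that \<open>[c, b]\<close> and
    \<open>[c, p]\<close> each have a point at distance \<open>e\<close> from \<open>c\<close>. Both
    points lie on \<open>[c, a]\<close>, hence they coincide.\<close>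
  define e where "e = min (dist c p) (dist c b)"
  have e: "e > 0" "e \<le> dist c p" "e \<le> dist c b" using p ne by (auto simp: e_def)
  obtain q where q: "btw c q b" "dist c q = e" using segment_exists[of e c b] e by auto
  obtain q' where q': "btw c q' p" "dist c q' = e" using segment_exists[of e c p] e by auto
  have "btw c q a" using btw_split[of c b a q] ab q by (simp add: btw_sym)
  moreover have "btw c q' a" using btw_split[of c p a q'] p q' by (simp add: btw_sym)
  ultimately have eq: "q = q'" using segment_unique q q' by simp
  have "btw c q d" using btw_split[of c p d q] p q' eq by simp
  then have "dist b d < dist b c + dist c d"
    using q e dist_triangle[of b d q] by (auto simp: btw_def dist_commute)
  then show False using bc by (simp add: btw_def)
qed

lemma btw_local_global':
  assumes "btw a b c" "btw b c d" "b \<noteq> (c::'a)"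
  shows "btw a b d"
  using btw_local_global[OF assms] assms(1) btw_split(1) by blast

text \<open>The open part of a unit segment issued from a vertex avoids \<open>V\<close> because
  vertices are 1-separated; being connected, it lies in one open edge. The starting vertex must then
  be an end of that edge, so the segment is the edge, run through in one of its two
  directions.\<close>

lemma edge_component:
  assumes c: "isometric_on {0..1::real} c" and c0: "c 0 \<in> V"
  shows "c 1 \<in> V" "c ` {0<..<1} \<in> components (- V)"
proof -
  have cont: "continuous_on {0..1} c" using c isometric_continuous by blast
  have sub: "c ` {0<..<1} \<subseteq> - V"
  proof
    fix z assume "z \<in> c ` {0<..<1}"
    then obtain t where t: "0 < t" "t < 1" "z = c t" by auto
    then have "dist (c 0) z = t" using isometric_onD[OF c, of 0 t] by auto
    then show "z \<in> - V" using vertices_separated[OF c0, of z] t by (cases "c 0 = z") auto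
  qed
  have con: "connected (c ` {0<..<1})"
    by (rule connected_continuous_image)
      (auto intro: continuous_on_subset[OF cont])
  have ne: "c ` {0<..<1} \<noteq> {}" by auto
  have "- V \<noteq> {}" using sub ne by blast
  then obtain C where C: "C \<in> components (- V)" "c ` {0<..<1} \<subseteq> C"
    using exists_component_superset[OF sub _ con] by blast
  obtain e where e: "isometric_on {0..1::real} e" "e 0 \<in> V" "e 1 \<in> V" "C = e ` {0<..<1}"
    using open_edges[OF C(1)] by blast
  have "closed (e ` {0..1})"
    by (intro compact_imp_closed compact_continuous_image isometric_continuous e) auto
  then have "c ` closure {0<..<1} \<subseteq> e ` {0..1}"
    using C(2) e(4) cont by (intro image_closure_subset) auto
  then have im: "c ` {0..1} \<subseteq> e ` {0..1}" by simp
  have CV: "C \<inter> V = {}" using in_components_subset[OF C(1)] by auto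
  from im obtain u where u: "u \<in> {0..1}" "c 0 = e u" by force
  have "u = 0 \<or> u = 1"
  proof (rule ccontr)
    assume "\<not> ?thesis"
    then have "e u \<in> C" using u e(4) by auto
    then show False using CV c0 u by auto
  qed
  then consider "\<forall>t\<in>{0..1}. c t = e t" | "\<forall>t\<in>{0..1}. c t = e (1 - t)"
  proof
    assume u0: "u = 0"
    have "c t = e t" if t: "t \<in> {0..1}" for t
    proof -
      obtain s where s: "s \<in> {0..1}" "c t = e s" using im t by blast
      then have "s = t" using isometric_onD[OF e(1), of 0 s] isometric_onD[OF c, of 0 t] u u0 t by auto
      then show ?thesis using s by simp
    qed
    then show ?thesis using that by blast
  next
    assume u1: "u = 1"
    have "c t = e (1 - t)" if t: "t \<in> {0..1}" for t
    proof -
      obtain s where s: "s \<in> {0..1}" "c t = e s" using im t by blast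
      then have "s = 1 - t" using isometric_onD[OF e(1), of 1 s] isometric_onD[OF c, of 0 t] u u1 t
        by (auto simp: dist_real_def)
      then show ?thesis using s by simp
    qed
    then show ?thesis using that by blast
  qed
  then have "c 1 \<in> V \<and> c ` {0<..<1} = C"
  proof cases
    case 1
    then show ?thesis using e by (auto simp: image_iff)
  next
    case 2
    then have "c ` {0<..<1} = e ` (\<lambda>t. 1 - t) ` {0<..<1}" by (auto simp: image_image)
    also have "(\<lambda>t::real. 1 - t) ` {0<..<1} = {0<..<1}"
      by (auto simp: image_iff intro!: bexI[of _ "1 - _"])
    finally show ?thesis using 2 e by auto
  qed
  then show "c 1 \<in> V" "c ` {0<..<1} \<in> components (- V)" using C by auto
qed

text \<open>A common point of the two unit segments other than \<open>y\<close> would be a common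
  far end or a common interior point. In the latter case both are the same component of the
  complement of \<open>V\<close>; either way \<open>z = z'\<close>.\<close>

lemma neighbours_btw:
  assumes y: "y \<in> V" and z: "dist y z = 1" "dist y z' = 1" "z \<noteq> z'"
  shows "btw z y z'"
proof (rule btw_join, rule ccontr)
  fix p assume p: "btw z p y" "btw y p z'" "p \<noteq> y"
  obtain c where c: "isometric_on {0..dist y z} c" "c 0 = y" "c (dist y z) = z"
    by (rule geodesic_obtain)
  obtain c' where c': "isometric_on {0..dist y z'} c'" "c' 0 = y" "c' (dist y z') = z'"
    by (rule geodesic_obtain)
  define s where "s = dist y p"
  have s: "s \<in> {0..1}" "p = c s" "p = c' s"
    using segment_param[OF c, of p] segment_param[OF c', of p] p z by (auto simp: s_def btw_sym)
  have E: "c ` {0<..<1} \<in> components (- V)" "c' ` {0<..<1} \<in> components (- V)"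
    using edge_component[of c] edge_component[of c'] c c' y z by auto
  show False
  proof (cases "s = 1")
    case True
    then show False using s c c' z by auto
  next
    case False
    then have "s \<in> {0<..<1}" using s(1) p(3) by (auto simp: less_le s_def)
    then have "c ` {0<..<1} \<inter> c' ` {0<..<1} \<noteq> {}" using s by blast
    then have ceq: "c ` {0<..<1} = c' ` {0<..<1}" using components_nonoverlap[OF E] by blast
    have "closed (c' ` {0..1})"
      using c' z by (intro compact_imp_closed compact_continuous_image isometric_continuous) auto
    moreover have "continuous_on (closure {0<..<1}) c" using c(1) z isometric_continuous by simp
    moreover have "c ` {0<..<1} \<subseteq> c' ` {0..1}" unfolding ceq by (intro image_mono) auto
    ultimately have "c ` closure {0<..<1} \<subseteq> c' ` {0..1}" by (intro image_closure_subset)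
    moreover have "c 1 \<in> c ` closure {0<..<1}" by simp
    ultimately obtain u where "u \<in> {0..1}" "c 1 = c' u" by blast
    then have "z = z'"
      using isometric_onD[OF c'(1), of 0 u] c c' z by auto
    then show False using z by simp
  qed
qed

section \<open>Vertices at integer distances, and geodesic lines\<close>

lemma vertex_step:
  assumes "isometric_on {a..a + 1::real} c" "c a \<in> V"
  shows "c (a + 1) \<in> V"
proof -
  have "isometric_on {0..1} (\<lambda>t. c (a + t))"
    using assms(1) by (auto simp: isometric_on_def dist_real_def)
  then show ?thesis using edge_component(1)[of "\<lambda>t. c (a + t)"] assms(2) by simp
qed

lemma vertex_nat:
  assumes "isometric_on {a..b::real} c" "c a \<in> V" "a + real n \<le> b"
  shows "c (a + real n) \<in> V"
  using assms(3)
proof (induction n)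
  case (Suc n)
  have "c ((a + real n) + 1) \<in> V"
    by (rule vertex_step) (use Suc assms in \<open>auto intro: isometric_on_subset\<close>)
  then show ?case by (simp add: algebra_simps)
qed (use assms in simp)

lemma vertex_between:
  assumes "x \<in> V" "btw x z y" "dist x z = real n"
  shows "z \<in> V"
proof -
  obtain c where c: "isometric_on {0..dist x y} c" "c 0 = x" "c (dist x y) = y"
    by (rule geodesic_obtain)
  have "z = c (real n)" "real n \<le> dist x y" using segment_param[OF c assms(2)] assms(3) by auto
  then show ?thesis using vertex_nat[OF c(1), of n] c assms by auto
qed

lemma vertex_dist:
  assumes "x \<in> V" "y \<in> V"
  shows "\<exists>n. dist x y = real n"
proof -
  define n where "n = nat \<lfloor>dist x y\<rfloor>"
  have n: "real n \<le> dist x y" "dist x y < real n + 1"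
    unfolding n_def using zero_le_dist[of x y] by linarith+
  obtain z where z: "btw x z y" "dist x z = real n" using segment_exists[of "real n" x y] n by auto
  then have "z \<in> V" using vertex_between assms by blast
  moreover have "dist z y < 1" using z n by (simp add: btw_def)
  ultimately have "z = y" using vertices_separated[of z y] assms by force
  then show ?thesis using z by auto
qed

text \<open>Consecutive triples are geodesic by \<open>neighbours_btw\<close>;
  \<open>btw_local_global\<close> then prolongs by one vertex at a time, the overlap being the last
  edge.\<close>

lemma nonbacktracking_geodesic:
  fixes v :: "int \<Rightarrow> 'a"
  assumes V: "\<And>i. v i \<in> V" and d: "\<And>i. dist (v i) (v (i + 1)) = 1" and nb: "\<And>i. v i \<noteq> v (i + 2)"
  shows "dist (v i) (v j) = \<bar>of_int (i - j)\<bar>"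
proof -
  have b: "btw (v i) (v (i + 1)) (v (i + 2))" for i
    using neighbours_btw[of "v (i + 1)" "v i" "v (i + 2)"] V d[of i] d[of "i + 1"] nb[of i]
    by (simp add: dist_commute add.assoc)
  have *: "btw (v i) (v (i + int n)) (v (i + int n + 1)) \<and> dist (v i) (v (i + int n)) = real n" for i n
  proof (induction n)
    case (Suc n)
    have "btw (v i) (v (i + int n + 1)) (v (i + int n + 2))"
      by (rule btw_local_global[of _ "v (i + int n)"])
        (use Suc b[of "i + int n"] d[of "i + int n"] in auto)
    then show ?case using Suc d[of "i + int n"] by (simp add: btw_def add.assoc algebra_simps)
  qed simp
  have "dist (v i) (v j) = of_int (j - i)" if "i \<le> j" for i j
    using *[of i "nat (j - i)"] that by simp
  then show ?thesis by (smt (verit) dist_commute of_int_minus of_int_0_le_iff abs_of_nonneg abs_minus_commute of_int_diff)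
qed

lemma geodesicsD:
  assumes "l \<in> geodesics V"
  shows "dist (l s) (l t) = \<bar>s - t\<bar>" "l (of_int i) \<in> V"
proof -
  have iso: "isometric_on UNIV l" and l0: "l 0 \<in> V" using assms by (auto simp: geodesics_def)
  show d: "dist (l s) (l t) = \<bar>s - t\<bar>" for s t
    using isometric_onD[OF iso, of s t] by (simp add: dist_real_def)
  show "l (of_int i) \<in> V"
  proof (cases "i \<ge> 0")
    case True
    have "l (0 + real (nat i)) \<in> V"
      by (rule vertex_nat[of _ "of_int i"]) (use True l0 iso in \<open>auto intro: isometric_on_subset\<close>)
    then show ?thesis using True by simp
  next
    case False
    have "(\<lambda>t. l (- t)) (0 + real (nat (- i))) \<in> V"
      by (rule vertex_nat[of _ "of_int (- i)"]) (use False l0 d in \<open>auto simp: isometric_on_def dist_real_def\<close>)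
    then show ?thesis using False by simp
  qed
qed

lemma geodesic_btw: "l \<in> geodesics V \<Longrightarrow> a \<le> t \<Longrightarrow> t \<le> b \<Longrightarrow> btw (l a) (l t) (l b)"
  by (simp add: btw_def geodesicsD)

lemma geodesic_vertex_int:
  assumes "l \<in> geodesics V" "l t \<in> V"
  shows "\<exists>i. t = of_int i"
proof -
  have "dist (l t) (l (of_int \<lfloor>t\<rfloor>)) < 1" using assms geodesicsD(1)[OF assms(1)]
    by (simp add: abs_if) linarith
  then have "l t = l (of_int \<lfloor>t\<rfloor>)"
    using vertices_separated[OF assms(2) geodesicsD(2)[OF assms(1), of "\<lfloor>t\<rfloor>"]] by force
  then have "dist (l t) (l (of_int \<lfloor>t\<rfloor>)) = 0" by simp
  then show ?thesis using geodesicsD(1)[OF assms(1)] by auto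
qed

lemma geodesics_eq_between:
  assumes "l \<in> geodesics V" "l' \<in> geodesics V" "l a = l' a'" "l b = l' b'" "b - a = b' - a'"
    "a \<le> t" "t \<le> b"
  shows "l t = l' (t - a + a')"
proof (rule segment_unique)
  show "btw (l a) (l t) (l b)" using geodesic_btw assms by blast
  show "btw (l a) (l' (t - a + a')) (l b)" unfolding assms using assms by (intro geodesic_btw) auto
  have "dist (l a) (l t) = t - a" using geodesicsD(1)[OF assms(1), of a t] assms(6) by linarith
  moreover have "dist (l a) (l' (t - a + a')) = t - a"
    unfolding assms(3) using geodesicsD(1)[OF assms(2), of a' "t - a + a'"] assms(6) by linarith
  ultimately show "dist (l a) (l t) = dist (l a) (l' (t - a + a'))" by simp
qed

lemma geodesic_reparam:
  assumes "l \<in> geodesics V"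
  shows "(\<lambda>t. l (t + of_int i)) \<in> geodesics V"
  using assms geodesicsD[OF assms] by (auto simp: geodesics_def isometric_on_def dist_real_def)

text \<open>Serves twice: with \<open>\<tau>\<close> the identity, for the line joining two ends,
  and with \<open>\<tau>\<close> the accumulated return times, for the line of a prescribed
  code.\<close>

lemma geodesic_of_points:
  fixes x :: "int \<Rightarrow> 'a" and \<tau> :: "int \<Rightarrow> int"
  assumes d: "\<And>i j. dist (x i) (x j) = \<bar>of_int (\<tau> i - \<tau> j)\<bar>" and mono: "\<And>i. \<tau> i < \<tau> (i + 1)" and "x 0 \<in> V"
  shows "\<exists>l\<in>geodesics V. \<forall>i. l (of_int (\<tau> i)) = x i"
proof -
  have grow: "\<tau> i + (j - i) \<le> \<tau> j" if "i \<le> j" for i j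
    using that
  proof (induction j rule: int_ge_induct)
    case (step j)
    then show ?case using mono[of j] by simp
  qed simp
  have ordered: "\<tau> i \<le> \<tau> j \<longleftrightarrow> i \<le> j" "\<tau> i < \<tau> j \<longleftrightarrow> i < j" for i j
    using grow[of i j] grow[of j i] by (cases "i < j"; cases "i = j"; simp)+
  have ex: "\<exists>i. of_int (\<tau> i) \<le> t \<and> t < of_int (\<tau> (i + 1))" for t :: real
  proof (rule ccontr)
    assume "\<not> ?thesis"
    then have st: "of_int (\<tau> i) \<le> t \<Longrightarrow> of_int (\<tau> (i + 1)) \<le> t" for i using not_le by blast
    define a where "a = min 0 (\<lfloor>t\<rfloor> - \<tau> 0)"
    define b where "b = max 0 (\<lceil>t\<rceil> + 1 - \<tau> 0)"
    have "\<tau> a \<le> \<lfloor>t\<rfloor>" "\<lceil>t\<rceil> + 1 \<le> \<tau> b" using grow[of a 0] grow[of 0 b] by (auto simp: a_def b_def)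
    then have "of_int (\<tau> a) \<le> t" "t < of_int (\<tau> b)" by linarith+
    have "a \<le> b" by (simp add: a_def b_def)
    then have "of_int (\<tau> b) \<le> t"
    proof (induction b rule: int_ge_induct)
      case base show ?case by fact
    next
      case (step i) then show ?case using st by blast
    qed
    then show False using \<open>t < of_int (\<tau> b)\<close> by linarith
  qed
  \<comment> \<open>The point at time \<open>t\<close> is taken on the segment between the two given
    points around \<open>t\<close>. The triangle inequality then forces its distances to all given
    points, so that any two chosen points lie on one segment and \<open>segment_dist\<close> makes
    the curve isometric.\<close>
  have "\<exists>z. \<forall>a b. of_int (\<tau> a) \<le> t \<and> t \<le> of_int (\<tau> b) \<longrightarrow>
      dist (x a) z = t - of_int (\<tau> a) \<and> dist z (x b) = of_int (\<tau> b) - t" for t :: real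
  proof -
    obtain n where n: "of_int (\<tau> n) \<le> t" "t < of_int (\<tau> (n + 1))" using ex[of t] by blast
    have dn: "dist (x n) (x (n + 1)) = of_int (\<tau> (n + 1)) - of_int (\<tau> n)" using d[of n "n + 1"] mono[of n] by simp
    obtain z where z: "btw (x n) z (x (n + 1))" "dist (x n) z = t - of_int (\<tau> n)"
      using segment_exists[of "t - of_int (\<tau> n)" "x n" "x (n + 1)"] dn n by auto
    have z2: "dist z (x (n + 1)) = of_int (\<tau> (n + 1)) - t" using z dn by (simp add: btw_def)
    have "dist (x a) z = t - of_int (\<tau> a) \<and> dist z (x b) = of_int (\<tau> b) - t"
      if ab: "of_int (\<tau> a) \<le> t" "t \<le> of_int (\<tau> b)" for a b
    proof (cases "t = of_int (\<tau> b)")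
      case True
      then have "\<tau> n \<le> \<tau> b" "\<tau> b < \<tau> (n + 1)" using n by auto
      then have "b = n" unfolding ordered by simp
      then have "z = x b" using z True by simp
      then show ?thesis using d[of a b] ab True by auto
    next
      case False
      then have "\<tau> n < \<tau> b" "\<tau> a < \<tau> (n + 1)" using ab n by linarith+
      then have "n + 1 \<le> b" "a \<le> n" unfolding ordered by simp_all
      then have "\<tau> (n + 1) \<le> \<tau> b" "\<tau> a \<le> \<tau> n" unfolding ordered by simp_all
      then have "dist (x a) (x b) = of_int (\<tau> b) - of_int (\<tau> a)" "dist (x a) (x n) = of_int (\<tau> n) - of_int (\<tau> a)"
        "dist (x (n + 1)) (x b) = of_int (\<tau> b) - of_int (\<tau> (n + 1))"
        using d[of a b] d[of a n] d[of "n + 1" b] mono[of n] by auto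
      then show ?thesis
        using dist_triangle[of "x a" z "x n"] dist_triangle[of z "x b" "x (n + 1)"]
          dist_triangle[of "x a" "x b" z] z z2 by auto
    qed
    then show ?thesis by blast
  qed
  then have "\<forall>t. \<exists>z. \<forall>a b. of_int (\<tau> a) \<le> t \<and> t \<le> of_int (\<tau> b) \<longrightarrow>
      dist (x a) z = t - of_int (\<tau> a) \<and> dist z (x b) = of_int (\<tau> b) - t"
    by blast
  then obtain l where l': "\<forall>t. \<forall>a b. of_int (\<tau> a) \<le> t \<and> t \<le> of_int (\<tau> b) \<longrightarrow>
      dist (x a) (l t) = t - of_int (\<tau> a) \<and> dist (l t) (x b) = of_int (\<tau> b) - t"
    by (rule choice[THEN exE])
  have l: "dist (x a) (l t) = t - of_int (\<tau> a) \<and> dist (l t) (x b) = of_int (\<tau> b) - t"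
    if "of_int (\<tau> a) \<le> t" "t \<le> of_int (\<tau> b)" for t a b
    using l' that by blast
  have v: "l (of_int (\<tau> i)) = x i" for i
    using conjunct1[OF l[of i "of_int (\<tau> i)" i]] by (simp del: of_int_diff)
  have iso: "dist (l s) (l t) = \<bar>s - t\<bar>" for s t
  proof -
    obtain a where a: "of_int (\<tau> a) \<le> min s t" using ex[of "min s t"] by blast
    obtain b where b: "max s t < of_int (\<tau> (b + 1))" using ex[of "max s t"] by blast
    have ab: "of_int (\<tau> a) \<le> s" "of_int (\<tau> a) \<le> t" "s \<le> of_int (\<tau> (b + 1))" "t \<le> of_int (\<tau> (b + 1))"
      using a b by linarith+
    then have "dist (x a) (x (b + 1)) = of_int (\<tau> (b + 1)) - of_int (\<tau> a)" using d[of a "b + 1"] by simp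
    then have "btw (x a) (l s) (x (b + 1))" "btw (x a) (l t) (x (b + 1))" using l ab by (simp_all add: btw_def)
    from segment_dist[OF this] show ?thesis using l ab by simp
  qed
  \<comment> \<open>Only the point at time \<open>\<tau> 0\<close> is known to be a vertex, while a
    geodesic must have one at time 0; the line is shifted there and shifted back by
    \<open>geodesic_reparam\<close>.\<close>
  define l2 where "l2 = (\<lambda>t. l (t + of_int (\<tau> 0)))"
  have "l2 \<in> geodesics V"
    using iso v[of 0] assms(3) by (simp add: l2_def geodesics_def isometric_on_def dist_real_def)
  from geodesic_reparam[OF this, of "- \<tau> 0"] have "l \<in> geodesics V" by (simp add: l2_def)
  then show ?thesis using v by blast
qed

end

section \<open>Ends, rays and lines\<close>

lemma geodesic_raysD: "r \<in> geodesic_rays \<Longrightarrow> s \<ge> 0 \<Longrightarrow> t \<ge> 0 \<Longrightarrow> dist (r s) (r t) = \<bar>s - t\<bar>"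
  by (simp add: geodesic_rays_def isometric_on_def dist_real_def)

lemma cofinalI:
  assumes "r \<in> geodesic_rays" "s \<in> geodesic_rays" "a \<ge> 0" "b \<ge> 0" "\<And>t. t \<ge> 0 \<Longrightarrow> r (a + t) = s (b + t)"
  shows "(r, s) \<in> cofinal_rays"
  using assms unfolding cofinal_rays_def by blast

lemma equiv_cofinal_rays: "equiv geodesic_rays cofinal_rays"
proof (rule equivI)
  show "cofinal_rays \<subseteq> geodesic_rays \<times> geodesic_rays"
    by (auto simp: cofinal_rays_def)
  show "refl_on geodesic_rays cofinal_rays"
    by (auto simp: cofinal_rays_def refl_on_def)
  show "sym cofinal_rays"
    by (auto simp: cofinal_rays_def sym_def) metis+
  show "trans cofinal_rays"
  proof (rule transI)
    fix r s u assume "(r, s) \<in> cofinal_rays" "(s, u) \<in> cofinal_rays"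
    then obtain a b c d where g: "r \<in> geodesic_rays" "u \<in> geodesic_rays"
      and p: "a \<ge> 0" "b \<ge> 0" "c \<ge> 0" "d \<ge> 0"
      and rs: "\<And>t. t \<ge> 0 \<Longrightarrow> r (a + t) = s (b + t)" and su: "\<And>t. t \<ge> 0 \<Longrightarrow> s (c + t) = u (d + t)"
      unfolding cofinal_rays_def by blast
    have "r ((a + c) + t) = u ((b + d) + t)" if "t \<ge> 0" for t
      using rs[of "c + t"] su[of "b + t"] that p by (simp add: algebra_simps)
    then show "(r, u) \<in> cofinal_rays"
      using g p by (intro cofinalI[of r u "a + c" "b + d"]) auto
  qed
qed

lemma end_of_in_ends: "r \<in> geodesic_rays \<Longrightarrow> end_of r \<in> ends"
  unfolding end_of_def ends_def by (rule quotientI)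

lemma mem_end_of_iff: "s \<in> end_of r \<longleftrightarrow> (r, s) \<in> cofinal_rays"
  by (simp add: end_of_def)

lemma mem_end_of: "r \<in> geodesic_rays \<Longrightarrow> r \<in> end_of r"
  using equiv_class_self[OF equiv_cofinal_rays] by (simp add: end_of_def)

lemma end_member:
  assumes "\<xi> \<in> ends" "r \<in> \<xi>"
  shows "r \<in> geodesic_rays" "end_of r = \<xi>"
proof -
  show r: "r \<in> geodesic_rays" using assms in_quotient_imp_subset[OF equiv_cofinal_rays] unfolding ends_def by blast
  show "end_of r = \<xi>"
    using quotient_eqI[OF equiv_cofinal_rays, of "end_of r" \<xi> r r] end_of_in_ends[OF r] mem_end_of[OF r] assms
      equiv_class_self[OF equiv_cofinal_rays r]
    unfolding ends_def by blast
qed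

lemma ends_nonempty: "\<xi> \<in> ends \<Longrightarrow> \<exists>r. r \<in> \<xi>"
  using in_quotient_imp_non_empty[OF equiv_cofinal_rays] unfolding ends_def by blast

lemma ends_eqI:
  assumes "\<xi> \<in> ends" "\<eta> \<in> ends" "r \<in> \<xi>" "s \<in> \<eta>" "(r, s) \<in> cofinal_rays"
  shows "\<xi> = \<eta>"
  using quotient_eqI[OF equiv_cofinal_rays] assms unfolding ends_def by blast

lemma mem_end_cofinal:
  assumes "\<xi> \<in> ends" "r \<in> \<xi>" "s \<in> \<xi>"
  obtains a b where "a \<ge> 0" "b \<ge> 0" "\<And>t. t \<ge> 0 \<Longrightarrow> r (a + t) = s (b + t)"
proof -
  have "(r, s) \<in> cofinal_rays" using end_member[OF assms(1,2)] assms(3) mem_end_of_iff by blast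
  then show ?thesis using that unfolding cofinal_rays_def by blast
qed

lemma mem_endI:
  assumes "\<xi> \<in> ends" "r \<in> \<xi>" "s \<in> geodesic_rays" "a \<ge> 0" "b \<ge> 0" "\<And>t. t \<ge> 0 \<Longrightarrow> r (a + t) = s (b + t)"
  shows "s \<in> \<xi>"
  using cofinalI[OF _ assms(3-5)] end_member[OF assms(1,2)] assms(6) mem_end_of_iff by metis

lemma end_of_eqI:
  assumes "r \<in> geodesic_rays" "s \<in> geodesic_rays" "a \<ge> 0" "b \<ge> 0" "\<And>t. t \<ge> 0 \<Longrightarrow> r (a + t) = s (b + t)"
  shows "end_of r = end_of s"
  unfolding end_of_def using equiv_class_eq[OF equiv_cofinal_rays cofinalI[OF assms]] .

text \<open>Only the values at non-negative times are meaningful: there all representatives of the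
  end that start in \<open>x\<close> agree, whereas the choice is arbitrary at negative
  times.\<close>

definition ray :: "'a::metric_space \<Rightarrow> 'a tree_end \<Rightarrow> real \<Rightarrow> 'a" where
  "ray x \<xi> = (SOME r. r \<in> \<xi> \<and> r 0 = x)"

definition shadow :: "'a::metric_space \<Rightarrow> 'a \<Rightarrow> 'a tree_end set" where
  "shadow x y = {\<xi> \<in> ends. y \<in> ray_to x \<xi>}"

context simplicial_tree
begin

lemma rays_eq_of_nat:
  assumes r: "r \<in> geodesic_rays" and s: "s \<in> geodesic_rays" and eq: "\<And>n. r (real n) = s (real n :: real) " and "t \<ge> 0"
  shows "r t = (s t :: 'a)"
proof (rule segment_unique)
  have n: "t \<le> real (nat \<lceil>t\<rceil>)" by (simp add: real_nat_ceiling_ge)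
  show "btw (r 0) (r t) (r (real (nat \<lceil>t\<rceil>)))"
    using n assms geodesic_raysD[OF r] by (simp add: btw_def)
  show "btw (r 0) (s t) (r (real (nat \<lceil>t\<rceil>)))"
    unfolding eq eq[of 0, simplified] using n assms geodesic_raysD[OF s] by (simp add: btw_def)
  have "dist (r 0) (s t) = dist (s 0) (s t)" using eq[of 0] by simp
  then show "dist (r 0) (r t) = dist (r 0) (s t)"
    using assms geodesic_raysD[OF r, of 0 t] geodesic_raysD[OF s, of 0 t] by simp
qed

text \<open>\<open>s\<close> is the last time at which the ray lies on the segment from
  \<open>x\<close> to \<open>r 0\<close>, that is, the projection of \<open>x\<close> to the ray.
  Beyond it the two paths meet only in \<open>r s\<close>, which is the hypothesis of
  \<open>btw_join\<close>.\<close>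

lemma ray_projection:
  assumes r: "r \<in> geodesic_rays"
  shows "\<exists>s\<ge>0. \<forall>t\<ge>s. btw x (r s) (r t :: 'a)"
proof -
  define J where "J = {t \<in> {0..dist x (r 0)}. btw x (r t) (r 0)}"
  have cont: "continuous_on {0..} r" using r isometric_continuous by (auto simp: geodesic_rays_def)
  have "J = {t \<in> {0..dist x (r 0)}. dist x (r t) + dist (r t) (r 0) = dist x (r 0)}"
    by (auto simp: J_def btw_def)
  moreover have "closed \<dots>"
    by (intro continuous_closed_preimage_constant continuous_intros continuous_on_subset[OF cont]) auto
  ultimately have "closed J" by simp
  moreover have "bounded J" unfolding J_def by (rule bounded_subset[of "{0..dist x (r 0)}"]) auto
  ultimately have cJ: "compact J" by (simp add: compact_eq_bounded_closed)
  have "0 \<in> J" by (simp add: J_def)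
  then obtain s where s: "s \<in> J" "\<And>t. t \<in> J \<Longrightarrow> t \<le> s"
    using compact_attains_sup[OF cJ] by blast
  have s0: "s \<ge> 0" using s by (simp add: J_def)
  have "btw x (r s) (r t)" if t: "t \<ge> s" for t
  proof (rule btw_join)
    fix p assume p: "btw x p (r s)" "btw (r s) p (r t)"
    define u where "u = s + dist (r s) p"
    have dst: "dist (r s) (r t) = t - s" using geodesic_raysD[OF r] s0 t by auto
    then have u: "s \<le> u" "u \<le> t" using p(2) unfolding btw_def u_def using zero_le_dist[of "r s" p] zero_le_dist[of p "r t"] by linarith+
    have "p = r u"
    proof (rule segment_unique[OF p(2)])
      show "btw (r s) (r u) (r t)" using u s0 geodesic_raysD[OF r] by (simp add: btw_def)
      show "dist (r s) p = dist (r s) (r u)" using u s0 geodesic_raysD[OF r, of s u] by (simp add: u_def)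
    qed
    then have "btw x (r u) (r 0)" using btw_split(1)[of x "r s" "r 0" p] p s(1) by (simp add: J_def)
    moreover have "u \<le> dist x (r 0)"
      using calculation geodesic_raysD[OF r, of u 0] u s0 by (simp add: btw_def)
    ultimately have "u \<in> J" using u s0 by (simp add: J_def)
    then have "u = s" using s(2) u by force
    then show "p = r s" using \<open>p = r u\<close> by simp
  qed
  then show ?thesis using s0 by blast
qed

text \<open>The segment from \<open>x\<close> to its projection on some ray of the end is followed
  by the tail of that ray.\<close>

lemma ray_exists:
  assumes "\<xi> \<in> ends"
  shows "\<exists>r\<in>\<xi>. r 0 = (x::'a)"
proof -
  obtain r where r: "r \<in> \<xi>" using ends_nonempty[OF assms] by blast
  have rr: "r \<in> geodesic_rays" using end_member[OF assms r] by blast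
  obtain s where s: "s \<ge> 0" "\<And>t. t \<ge> s \<Longrightarrow> btw x (r s) (r t)" using ray_projection[OF rr] by blast
  define D where "D = dist x (r s)"
  obtain c where c: "isometric_on {0..D} c" "c 0 = x" "c D = r s"
    unfolding D_def by (rule geodesic_obtain)
  define r' where "r' t = (if t \<le> D then c t else r (s + t - D))" for t
  have D: "D \<ge> 0" by (simp add: D_def)
  have mixed: "dist (r' u) (r' t) = t - u" if "0 \<le> u" "u \<le> D" "D < t" for u t
  proof -
    have "btw x (r s) (r (s + t - D))" using s that by simp
    moreover have "dist (r s) (r (s + t - D)) = t - D" using geodesic_raysD[OF rr] s that D by simp
    moreover have "dist x (c u) = u" "dist (c u) (r s) = D - u"
      using isometric_onD[OF c(1), of 0 u] isometric_onD[OF c(1), of u D] c that D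
      by (auto simp: dist_real_def)
    ultimately show ?thesis
      using dist_triangle[of x "r (s + t - D)" "c u"] dist_triangle[of "c u" "r (s + t - D)" "r s"] that
      by (simp add: r'_def btw_def D_def)
  qed
  have "dist (r' u) (r' t) = dist u t" if ut: "u \<ge> 0" "t \<ge> 0" for u t
  proof -
    consider "u \<le> D" "t \<le> D" | "u \<le> D" "t > D" | "u > D" "t \<le> D" | "u > D" "t > D" by linarith
    then show ?thesis
    proof cases
      case 1 then show ?thesis using ut isometric_onD[OF c(1), of u t] by (simp add: r'_def)
    next
      case 2 then show ?thesis using ut mixed by (simp add: dist_real_def)
    next
      case 3 then show ?thesis using ut mixed[of t u] by (simp add: dist_real_def dist_commute)
    next
      case 4
      have "dist (r' u) (r' t) = dist (r (s + u - D)) (r (s + t - D))" using 4 by (simp add: r'_def)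
      also have "\<dots> = \<bar>(s + u - D) - (s + t - D)\<bar>" by (rule geodesic_raysD[OF rr]) (use 4 s D in auto)
      finally show ?thesis by (simp add: dist_real_def)
    qed
  qed
  then have r'r: "r' \<in> geodesic_rays" by (simp add: geodesic_rays_def isometric_on_def)
  have "r (s + t) = r' (D + t)" if "t \<ge> 0" for t
    using that c by (cases "t = 0") (auto simp: r'_def)
  then have "r' \<in> \<xi>" by (intro mem_endI[OF assms r r'r s(1) D])
  moreover have "r' 0 = x" using D c by (simp add: r'_def)
  ultimately show ?thesis by blast
qed

lemma ray_unique:
  assumes "\<xi> \<in> ends" "r \<in> \<xi>" "r' \<in> \<xi>" "r 0 = r' 0" "t \<ge> 0"
  shows "r t = (r' t :: 'a)"
proof -
  have g: "r \<in> geodesic_rays" "r' \<in> geodesic_rays" using end_member assms by blast+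
  obtain a b where ab: "a \<ge> 0" "b \<ge> 0" "\<And>t. t \<ge> 0 \<Longrightarrow> r (a + t) = r' (b + t)"
    using mem_end_cofinal[OF assms(1-3)] by blast
  have "a = b" using ab(3)[of 0] geodesic_raysD[OF g(1), of 0 a] geodesic_raysD[OF g(2), of 0 b] ab(1,2) assms(4) by simp
  show ?thesis
  proof (cases "t \<ge> a")
    case True then show ?thesis using ab(3)[of "t - a"] \<open>a = b\<close> by simp
  next
    case False
    have "btw (r 0) (r t) (r a)" "btw (r' 0) (r' t) (r' b)"
      using False assms(5) \<open>a = b\<close> geodesic_raysD[OF g(1)] geodesic_raysD[OF g(2)] by (auto simp: btw_def)
    moreover have "r a = r' b" using ab(3)[of 0] by simp
    moreover have "dist (r 0) (r t) = t" "dist (r' 0) (r' t) = t"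
      using assms(5) geodesic_raysD[OF g(1), of 0 t] geodesic_raysD[OF g(2), of 0 t] by auto
    ultimately show ?thesis using segment_unique[of "r 0" "r t" "r a" "r' t"] assms(4) by simp
  qed
qed

lemma ray_props:
  assumes "\<xi> \<in> ends"
  shows "ray x \<xi> \<in> \<xi>" "ray x \<xi> 0 = (x::'a)" "ray x \<xi> \<in> geodesic_rays"
proof -
  have "\<exists>r. r \<in> \<xi> \<and> r 0 = x" using ray_exists[OF assms] by blast
  then have "ray x \<xi> \<in> \<xi> \<and> ray x \<xi> 0 = x" unfolding ray_def by (rule someI_ex)
  then show "ray x \<xi> \<in> \<xi>" "ray x \<xi> 0 = x" "ray x \<xi> \<in> geodesic_rays" using end_member[OF assms] by auto
qed

lemma ray_dist: "\<xi> \<in> ends \<Longrightarrow> s \<ge> 0 \<Longrightarrow> t \<ge> 0 \<Longrightarrow> dist (ray x \<xi> s) (ray x \<xi> t :: 'a) = \<bar>s - t\<bar>"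
  using geodesic_raysD ray_props by blast

lemma ray_dist0: "\<xi> \<in> ends \<Longrightarrow> t \<ge> 0 \<Longrightarrow> dist x (ray x \<xi> t :: 'a) = t"
  using ray_dist[of \<xi> 0 t x] ray_props(2)[of \<xi> x] by simp

lemma ray_btw: "\<xi> \<in> ends \<Longrightarrow> 0 \<le> s \<Longrightarrow> s \<le> t \<Longrightarrow> btw (x::'a) (ray x \<xi> s) (ray x \<xi> t)"
  by (simp add: btw_def ray_dist0 ray_dist)

lemma ray_eqI: "\<xi> \<in> ends \<Longrightarrow> r \<in> \<xi> \<Longrightarrow> r 0 = x \<Longrightarrow> t \<ge> 0 \<Longrightarrow> ray x \<xi> t = (r t :: 'a)"
  using ray_unique[of \<xi> "ray x \<xi>" r t] ray_props[of \<xi> x] by simp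

lemma ray_vertex:
  assumes "\<xi> \<in> ends" "x \<in> V"
  shows "ray x \<xi> (real n) \<in> V"
proof -
  have "isometric_on {0..real n} (ray x \<xi>)"
    using ray_props(3)[OF assms(1)] by (auto simp: geodesic_rays_def intro: isometric_on_subset[of "{0..}"])
  from vertex_nat[OF this, of n] show ?thesis using assms ray_props(2) by simp
qed

lemma ray_to_eq:
  assumes "\<xi> \<in> ends"
  shows "ray_to (x::'a) \<xi> = ray x \<xi> ` {0..}"
proof -
  have "r ` {0..} = ray x \<xi> ` {0..}" if "r \<in> \<xi>" "r 0 = x" for r
    by (rule image_cong) (use ray_eqI[OF assms that] in auto)
  then have "{r ` {0..} | r. r \<in> \<xi> \<and> r 0 = x} = {ray x \<xi> ` {0..}}"
    using ray_props[OF assms, of x] by blast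
  then show ?thesis by (simp add: ray_to_def)
qed

lemma shadow_iff: "\<xi> \<in> ends \<Longrightarrow> \<xi> \<in> shadow x y \<longleftrightarrow> ray x \<xi> (dist x y) = (y::'a)"
  unfolding shadow_def using ray_to_eq ray_dist0[of \<xi> _ x] by (auto simp: image_iff intro: bexI[of _ "dist x y"])

lemma shadow_ends: "shadow x y \<subseteq> ends"
  by (auto simp: shadow_def)

lemma shadow_ray: "\<xi> \<in> ends \<Longrightarrow> t \<ge> 0 \<Longrightarrow> \<xi> \<in> shadow x (ray x \<xi> t :: 'a)"
  by (simp add: shadow_iff ray_dist0)

lemma shadow_self: "\<xi> \<in> ends \<Longrightarrow> \<xi> \<in> shadow x (x::'a)"
  using shadow_ray[of \<xi> 0 x] ray_props(2)[of \<xi> x] by simp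

lemma ray_tail:
  assumes "\<xi> \<in> shadow x y" "t \<ge> 0"
  shows "ray x \<xi> (dist x y + t) = (ray y \<xi> t :: 'a)"
proof -
  have xi: "\<xi> \<in> ends" using assms shadow_ends by blast
  have "(\<lambda>t. ray x \<xi> (dist x y + t)) \<in> geodesic_rays"
    using ray_dist[OF xi] by (simp add: geodesic_rays_def isometric_on_def dist_real_def)
  then have "(\<lambda>t. ray x \<xi> (dist x y + t)) \<in> \<xi>"
    by (intro mem_endI[OF xi ray_props(1)[OF xi], of _ "dist x y" 0]) auto
  moreover have "ray x \<xi> (dist x y + 0) = y" using assms shadow_iff[OF xi] by simp
  ultimately show ?thesis using ray_eqI[OF xi, of "\<lambda>t. ray x \<xi> (dist x y + t)" y t] assms by simp
qed

lemma rays_merge: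
  assumes "\<xi> \<in> ends"
  obtains a b where "a \<ge> 0" "b \<ge> 0" "\<And>t. t \<ge> 0 \<Longrightarrow> ray x \<xi> (a + t) = (ray y \<xi> (b + t) :: 'a)"
  using mem_end_cofinal[OF assms ray_props(1)[OF assms, of x] ray_props(1)[OF assms, of y]] by blast

text \<open>One point beyond \<open>y\<close> decides, however close to \<open>y\<close>: the piece
  of ray from \<open>y\<close> to it is the overlap needed by
  \<open>btw_local_global\<close>.\<close>

lemma shadow_iff_btw:
  assumes xi: "\<xi> \<in> ends" and t: "t > 0"
  shows "\<xi> \<in> shadow x y \<longleftrightarrow> btw x y (ray y \<xi> t :: 'a)"
proof
  assume "\<xi> \<in> shadow x y"
  then show "btw x y (ray y \<xi> t)"
    using ray_tail[of \<xi> x y t] ray_btw[OF xi, of "dist x y" "dist x y + t" x] t shadow_iff[OF xi] by simp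
next
  assume b: "btw x y (ray y \<xi> t)"
  obtain a c where ac: "a \<ge> 0" "c \<ge> 0" "\<And>t. t \<ge> 0 \<Longrightarrow> ray x \<xi> (a + t) = ray y \<xi> (c + t)"
    using rays_merge[OF xi, of x y] by blast
  define z where "z = ray y \<xi> (c + t)"
  have z: "z = ray x \<xi> (a + t)" using ac(3)[of t] t by (simp add: z_def)
  have "btw y (ray y \<xi> t) z" unfolding z_def using ac t by (intro ray_btw[OF xi]) auto
  moreover have "y \<noteq> ray y \<xi> t" using ray_dist0[OF xi, of t y] t by auto
  ultimately have xyz: "btw x y z" using btw_local_global'[OF b] by blast
  have "dist x z = a + t" using ray_dist0[OF xi, of "a + t" x] ac(1) t unfolding z by simp
  then have le: "dist x y \<le> a + t" using xyz by (simp add: btw_def)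
  have "btw x (ray x \<xi> (dist x y)) z" unfolding z using le by (intro ray_btw[OF xi]) auto
  then have "ray x \<xi> (dist x y) = y"
    using segment_unique[OF _ xyz, of "ray x \<xi> (dist x y)"] ray_dist0[OF xi] by simp
  then show "\<xi> \<in> shadow x y" using shadow_iff[OF xi] by simp
qed

lemma shadow_trans:
  assumes "\<xi> \<in> shadow x y" "\<xi> \<in> shadow y z"
  shows "\<xi> \<in> shadow x (z::'a)" "btw x y z"
proof -
  have xi: "\<xi> \<in> ends" using assms shadow_ends by blast
  have "ray x \<xi> (dist x y + dist y z) = z"
    using ray_tail[OF assms(1), of "dist y z"] assms(2) shadow_iff[OF xi] by simp
  then show "\<xi> \<in> shadow x z" using shadow_ray[OF xi, of "dist x y + dist y z" x] by simp
  show "btw x y z"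
    using ray_dist0[OF xi, of "dist x y + dist y z" x] \<open>ray x \<xi> _ = z\<close> by (simp add: btw_def)
qed

lemma shadow_split:
  assumes "\<xi> \<in> shadow x z" "btw x y (z::'a)"
  shows "\<xi> \<in> shadow x y" "\<xi> \<in> shadow y z"
proof -
  have xi: "\<xi> \<in> ends" using assms shadow_ends by blast
  have le: "dist x y \<le> dist x z" using assms(2) by (simp add: btw_def)
  have z: "ray x \<xi> (dist x z) = z" using assms shadow_iff[OF xi] by simp
  have "btw x (ray x \<xi> (dist x y)) z" using ray_btw[OF xi, of "dist x y" "dist x z" x] le z by simp
  then have "ray x \<xi> (dist x y) = y"
    using segment_unique[OF _ assms(2)] ray_dist0[OF xi, of "dist x y" x] by simp
  then show 1: "\<xi> \<in> shadow x y" using shadow_iff[OF xi] by simp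
  show "\<xi> \<in> shadow y z" using ray_tail[OF 1, of "dist y z"] z assms(2) shadow_iff[OF xi] by (simp add: btw_def)
qed

text \<open>Together with \<open>shadow_split\<close>: the shadow of \<open>z\<close> stays the same
  when the viewpoint moves back from \<open>y\<close> to a point behind it. This is why one shadow
  of a path does not notice how the path is prolonged at the opposite end.\<close>

lemma shadow_extend:
  assumes "\<xi> \<in> shadow y z" "btw x y z" "y \<noteq> (z::'a)"
  shows "\<xi> \<in> shadow x z"
proof -
  have xi: "\<xi> \<in> ends" using assms shadow_ends by blast
  have b: "btw y z (ray z \<xi> 1)" using assms shadow_iff_btw[OF xi, of 1] by simp
  show ?thesis using btw_local_global[OF assms(2) b assms(3)] shadow_iff_btw[OF xi, of 1] by simp
qed

lemma shadow_common:
  assumes xi: "\<xi> \<in> ends" and x: "x \<in> V"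
  shows "\<exists>w\<in>V. \<xi> \<in> shadow x w \<and> \<xi> \<in> shadow (y::'a) w \<and> dist x w \<ge> T"
proof -
  obtain a c where ac: "a \<ge> 0" "c \<ge> 0" "\<And>t. t \<ge> 0 \<Longrightarrow> ray x \<xi> (a + t) = ray y \<xi> (c + t)"
    using rays_merge[OF xi, of x y] by blast
  obtain n where n: "real n \<ge> max a T" using real_arch_simple by blast
  define w where "w = ray x \<xi> (real n)"
  have "w = ray y \<xi> (c + (real n - a))" using ac(3)[of "real n - a"] n by (simp add: w_def)
  then have "\<xi> \<in> shadow y w" using shadow_ray[OF xi, of "c + (real n - a)" y] n ac by simp
  moreover have "\<xi> \<in> shadow x w" using shadow_ray[OF xi] by (simp add: w_def)
  moreover have "w \<in> V" using ray_vertex[OF xi x] by (simp add: w_def)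
  moreover have "dist x w = real n" using ray_dist0[OF xi] by (simp add: w_def)
  ultimately show ?thesis using n by auto
qed

lemma ends_separated:
  assumes "\<xi> \<in> ends" "\<eta> \<in> ends" "\<xi> \<noteq> \<eta>"
  shows "\<exists>n. ray x \<xi> (real n) \<noteq> (ray x \<eta> (real n) :: 'a)"
proof (rule ccontr)
  assume "\<not> ?thesis"
  then have "ray x \<xi> t = ray x \<eta> t" if "t \<ge> 0" for t
    using rays_eq_of_nat[OF ray_props(3)[OF assms(1)] ray_props(3)[OF assms(2)]] that by blast
  then have "(ray x \<xi>, ray x \<eta>) \<in> cofinal_rays"
    by (intro cofinalI[of _ _ 0 0] ray_props assms) auto
  then show False using ends_eqI[OF assms(1,2) ray_props(1)[OF assms(1)] ray_props(1)[OF assms(2)]] assms(3) by blast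
qed

subsection \<open>Lines\<close>

lemma line_rays:
  assumes "l \<in> geodesics V"
  shows "(\<lambda>t. l (s + t)) \<in> geodesic_rays" "(\<lambda>t. l (s - t)) \<in> geodesic_rays"
  using geodesicsD(1)[OF assms] by (auto simp: geodesic_rays_def isometric_on_def dist_real_def)

lemma end_of_line:
  assumes "l \<in> geodesics V"
  shows "end_of (\<lambda>t. l (s + t)) = end_of l" "end_of (\<lambda>t. l (s - t)) = origin l"
proof -
  show "end_of (\<lambda>t. l (s + t)) = end_of l"
    by (rule end_of_eqI[of _ _ "max 0 (- s)" "max s 0"])
      (use line_rays[OF assms, of s] line_rays[OF assms, of 0] in \<open>auto simp: max_def\<close>)
  show "end_of (\<lambda>t. l (s - t)) = origin l" unfolding origin_def
    by (rule end_of_eqI[of _ _ "max 0 s" "max (- s) 0"])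
      (use line_rays[OF assms, of s] line_rays[OF assms, of 0] in \<open>auto simp: max_def algebra_simps\<close>)
qed

lemma line_ends:
  assumes "l \<in> geodesics V"
  shows "end_of l \<in> ends" "origin l \<in> ends"
  using end_of_in_ends[OF line_rays(1)[OF assms, of 0]] end_of_in_ends[OF line_rays(2)[OF assms, of 0]]
  by (simp_all add: origin_def)

lemma ray_line:
  assumes "l \<in> geodesics V" "t \<ge> 0"
  shows "ray (l s) (end_of l) t = l (s + t)" "ray (l s) (origin l) t = l (s - t)"
proof -
  show "ray (l s) (end_of l) t = l (s + t)"
    using ray_eqI[OF line_ends(1)[OF assms(1)], of "\<lambda>t. l (s + t)" "l s" t] assms
      mem_end_of[OF line_rays(1)[OF assms(1), of s]] end_of_line[OF assms(1), of s] by simp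
  show "ray (l s) (origin l) t = l (s - t)"
    using ray_eqI[OF line_ends(2)[OF assms(1)], of "\<lambda>t. l (s - t)" "l s" t] assms
      mem_end_of[OF line_rays(2)[OF assms(1), of s]] end_of_line[OF assms(1), of s] by simp
qed

lemma line_ends_distinct:
  assumes "l \<in> geodesics V"
  shows "origin l \<noteq> end_of l"
proof
  assume "origin l = end_of l"
  then have "l 1 = l (- 1)" using ray_line[OF assms, of 1 0] by simp
  then show False using geodesicsD(1)[OF assms, of 1 "- 1"] by simp
qed

text \<open>The rays from \<open>x\<close> to the two ends first differ at step \<open>N\<close>, so
  they branch at step \<open>m = N - 1\<close>. Coming in along one ray and leaving along the other
  is a path without backtracking: away from the branch vertex because rays are geodesic, at the
  branch vertex by the choice of \<open>N\<close>.\<close>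

lemma line_exists:
  assumes "\<xi> \<in> ends" "\<eta> \<in> ends" "\<xi> \<noteq> \<eta>"
  shows "\<exists>l\<in>geodesics V. origin l = \<xi> \<and> end_of l = \<eta>"
proof -
  obtain x where x: "x \<in> V" using vertices_nonempty by blast
  define N where "N = (LEAST n. ray x \<xi> (real n) \<noteq> ray x \<eta> (real n))"
  have N: "ray x \<xi> (real N) \<noteq> ray x \<eta> (real N)"
    unfolding N_def by (rule LeastI_ex) (rule ends_separated[OF assms])
  have lt: "ray x \<xi> (real n) = ray x \<eta> (real n)" if "n < N" for n
    using not_less_Least that unfolding N_def by blast
  have "N \<noteq> 0" using N ray_props(2) assms by auto
  then obtain m where m: "N = Suc m" by (cases N) auto
  have eq: "ray x \<xi> (real m) = ray x \<eta> (real m)" using lt m by simp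
  define v where "v i = (if i \<ge> 0 then ray x \<eta> (real (m + nat i)) else ray x \<xi> (real (m + nat (- i))))" for i :: int
  have v1: "v i = ray x \<eta> (real m + of_int i)" if "i \<ge> 0" for i using that by (simp add: v_def)
  have v2: "v i = ray x \<xi> (real m - of_int i)" if "i \<le> 0" for i
    using that eq by (cases "i = 0") (simp_all add: v_def)
  have V: "v i \<in> V" for i using ray_vertex assms x by (simp add: v_def del: of_nat_add)
  have d1: "dist (v i) (v j) = of_int \<bar>i - j\<bar>" if "i \<ge> 0" "j \<ge> 0" for i j
    using v1[OF that(1)] v1[OF that(2)] ray_dist[OF assms(2), of "real m + of_int i" "real m + of_int j" x] that by simp
  have d2: "dist (v i) (v j) = of_int \<bar>i - j\<bar>" if "i \<le> 0" "j \<le> 0" for i j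
    using v2[OF that(1)] v2[OF that(2)] ray_dist[OF assms(1), of "real m - of_int i" "real m - of_int j" x] that
    by (simp add: abs_minus_commute)
  have step: "dist (v i) (v (i + 1)) = 1" for i
    using d1[of i "i + 1"] d2[of i "i + 1"] by (cases "i \<ge> 0") auto
  have nb: "v i \<noteq> v (i + 2)" for i
  proof -
    consider "i \<ge> 0" | "i \<le> - 2" | "i = - 1" by linarith
    then show ?thesis
    proof cases
      case 1 then show ?thesis using d1[of i "i + 2"] by auto
    next
      case 2 then show ?thesis using d2[of i "i + 2"] by auto
    next
      case 3
      then have "v i = ray x \<xi> (real N)" "v (i + 2) = ray x \<eta> (real N)"
        using v2[of i] v1[of "i + 2"] m by (auto simp: add.commute)
      then show ?thesis using N by simp
    qed
  qed
  obtain l where l: "l \<in> geodesics V" "\<And>i. l (of_int i) = v i"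
    using geodesic_of_points[of v "\<lambda>i. i"] nonbacktracking_geodesic[of v, OF V step nb] V by auto
  have sh: "(\<lambda>t. ray x \<eta> (real m + t)) \<in> geodesic_rays" "(\<lambda>t. ray x \<xi> (real m + t)) \<in> geodesic_rays"
    using ray_dist assms by (auto simp: geodesic_rays_def isometric_on_def dist_real_def)
  have "l (0 + t) = ray x \<eta> (real m + t)" if "t \<ge> 0" for t
    using rays_eq_of_nat[OF line_rays(1)[OF l(1), of 0] sh(1), of t] that l(2)[of "int _"] v1[of "int _"] by simp
  then have "end_of l = end_of (ray x \<eta>)"
    using line_rays(1)[OF l(1), of 0] ray_props(3)[OF assms(2), of x]
    by (intro end_of_eqI[of _ _ 0 "real m"]) auto
  moreover have "l (0 - t) = ray x \<xi> (real m + t)" if "t \<ge> 0" for t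
  proof (rule rays_eq_of_nat[OF line_rays(2)[OF l(1), of 0] sh(2) _ that])
    show "l (0 - real n) = ray x \<xi> (real m + real n)" for n
      using l(2)[of "- int n"] v2[of "- int n"] by simp
  qed
  then have "origin l = end_of (ray x \<xi>)"
    unfolding origin_def using line_rays(2)[OF l(1), of 0] ray_props(3)[OF assms(1), of x]
    by (intro end_of_eqI[of _ _ 0 "real m"]) auto
  moreover have "end_of (ray x \<eta>) = \<eta>" "end_of (ray x \<xi>) = \<xi>"
    using end_member ray_props(1) assms by blast+
  ultimately show ?thesis using l(1) by blast
qed

text \<open>The lines coincide near either end up to a shift. Comparing the distance of two far
  points on both lines shows that the two shifts are equal, and the points in between follow by
  uniqueness of segments. The shift is an integer because it carries a vertex to a vertex.\<close>

lemma line_unique: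
  assumes l: "l \<in> geodesics V" "l' \<in> geodesics V" and e: "origin l = origin l'" "end_of l = end_of l'"
  shows "\<exists>h::int. \<forall>t. l t = l' (t + of_int h)"
proof -
  have ee: "l \<in> end_of l" "l' \<in> end_of l" "(\<lambda>t. l (- t)) \<in> origin l" "(\<lambda>t. l' (- t)) \<in> origin l"
    using mem_end_of[of l] mem_end_of[of l'] mem_end_of[of "\<lambda>t. l (- t)"] mem_end_of[of "\<lambda>t. l' (- t)"]
      line_rays[OF l(1), of 0] line_rays[OF l(2), of 0] e unfolding e[symmetric] origin_def
    by simp_all
  obtain a b where ab: "a \<ge> 0" "b \<ge> 0" "\<And>t. t \<ge> 0 \<Longrightarrow> l (a + t) = l' (b + t)"
    using mem_end_cofinal[OF line_ends(1)[OF l(1)] ee(1,2)] by blast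
  obtain a' b' where ab': "a' \<ge> 0" "b' \<ge> 0" "\<And>t. t \<ge> 0 \<Longrightarrow> l (- (a' + t)) = l' (- (b' + t))"
    using mem_end_cofinal[OF line_ends(2)[OF l(1)] ee(3,4)] by blast
  define h where "h = b - a"
  have 1: "l T = l' (T + h)" if "T \<ge> a" for T using ab(3)[of "T - a"] that by (simp add: h_def algebra_simps)
  have 2: "l (- T) = l' (- T + (a' - b'))" if "T \<ge> a'" for T using ab'(3)[of "T - a'"] that by (simp add: algebra_simps)
  \<comment> \<open>The last term makes the difference of the shifted parameters non-negative, so
    that the absolute values can be removed and the two shifts compared.\<close>
  define T where "T = max (max a a') (\<bar>h\<bar> + \<bar>a' - b'\<bar>)"
  have T: "T \<ge> a" "T \<ge> a'" "T \<ge> \<bar>h\<bar> + \<bar>a' - b'\<bar>" by (auto simp: T_def)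
  have "dist (l T) (l (- T)) = dist (l' (T + h)) (l' (- T + (a' - b')))"
    by (simp only: 1[OF T(1)] 2[OF T(2)])
  then have "\<bar>T - - T\<bar> = \<bar>(T + h) - (- T + (a' - b'))\<bar>" by (simp only: geodesicsD(1)[OF l(1)] geodesicsD(1)[OF l(2)])
  then have hh: "a' - b' = h" using T(3) by linarith
  have eq: "l t = l' (t + h)" for t
  proof -
    define S where "S = max (max a a') \<bar>t\<bar>"
    have S: "S \<ge> a" "S \<ge> a'" "S \<ge> \<bar>t\<bar>" by (auto simp: S_def)
    have "l t = l' (t - (- S) + (- S + h))"
    proof (rule geodesics_eq_between[OF l])
      show "l (- S) = l' (- S + h)" using 2[OF S(2)] hh by simp
      show "l S = l' (S + h)" by (rule 1[OF S(1)])
    qed (use S(3) in linarith)+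
    then show ?thesis by simp
  qed
  have "l' (0 + h) \<in> V" using eq[of 0] l(1) by (simp add: geodesics_def)
  then obtain i where "h = of_int i" using geodesic_vertex_int[OF l(2)] by auto
  then show ?thesis using eq by blast
qed

text \<open>Distances from \<open>y\<close> to the vertices of the line are natural numbers, so a
  minimum is attained. At a minimum the step back towards \<open>y\<close> leaves the line, since a
  neighbour on the line would be closer; hence leaving along the line in either direction does not
  backtrack.\<close>

lemma closest_point:
  assumes "y \<in> V" "l \<in> geodesics V"
  shows "\<exists>n::int. \<forall>s. dist y (l s) = dist y (l (of_int n)) + \<bar>s - of_int n\<bar>"
proof -
  have "\<forall>i. \<exists>k. dist y (l (of_int i)) = real k"
    using vertex_dist[OF assms(1) geodesicsD(2)[OF assms(2)]] by blast
  then obtain f :: "int \<Rightarrow> nat" where "\<forall>i. dist y (l (of_int i)) = real (f i)"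
    by (rule choice[THEN exE])
  then have f: "dist y (l (of_int i)) = real (f i)" for i by blast
  obtain n where n: "\<And>i. f n \<le> f i" using ex_has_least_nat[of "\<lambda>_. True" 0 f] by blast
  define D where "D = dist y (l (of_int n))"
  have Dle: "D \<le> dist y (l (of_int i))" for i using n[of i] by (simp add: D_def f)
  have nbr: "btw y (l (of_int n)) (l (of_int n + e))" if e: "e = 1 \<or> e = -1" for e :: real
  proof (cases "D = 0")
    case True then show ?thesis by (simp add: D_def)
  next
    case False
    then have "D \<ge> 1" using f[of n] by (simp add: D_def)
    then obtain y' where y': "btw (l (of_int n)) y' y" "dist (l (of_int n)) y' = 1"
      using segment_exists[of 1 "l (of_int n)" y] by (auto simp: D_def dist_commute)
    have ie: "of_int n + e = of_int (n + (if e = 1 then 1 else - 1))" using e by auto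
    have "l (of_int n + e) \<noteq> y'"
    proof
      assume "l (of_int n + e) = y'"
      then have "dist y (l (of_int (n + (if e = 1 then 1 else - 1)))) < D"
        using y' unfolding ie by (simp add: D_def btw_def dist_commute)
      then show False using Dle by (meson not_le)
    qed
    then have "btw y' (l (of_int n)) (l (of_int n + e))"
      using neighbours_btw[of "l (of_int n)" y' "l (of_int n + e)"] y' e geodesicsD[OF assms(2)] by auto
    moreover have "btw y y' (l (of_int n))" "y' \<noteq> l (of_int n)" using y' by (auto simp: btw_sym)
    ultimately show ?thesis using btw_local_global by blast
  qed
  have far: "btw y (l (of_int n)) (l s)" for s
  proof -
    define e :: real where "e = (if s \<ge> of_int n then 1 else - 1)"
    define T where "T = \<bar>s - of_int n\<bar> + 1"
    have b: "btw (l (of_int n)) (l (of_int n + e)) (l (of_int n + e * T))"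
      using geodesicsD(1)[OF assms(2)] by (auto simp: btw_def e_def T_def)
    have ne: "l (of_int n) \<noteq> l (of_int n + e)"
      using geodesicsD(1)[OF assms(2), of "of_int n" "of_int n + e"] by (auto simp: e_def)
    have "btw y (l (of_int n)) (l (of_int n + e * T))"
      using btw_local_global'[OF nbr b ne] by (auto simp: e_def)
    moreover have "btw (l (of_int n)) (l s) (l (of_int n + e * T))"
      using geodesicsD(1)[OF assms(2)] by (auto simp: btw_def e_def T_def)
    ultimately show ?thesis using btw_split'(2) by blast
  qed
  have "dist y (l s) = dist y (l (of_int n)) + \<bar>s - of_int n\<bar>" for s
    using far[of s] geodesicsD(1)[OF assms(2), of "of_int n" s] unfolding btw_def by linarith
  then show ?thesis by blast
qed

text \<open>The time coordinate of \<open>hopf_param\<close>, under the same description, so that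
  \<open>hopf_param_eq\<close> is a mere unfolding.\<close>

definition foot :: "'a \<Rightarrow> (real \<Rightarrow> 'a) \<Rightarrow> int" where
  "foot y l = (THE n. \<forall>s. dist y (l (of_int n)) \<le> dist y (l s))"

lemma foot_eqI:
  assumes "l \<in> geodesics V" "\<And>s. dist y (l s) = dist y (l (of_int n)) + \<bar>s - of_int n\<bar>"
  shows "foot y l = n"
  unfolding foot_def
proof (rule the_equality)
  show "\<forall>s. dist y (l (of_int n)) \<le> dist y (l s)" 
  proof
    fix s show "dist y (l (of_int n)) \<le> dist y (l s)" using assms(2)[of s] by linarith
  qed
  fix m :: int assume "\<forall>s. dist y (l (of_int m)) \<le> dist y (l s)"
  then have "dist y (l (of_int m)) \<le> dist y (l (of_int n))" by blast
  then show "m = n" using assms(2)[of "of_int m"] by linarith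
qed

lemma foot:
  assumes "y \<in> V" "l \<in> geodesics V"
  shows "dist y (l s) = dist y (l (of_int (foot y l))) + \<bar>s - of_int (foot y l)\<bar>"
proof -
  obtain n :: int where "\<And>s. dist y (l s) = dist y (l (of_int n)) + \<bar>s - of_int n\<bar>"
    using closest_point[OF assms] by blast
  note n = this
  have "foot y l = n" by (rule foot_eqI[OF assms(2) n])
  then show ?thesis using n[of s] by (simp only:)
qed

lemma foot_reparam:
  assumes "y \<in> V" "l \<in> geodesics V"
  shows "foot y (\<lambda>t. l (t + of_int h)) = foot y l - h"
proof (rule foot_eqI[OF geodesic_reparam[OF assms(2)]])
  fix s show "dist y (l (s + of_int h)) = dist y (l (of_int (foot y l - h) + of_int h)) + \<bar>s - of_int (foot y l - h)\<bar>"
    using foot[OF assms, of "s + of_int h"] by (simp add: algebra_simps)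
qed

lemma hopf_param_eq: "hopf_param y l = (origin l, end_of l, foot y l)"
  by (simp add: hopf_param_def foot_def)

lemma ends_reparam:
  assumes "l \<in> geodesics V"
  shows "origin (\<lambda>t. l (t + h)) = origin l" "end_of (\<lambda>t. l (t + h)) = end_of l"
  using end_of_line[OF assms, of h] by (simp_all add: origin_def add.commute)

text \<open>Lines with the same ends differ by an integer translation, and translating by
  \<open>h\<close> lowers the foot by \<open>h\<close>; so the foot takes each integer exactly once
  on each pair of ends.\<close>

lemma hopf_param_bij:
  assumes "y \<in> V"
  shows "bij_betw (hopf_param y) (geodesics V) {(\<xi>, \<eta>, t). \<xi> \<in> ends \<and> \<eta> \<in> ends \<and> \<xi> \<noteq> \<eta>}"
proof (rule bij_betwI')
  fix l l' assume l: "l \<in> geodesics V" "l' \<in> geodesics V"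
  show "hopf_param y l = hopf_param y l' \<longleftrightarrow> l = l'"
  proof
    assume h: "hopf_param y l = hopf_param y l'"
    then obtain h :: int where h': "\<And>t. l t = l' (t + of_int h)"
      using line_unique[OF l] by (auto simp: hopf_param_eq)
    then have "l = (\<lambda>t. l' (t + of_int h))" by auto
    then have "foot y l = foot y l' - h" using foot_reparam[OF assms l(2)] by simp
    then show "l = l'" using h h' by (auto simp: hopf_param_eq)
  qed simp
next
  fix l assume "l \<in> geodesics V"
  then show "hopf_param y l \<in> {(\<xi>, \<eta>, t). \<xi> \<in> ends \<and> \<eta> \<in> ends \<and> \<xi> \<noteq> \<eta>}"
    using line_ends line_ends_distinct by (simp add: hopf_param_eq)
next
  fix z :: "'a tree_end \<times> 'a tree_end \<times> int"
  assume "z \<in> {(\<xi>, \<eta>, t). \<xi> \<in> ends \<and> \<eta> \<in> ends \<and> \<xi> \<noteq> \<eta>}"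
  then obtain \<xi> \<eta> t where z: "z = (\<xi>, \<eta>, t)" "\<xi> \<in> ends" "\<eta> \<in> ends" "\<xi> \<noteq> \<eta>" by auto
  obtain l where l: "l \<in> geodesics V" "origin l = \<xi>" "end_of l = \<eta>" using line_exists[OF z(2-4)] by blast
  define l' where "l' = (\<lambda>s. l (s + of_int (foot y l - t)))"
  have "hopf_param y l' = z" unfolding hopf_param_eq l'_def
    using foot_reparam[OF assms l(1), of "foot y l - t"] ends_reparam[OF l(1)] l z by simp
  then show "\<exists>l\<in>geodesics V. z = hopf_param y l"
    using geodesic_reparam[OF l(1)] unfolding l'_def by blast
qed

end

subsection \<open>Busemann cocycle and visual distance\<close>

context simplicial_tree
begin

text \<open>A vertex common to the rays from \<open>x\<close> and from \<open>y\<close> is already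
  close enough to the end. Any point behind the next point \<open>q\<close> of the ray is reached
  from both \<open>x\<close> and \<open>y\<close> through \<open>w\<close>, so the difference of
  distances no longer changes.\<close>

lemma busemann_eq:
  assumes x: "x \<in> V" and w: "\<xi> \<in> shadow x w" "\<xi> \<in> shadow y w"
  shows "busemann V \<xi> x y = dist x w - dist w y"
proof -
  have xi: "\<xi> \<in> ends" using w shadow_ends by blast
  define P where "P b r s \<longleftrightarrow> r \<in> \<xi> \<and> s \<ge> 0 \<and> (\<forall>z\<in>V. dist (r 0) (r s) + dist (r s) z = dist (r 0) z \<longrightarrow> dist x z - dist z y = b)"
    for b r s
  \<comment> \<open>One step beyond \<open>w\<close>: the edge from \<open>w\<close> to
    \<open>q\<close> is the overlap that prolongs the geodesics from \<open>x\<close> and from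
    \<open>y\<close>.\<close>
  define s where "s = dist x w + 1"
  have wx: "ray x \<xi> (dist x w) = w" and wy: "ray y \<xi> (dist y w) = w" using w shadow_iff[OF xi] by auto
  have r: "ray x \<xi> s = ray w \<xi> 1" "ray y \<xi> (dist y w + 1) = ray w \<xi> 1"
    unfolding s_def using ray_tail[OF w(1), of 1] ray_tail[OF w(2), of 1] by simp_all
  note q_ray = r(1)
  define q where "q = ray w \<xi> 1"
  have wq: "w \<noteq> q" "dist w q = 1" using ray_dist0[OF xi, of 1 w] by (auto simp: q_def)
  have xwq: "btw x w q" "btw y w q"
    unfolding q_def using w shadow_iff_btw[OF xi, of 1] by simp_all
  have val: "dist x z - dist z y = dist x w - dist w y" if "btw x q z" for z
  proof -
    have "btw w q z" using btw_split'(1)[of z q x w] that xwq(1) by (metis btw_sym btw_split(2))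
    then have "btw y q z" using btw_local_global[OF xwq(2) _ wq(1)] by blast
    then show ?thesis using that xwq by (simp add: btw_def dist_commute)
  qed
  have "dist x z - dist z y = dist x w - dist w y" if "dist x q + dist q z = dist x z" for z
    by (rule val) (simp add: btw_def that)
  then have "P (dist x w - dist w y) (ray x \<xi>) s"
    unfolding P_def ray_props(2)[OF xi] q_ray q_def[symmetric] using ray_props(1)[OF xi, of x]
    by (auto simp: s_def)
  moreover have "b = dist x w - dist w y" if P: "P b r t" for b r t
  proof -
    have r: "r \<in> \<xi>" "t \<ge> 0" using P by (auto simp: P_def)
    have rr: "r \<in> geodesic_rays" using end_member[OF xi r(1)] by blast
    obtain a c where ac: "a \<ge> 0" "c \<ge> 0" "\<And>t. t \<ge> 0 \<Longrightarrow> ray x \<xi> (a + t) = r (c + t)"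
      using mem_end_cofinal[OF xi ray_props(1)[OF xi] r(1)] by blast
    \<comment> \<open>Far enough to lie behind \<open>q\<close> as seen from \<open>x\<close> and
      behind \<open>r t\<close> as seen from \<open>r 0\<close>, so that both descriptions of the
      cocycle apply to this vertex.\<close>
    obtain n where n: "real n \<ge> max s (a + t)" using real_arch_simple by blast
    define u where "u = c + (real n - a)"
    define z where "z = ray x \<xi> (real n)"
    have zV: "z \<in> V" using ray_vertex[OF xi x] by (simp add: z_def)
    have zr: "z = r u" using ac(3)[of "real n - a"] n r(2) by (simp add: z_def u_def)
    have "t \<le> u" using n ac(2) by (simp add: u_def)
    then have "dist (r 0) (r t) + dist (r t) z = dist (r 0) z"
      unfolding zr using geodesic_raysD[OF rr] r(2) by simp
    then have "dist x z - dist z y = b" using P zV by (auto simp: P_def)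
    moreover have "btw x q z" unfolding q_def z_def q_ray[symmetric]
      using ray_btw[OF xi, of s "real n" x] n by (simp add: s_def)
    ultimately show ?thesis using val by simp
  qed
  ultimately have "(THE b. \<exists>r t. P b r t) = dist x w - dist w y" by (intro the_equality) blast+
  moreover have "busemann V \<xi> x y = (THE b. \<exists>r t. P b r t)"
    unfolding busemann_def P_def by (intro arg_cong[where f = The] ext) blast
  ultimately show ?thesis by simp
qed

text \<open>The sum of the two identities is twice the distance from \<open>y\<close> to the line
  and yields the density of the Bowen-Margulis measure; their difference is twice the time elapsed
  since the foot and yields the time coordinate.\<close>

lemma busemann_line:
  assumes y: "y \<in> V" and l: "l \<in> geodesics V"
  shows "busemann V (end_of l) y (l (of_int a)) = dist y (l (of_int (foot y l))) + (of_int a - of_int (foot y l))"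
    "busemann V (origin l) y (l (of_int a)) = dist y (l (of_int (foot y l))) - (of_int a - of_int (foot y l))"
proof -
  define n where "n = foot y l"
  define D where "D = dist y (l (of_int n))"
  have d: "dist y (l s) = D + \<bar>s - of_int n\<bar>" for s using foot[OF y l, of s] unfolding D_def n_def .
  define b where "b = max a n"
  have bb: "of_int n \<le> (of_int b :: real)" "of_int a \<le> (of_int b :: real)" by (auto simp: b_def)
  have bg: "btw y (l (of_int b)) (l (of_int b + 1))"
    using d[of "of_int b"] d[of "of_int b + 1"] geodesicsD(1)[OF l, of "of_int b" "of_int b + 1"] bb
    unfolding btw_def by linarith
  have "end_of l \<in> shadow y (l (of_int b))"
    using shadow_iff_btw[OF line_ends(1)[OF l], of 1 y "l (of_int b)"] ray_line(1)[OF l, of 1 "of_int b"] bg by simp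
  moreover have "end_of l \<in> shadow (l (of_int a)) (l (of_int b))"
    using shadow_iff_btw[OF line_ends(1)[OF l], of 1 "l (of_int a)" "l (of_int b)"] ray_line(1)[OF l, of 1 "of_int b"]
      geodesic_btw[OF l, of "of_int a" "of_int b" "of_int b + 1"] bb by simp
  ultimately have "busemann V (end_of l) y (l (of_int a)) = dist y (l (of_int b)) - dist (l (of_int b)) (l (of_int a))"
    using busemann_eq[OF y] by blast
  also have "\<dots> = D + (of_int a - of_int n)" 
    using d[of "of_int b"] geodesicsD(1)[OF l, of "of_int b" "of_int a"] bb by linarith
  finally show "busemann V (end_of l) y (l (of_int a)) = dist y (l (of_int (foot y l))) + (of_int a - of_int (foot y l))"
    by (simp add: D_def n_def)
  define c where "c = min a n"
  have cc: "of_int c \<le> (of_int n :: real)" "of_int c \<le> (of_int a :: real)" by (auto simp: c_def)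
  have cg: "btw y (l (of_int c)) (l (of_int c - 1))"
    using d[of "of_int c"] d[of "of_int c - 1"] geodesicsD(1)[OF l, of "of_int c" "of_int c - 1"] cc
    unfolding btw_def by linarith
  have "origin l \<in> shadow y (l (of_int c))"
    using shadow_iff_btw[OF line_ends(2)[OF l], of 1 y "l (of_int c)"] ray_line(2)[OF l, of 1 "of_int c"] cg by simp
  moreover have "btw (l (of_int a)) (l (of_int c)) (l (of_int c - 1))"
    using geodesicsD(1)[OF l, of "of_int a" "of_int c"] geodesicsD(1)[OF l, of "of_int c" "of_int c - 1"]
      geodesicsD(1)[OF l, of "of_int a" "of_int c - 1"] cc unfolding btw_def by linarith
  then have "origin l \<in> shadow (l (of_int a)) (l (of_int c))"
    using shadow_iff_btw[OF line_ends(2)[OF l], of 1 "l (of_int a)" "l (of_int c)"] ray_line(2)[OF l, of 1 "of_int c"]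
    by simp
  ultimately have "busemann V (origin l) y (l (of_int a)) = dist y (l (of_int c)) - dist (l (of_int c)) (l (of_int a))"
    using busemann_eq[OF y] by blast
  also have "\<dots> = D - (of_int a - of_int n)" 
    using d[of "of_int c"] geodesicsD(1)[OF l, of "of_int c" "of_int a"] cc by linarith
  finally show "busemann V (origin l) y (l (of_int a)) = dist y (l (of_int (foot y l))) - (of_int a - of_int (foot y l))"
    by (simp add: D_def n_def)
qed

lemma shadow_foot:
  assumes y: "y \<in> V" and l: "l \<in> geodesics V"
  shows "end_of l \<in> shadow y (l (of_int (foot y l)))" "origin l \<in> shadow y (l (of_int (foot y l)))"
proof -
  define n where "n = foot y l"
  have "btw y (l (of_int n)) (l (of_int n + 1))" "btw y (l (of_int n)) (l (of_int n - 1))"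
    using foot[OF y l, of "of_int n + 1"] foot[OF y l, of "of_int n - 1"] geodesicsD(1)[OF l]
    by (simp_all add: btw_def n_def)
  then show "end_of l \<in> shadow y (l (of_int (foot y l)))" "origin l \<in> shadow y (l (of_int (foot y l)))"
    using shadow_iff_btw[OF line_ends(1)[OF l], of 1 y "l (of_int n)"] ray_line(1)[OF l, of 1 "of_int n"]
      shadow_iff_btw[OF line_ends(2)[OF l], of 1 y "l (of_int n)"] ray_line(2)[OF l, of 1 "of_int n"]
    by (simp_all add: n_def)
qed

text \<open>The rays from \<open>y\<close> to the two ends run together to the foot of
  \<open>y\<close> and separate there, so their intersection is the segment from \<open>y\<close> to
  the foot.\<close>

lemma visual_dist_line:
  assumes y: "y \<in> V" and l: "l \<in> geodesics V"
  shows "visual_dist y (origin l) (end_of l) = exp (- dist y (l (of_int (foot y l))))"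
proof -
  define n where "n = foot y l"
  define D where "D = dist y (l (of_int n))"
  let ?r = "ray y (origin l)" and ?s = "ray y (end_of l)"
  have e: "origin l \<in> ends" "end_of l \<in> ends" using line_ends[OF l] by auto
  have sh: "end_of l \<in> shadow y (l (of_int n))" "origin l \<in> shadow y (l (of_int n))"
    using shadow_foot[OF y l] by (simp_all add: n_def)
  have s1: "?s (D + t) = l (of_int n + t)" "?r (D + t) = l (of_int n - t)" if "t \<ge> 0" for t
    using ray_tail[OF sh(1) that] ray_tail[OF sh(2) that] ray_line[OF l that, of "of_int n"] by (simp_all add: D_def)
  have eq: "?r t = ?s t" if "0 \<le> t" "t \<le> D" for t
  proof (rule segment_unique)
    show "btw y (?r t) (l (of_int n))"
      using ray_btw[OF e(1) that, of y] s1(2)[of 0] by simp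
    show "btw y (?s t) (l (of_int n))"
      using ray_btw[OF e(2) that, of y] s1(1)[of 0] by simp
    show "dist y (?r t) = dist y (?s t)" using ray_dist0 e that by simp
  qed
  have ne: "?r t \<noteq> ?s t" if "t > D" for t
    using s1[of "t - D"] that geodesicsD(1)[OF l, of "of_int n + (t - D)" "of_int n - (t - D)"] by auto
  have D0: "D \<ge> 0" by (simp add: D_def)
  have "ray_to y (origin l) \<inter> ray_to y (end_of l) = ?s ` {0..D}"
  proof (intro equalityI subsetI)
    fix z assume "z \<in> ray_to y (origin l) \<inter> ray_to y (end_of l)"
    then obtain t u where t: "t \<ge> 0" "z = ?r t" "u \<ge> 0" "z = ?s u"
      unfolding ray_to_eq[OF e(1)] ray_to_eq[OF e(2)] by auto
    then have "t = u" using ray_dist0[OF e(1), of t y] ray_dist0[OF e(2), of u y] by simp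
    then have "u \<le> D" using ne[of u] t by (meson not_le)
    then show "z \<in> ?s ` {0..D}" using t by (intro image_eqI[of _ _ u]) auto
  next
    fix z assume "z \<in> ?s ` {0..D}"
    then obtain t where "0 \<le> t" "t \<le> D" "z = ?s t" by auto
    then show "z \<in> ray_to y (origin l) \<inter> ray_to y (end_of l)"
      unfolding ray_to_eq[OF e(1)] ray_to_eq[OF e(2)] using eq[of t] by (auto intro!: image_eqI[of _ _ t])
  qed
  moreover have "diameter (?s ` {0..D}) = D"
  proof (rule antisym)
    show "diameter (?s ` {0..D}) \<le> D"
      unfolding diameter_def using D0 by (auto simp: ray_dist[OF e(2)] intro!: cSUP_least)
    have "bounded (?s ` {0..D})"
      unfolding bounded_def using ray_dist0[OF e(2)] by (intro exI[of _ y] exI[of _ D]) auto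
    then have "dist (?s 0) (?s D) \<le> diameter (?s ` {0..D})"
      by (rule diameter_bounded_bound) (use D0 in auto)
    then show "D \<le> diameter (?s ` {0..D})" using D0 by (simp add: ray_dist[OF e(2)])
  qed
  ultimately show ?thesis by (simp add: visual_dist_def D_def n_def)
qed

subsection \<open>The action on ends\<close>

definition aut :: "('a \<Rightarrow> 'a) \<Rightarrow> bool" where
  "aut g \<longleftrightarrow> bij g \<and> isometric_on UNIV g \<and> g ` V = V"

lemma autD:
  assumes "aut g"
  shows "dist (g x) (g y) = dist x y" "x \<in> V \<Longrightarrow> g x \<in> V" "bij g" "inv g (g x) = x" "g (inv g x) = x"
  using assms by (auto simp: aut_def isometric_on_def bij_is_inj inv_f_f surj_f_inv_f bij_is_surj)

lemma aut_inv: "aut g \<Longrightarrow> aut (inv g)"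
proof -
  assume g: "aut g"
  have "inv g ` V = V" using g unfolding aut_def by (metis bij_is_inj image_inv_f_f)
  moreover have "isometric_on UNIV (inv g)"
    using autD(1)[OF g, of "inv g _" "inv g _"] autD(5)[OF g] by (simp add: isometric_on_def)
  ultimately show ?thesis using g bij_imp_bij_inv by (auto simp: aut_def)
qed

lemma aut_btw: "aut g \<Longrightarrow> btw (g x) (g y) (g z) \<longleftrightarrow> btw x y z"
  by (simp add: btw_def autD)

lemma aut_rays: "aut g \<Longrightarrow> g \<circ> r \<in> geodesic_rays \<longleftrightarrow> r \<in> geodesic_rays"
  by (simp add: geodesic_rays_def isometric_on_def autD)

lemma aut_end_of:
  assumes g: "aut g" and r: "r \<in> geodesic_rays"
  shows "end_action g (end_of r) = end_of (g \<circ> r)"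
proof (intro equalityI subsetI)
  fix s assume "s \<in> end_action g (end_of r)"
  then obtain u where "s = g \<circ> u" "(r, u) \<in> cofinal_rays" by (auto simp: end_action_def mem_end_of_iff)
  then show "s \<in> end_of (g \<circ> r)"
    using aut_rays[OF g] by (auto simp: mem_end_of_iff cofinal_rays_def) metis
next
  fix s assume "s \<in> end_of (g \<circ> r)"
  then obtain a b where ab: "s \<in> geodesic_rays" "a \<ge> 0" "b \<ge> 0" "\<And>t. t \<ge> 0 \<Longrightarrow> g (r (a + t)) = s (b + t)"
    by (auto simp: mem_end_of_iff cofinal_rays_def)
  have "r (a + t) = (inv g \<circ> s) (b + t)" if "t \<ge> 0" for t
    using ab(4)[OF that, symmetric] autD(4)[OF g] by simp
  then have "inv g \<circ> s \<in> end_of r"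
    unfolding mem_end_of_iff using ab(1-3) aut_rays[OF aut_inv[OF g]] r by (intro cofinalI[of r "inv g \<circ> s" a b]) auto
  moreover have "s = g \<circ> (inv g \<circ> s)" using autD(5)[OF g] by auto
  ultimately show "s \<in> end_action g (end_of r)" unfolding end_action_def by blast
qed

lemma aut_ends:
  assumes "aut g" "\<xi> \<in> ends"
  shows "end_action g \<xi> \<in> ends"
proof -
  obtain r where "r \<in> \<xi>" using ends_nonempty[OF assms(2)] by blast
  then show ?thesis
    using end_member[OF assms(2)] aut_end_of[OF assms(1), of r] aut_rays[OF assms(1)] end_of_in_ends by metis
qed

lemma aut_ray:
  assumes "aut g" "\<xi> \<in> ends" "t \<ge> 0"
  shows "ray (g x) (end_action g \<xi>) t = g (ray x \<xi> t)"
proof -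
  have "g \<circ> ray x \<xi> \<in> end_action g \<xi>"
    using ray_props[OF assms(2), of x] by (auto simp: end_action_def)
  from ray_eqI[OF aut_ends[OF assms(1,2)] this, of "g x" t] show ?thesis
    using ray_props(2)[OF assms(2), of x] assms(3) by simp
qed

lemma aut_shadow:
  assumes "aut g" "\<xi> \<in> ends"
  shows "end_action g \<xi> \<in> shadow (g x) (g y) \<longleftrightarrow> \<xi> \<in> shadow x y"
proof -
  have "inj g" using assms by (simp add: aut_def bij_is_inj)
  then show ?thesis
    using shadow_iff[OF aut_ends[OF assms]] shadow_iff[OF assms(2)] aut_ray[OF assms, of "dist x y" x]
    by (simp add: autD[OF assms(1)] inj_eq)
qed

lemma aut_line: "aut g \<Longrightarrow> l \<in> geodesics V \<Longrightarrow> g \<circ> l \<in> geodesics V"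
  by (simp add: geodesics_def isometric_on_def autD)

lemma tree_automorphism_aut: "g \<in> tree_automorphisms V \<Longrightarrow> aut g"
  by (simp add: tree_automorphisms_def aut_def)

lemma fixes_ray_fixes_end:
  assumes g: "aut g" and xi: "\<xi> \<in> ends" and x: "x \<in> V" and fx: "\<And>n. g (ray x \<xi> (real n)) = ray x \<xi> (real n)"
  shows "end_action g \<xi> = \<xi>"
proof -
  have e: "end_action g \<xi> \<in> ends" by (rule aut_ends[OF g xi])
  have gx: "g x = x" using fx[of 0] ray_props(2)[OF xi] by simp
  have "ray x (end_action g \<xi>) (real n) = ray x \<xi> (real n)" for n
    using aut_ray[OF g xi, of "real n" x] gx fx by simp
  then show ?thesis using ends_separated[OF e xi] by blast
qed

lemma point_on_edge: "\<exists>x\<in>V. \<exists>y\<in>V. btw x z y \<and> dist x z \<le> 1 \<and> dist y z \<le> 1"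
proof (cases "z \<in> V")
  case True
  then show ?thesis by (auto intro!: bexI[of _ z])
next
  case False
  then have "z \<in> \<Union> (components (- V))" by simp
  then obtain C where C: "C \<in> components (- V)" "z \<in> C" by blast
  obtain e where e: "isometric_on {0..1::real} e" "e 0 \<in> V" "e 1 \<in> V" "C = e ` {0<..<1}"
    using open_edges[OF C(1)] by blast
  then obtain t where t: "0 < t" "t < 1" "z = e t" using C(2) by auto
  have "dist (e 0) z = t" "dist (e 1) z = 1 - t" "dist (e 0) (e 1) = 1"
    using isometric_onD[OF e(1), of 0 t] isometric_onD[OF e(1), of 1 t] isometric_onD[OF e(1), of 0 1] t
    by (auto simp: dist_real_def)
  then have "btw (e 0) z (e 1)" "dist (e 0) z \<le> 1" "dist (e 1) z \<le> 1"
    using t by (simp_all add: btw_def dist_commute)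
  then show ?thesis using e(2,3) by blast
qed

text \<open>Discreteness speaks of compact sets of points of the tree, stabilisers are controlled on
  vertices. The passage from one to the other: a point is determined on its edge by the distances
  from the two ends.\<close>

lemma aut_fixes_point:
  assumes g: "aut g" and "\<And>v. v \<in> V \<Longrightarrow> dist v z \<le> 1 \<Longrightarrow> g v = v"
  shows "g z = z"
proof -
  obtain x y where xy: "x \<in> V" "y \<in> V" "btw x z y" "dist x z \<le> 1" "dist y z \<le> 1" using point_on_edge by blast
  then have "g x = x" "g y = y" using assms(2) by auto
  then have "btw x (g z) y" "dist x (g z) = dist x z"
    using aut_btw[OF g, of x z y] autD(1)[OF g, of x z] xy by auto
  then show ?thesis using segment_unique xy by metis
qed

end

section \<open>First return maps and Bernoulli codings\<close>

text \<open>Invariance is not assumed in the definition of mixing, but follows from it: the correlations of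
  the preimage of \<open>E\<close> with the whole space are those of \<open>E\<close>, shifted by one step.\<close>

lemma mixing_imp_invariant:
  assumes "prob_space M" and mix: "mixing M T" and T: "T \<in> measurable M M" and E: "E \<in> sets M"
  shows "measure M (T -` E \<inter> space M) = measure M E"
proof -
  interpret prob_space M by fact
  have lim: "(\<lambda>n. measure M ((T ^^ n) -` X \<inter> space M)) \<longlonglongrightarrow> measure M X" if "X \<in> sets M" for X
    using mix[unfolded mixing_def, rule_format, OF that sets.top] by (simp add: prob_space)
  have sp: "x \<in> space M \<Longrightarrow> (T ^^ n) x \<in> space M" for x n
    by (induction n) (auto intro: measurable_space[OF T])
  define E' where "E' = T -` E \<inter> space M"
  have E': "E' \<in> sets M" unfolding E'_def by (rule measurable_sets[OF T E])
  have "(T ^^ n) -` E' \<inter> space M = (T ^^ Suc n) -` E \<inter> space M" for n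
    using sp by (auto simp: E'_def)
  then have "(\<lambda>n. measure M ((T ^^ Suc n) -` E \<inter> space M)) \<longlonglongrightarrow> measure M E'" using lim[OF E'] by simp
  moreover have "(\<lambda>n. measure M ((T ^^ Suc n) -` E \<inter> space M)) \<longlonglongrightarrow> measure M E"
    by (rule LIMSEQ_Suc[OF lim[OF E]])
  ultimately show ?thesis using LIMSEQ_unique unfolding E'_def by blast
qed

section \<open>Return times, Poincare recurrence and invariance of the first return map\<close>

definition return_time :: "('a \<Rightarrow> 'a) \<Rightarrow> 'a set \<Rightarrow> 'a \<Rightarrow> nat" where
  "return_time T A q = (LEAST n. 0 < n \<and> (T ^^ n) q \<in> A)"

lemma first_return_eq: "first_return T A q = (T ^^ return_time T A q) q"
  by (simp add: first_return_def return_time_def)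

text \<open>Returns without end in both time directions: this is what makes the first return maps of
  \<open>T\<close> and of \<open>Ti\<close> inverse bijections here, and gives each point a full
  two-sided itinerary.\<close>

definition recurrent_part :: "('a \<Rightarrow> 'a) \<Rightarrow> ('a \<Rightarrow> 'a) \<Rightarrow> 'a set \<Rightarrow> 'a set" where
  "recurrent_part T Ti A =
     {q \<in> A. (\<forall>n. \<exists>m>n. (T ^^ m) q \<in> A) \<and> (\<forall>n. \<exists>m>n. (Ti ^^ m) q \<in> A)}"

lemma recurrent_part_commute: "recurrent_part Ti T A = recurrent_part T Ti A"
  by (auto simp: recurrent_part_def)

text \<open>The inverse is a parameter rather than a construction, so that \<open>swap\<close>
  exchanges the two time directions and each fact about the future also gives the fact about the
  past.\<close>

locale invertible_system = prob_space M for M :: "'a measure" +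
  fixes T Ti :: "'a \<Rightarrow> 'a" and A :: "'a set"
  assumes T_meas [measurable]: "T \<in> measurable M M" and Ti_meas [measurable]: "Ti \<in> measurable M M"
    and Ti_T: "x \<in> space M \<Longrightarrow> Ti (T x) = x" and T_Ti: "x \<in> space M \<Longrightarrow> T (Ti x) = x"
    and invariant: "E \<in> sets M \<Longrightarrow> measure M (T -` E \<inter> space M) = measure M E"
    and A_sets [measurable]: "A \<in> sets M"
begin

lemma swap: "invertible_system M Ti T A"
proof
  fix E assume E: "E \<in> sets M"
  have "T -` (Ti -` E \<inter> space M) \<inter> space M = E"
    using sets.sets_into_space[OF E] measurable_space[OF T_meas] by (auto simp: Ti_T)
  then show "measure M (Ti -` E \<inter> space M) = measure M E"
    using invariant[OF measurable_sets[OF Ti_meas E]] by simp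
qed (use T_meas Ti_meas T_Ti Ti_T A_sets in auto)

lemma iter_space: "x \<in> space M \<Longrightarrow> (T ^^ n) x \<in> space M"
  by (induction n) (auto intro: measurable_space[OF T_meas])

lemma iter_meas [measurable]: "(T ^^ n) \<in> measurable M M"
proof (induction n)
  case (Suc n)
  then show ?case using measurable_comp[OF Suc T_meas] by simp
qed (simp add: id_def)

lemma iter_invariant:
  assumes "E \<in> sets M"
  shows "measure M ((T ^^ n) -` E \<inter> space M) = measure M E"
proof (induction n)
  case 0
  then show ?case using sets.sets_into_space[OF assms] by (simp add: Int_absorb2)
next
  case (Suc n)
  have "(T ^^ Suc n) -` E \<inter> space M = T -` ((T ^^ n) -` E \<inter> space M) \<inter> space M"
    using measurable_space[OF T_meas] by (auto simp: funpow_swap1)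
  then show ?case using invariant[OF measurable_sets[OF iter_meas assms, of n]] Suc by (simp only:)
qed

lemma iter_cancel: "x \<in> space M \<Longrightarrow> (Ti ^^ n) ((T ^^ (n + k)) x) = (T ^^ k) x"
proof (induction n)
  case (Suc n)
  have "(Ti ^^ Suc n) ((T ^^ (Suc n + k)) x) = (Ti ^^ n) (Ti (T ((T ^^ (n + k)) x)))"
    by (simp add: funpow_swap1)
  then show ?case using Suc Ti_T[OF iter_space] by simp
qed simp

lemma iter_cancel': "x \<in> space M \<Longrightarrow> (Ti ^^ (k + n)) ((T ^^ n) x) = (Ti ^^ k) x"
  using iter_cancel[of x n 0] by (simp add: funpow_add)

lemma return_time:
  assumes "(T ^^ m) q \<in> A" "m > 0"
  shows "0 < return_time T A q" "(T ^^ return_time T A q) q \<in> A"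
    "\<And>n. 0 < n \<Longrightarrow> n < return_time T A q \<Longrightarrow> (T ^^ n) q \<notin> A"
proof -
  have "0 < return_time T A q \<and> (T ^^ return_time T A q) q \<in> A"
    unfolding return_time_def by (rule LeastI[of _ m]) (use assms in auto)
  then show "0 < return_time T A q" "(T ^^ return_time T A q) q \<in> A" by auto
  show "\<And>n. 0 < n \<Longrightarrow> n < return_time T A q \<Longrightarrow> (T ^^ n) q \<notin> A"
    using not_less_Least unfolding return_time_def by blast
qed

lemma return_time_eqI:
  assumes "0 < n" "(T ^^ n) q \<in> A" "\<And>m. 0 < m \<Longrightarrow> m < n \<Longrightarrow> (T ^^ m) q \<notin> A"
  shows "return_time T A q = n"
  unfolding return_time_def by (rule Least_equality) (use assms not_le in blast)+

abbreviation "X \<equiv> recurrent_part T Ti A"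
abbreviation "F \<equiv> first_return T A"
abbreviation "Fi \<equiv> first_return Ti A"

lemma X_subset: "X \<subseteq> A" "X \<subseteq> space M"
  using sets.sets_into_space[OF A_sets] by (auto simp: recurrent_part_def)

lemma X_sets [measurable]: "X \<in> sets M"
proof -
  interpret sw: invertible_system M Ti T A by (rule swap)
  have "X = {q \<in> space M. q \<in> A \<and> (\<forall>n. \<exists>m\<in>{n<..}. (T ^^ m) q \<in> A) \<and> (\<forall>n. \<exists>m\<in>{n<..}. (Ti ^^ m) q \<in> A)}"
    using sets.sets_into_space[OF A_sets] by (auto simp: recurrent_part_def)
  also have "\<dots> \<in> sets M" by measurable
  finally show ?thesis .
qed

lemma X_returns:
  assumes "q \<in> X"
  shows "\<exists>m>0. (T ^^ m) q \<in> A" "\<exists>m>0. (Ti ^^ m) q \<in> A"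
  using assms unfolding recurrent_part_def by blast+

text \<open>Points strictly between \<open>q\<close> and its first return are not in
  \<open>A\<close>, so going back from \<open>F q\<close> the first visit to \<open>A\<close> is
  \<open>q\<close>, after the same time.\<close>

lemma F_in_X:
  assumes q: "q \<in> X"
  shows "F q \<in> X" "return_time Ti A (F q) = return_time T A q" "Fi (F q) = q"
proof -
  interpret sw: invertible_system M Ti T A by (rule swap)
  define n where "n = return_time T A q"
  obtain m where m: "m > 0" "(T ^^ m) q \<in> A" using X_returns[OF q] by blast
  note n = return_time[OF m(2,1), folded n_def]
  have qs: "q \<in> space M" using q X_subset by blast
  have qA: "q \<in> A" using q X_subset by blast
  have Fq: "F q = (T ^^ n) q" by (simp add: first_return_eq n_def)
  have bk: "(Ti ^^ j) (F q) = (T ^^ (n - j)) q" if "j \<le> n" for j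
    using iter_cancel[OF qs, of j "n - j"] that Fq by simp
  have far: "(Ti ^^ (k + n)) (F q) = (Ti ^^ k) q" for k
    using iter_cancel'[OF qs] Fq by simp
  have "return_time Ti A (F q) = n"
  proof (rule sw.return_time_eqI)
    show "(Ti ^^ n) (F q) \<in> A" using bk[of n] qA by simp
    show "(Ti ^^ k) (F q) \<notin> A" if "0 < k" "k < n" for k
      using bk[of k] n(3)[of "n - k"] that by simp
  qed (rule n(1))
  then show "return_time Ti A (F q) = return_time T A q" by (simp add: n_def)
  then show "Fi (F q) = q" using bk[of n] by (simp add: first_return_eq n_def)
  have "\<exists>m>k. (T ^^ m) (F q) \<in> A" for k
  proof -
    obtain m where m: "m > k + n" "(T ^^ m) q \<in> A" using q unfolding recurrent_part_def by blast
    have "(T ^^ (m - n)) (F q) = (T ^^ (m - n + n)) q" unfolding Fq funpow_add by simp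
    then show ?thesis using m by (intro exI[of _ "m - n"]) auto
  qed
  moreover have "\<exists>m>k. (Ti ^^ m) (F q) \<in> A" for k
  proof -
    obtain m where "m > k" "(Ti ^^ m) q \<in> A" using q unfolding recurrent_part_def by blast
    then show ?thesis using far[of m] n by (intro exI[of _ "m + n"]) auto
  qed
  ultimately show "F q \<in> X" using n Fq by (simp add: recurrent_part_def)
qed

lemma Fi_in_X:
  assumes q: "q \<in> X"
  shows "Fi q \<in> X" "return_time T A (Fi q) = return_time Ti A q" "F (Fi q) = q"
proof -
  interpret sw: invertible_system M Ti T A by (rule swap)
  show "Fi q \<in> X" "return_time T A (Fi q) = return_time Ti A q" "F (Fi q) = q"
    using sw.F_in_X[of q] q by (simp_all add: recurrent_part_commute)
qed

text \<open>Invariance under the first return map is turned into a statement about \<open>T\<close>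
  by this, in the proof that the shift is ergodic. The first return time is subtracted from
  \<open>n\<close> until nothing is left.\<close>

lemma visit_is_return:
  assumes "q \<in> X" "(T ^^ n) q \<in> A"
  shows "\<exists>k. (T ^^ n) q = (F ^^ k) q"
  using assms
proof (induction n arbitrary: q rule: less_induct)
  case (less n)
  show ?case
  proof (cases "n = 0")
    case True then show ?thesis by (intro exI[of _ 0]) simp
  next
    case False
    define r where "r = return_time T A q"
    have n0: "0 < n" using False by simp
    note r = return_time[OF less.prems(2) n0, folded r_def]
    have rn: "r \<le> n" "0 < r" proof -
      show "r \<le> n" using r(3)[OF n0] less.prems(2) not_le by blast
    qed (rule r(1))
    have "(T ^^ n) q = (T ^^ (n - r + r)) q" using rn by simp
    also have "\<dots> = (T ^^ (n - r)) (F q)" unfolding funpow_add by (simp add: first_return_eq r_def)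
    finally have eq: "(T ^^ n) q = (T ^^ (n - r)) (F q)" .
    then obtain k where "(T ^^ (n - r)) (F q) = (F ^^ k) (F q)"
      using less.IH[of "n - r" "F q"] rn False F_in_X(1)[OF less.prems(1)] less.prems(2) by auto
    then show ?thesis using eq by (intro exI[of _ "Suc k"]) (simp add: funpow_swap1)
  qed
qed

lemma return_time_level_sets:
  assumes [measurable]: "E \<in> sets M" and "E \<subseteq> X"
  shows "{q \<in> E. return_time T A q = n} \<in> sets M"
proof -
  have Collect_sub: "{q \<in> E. Q q} = {q \<in> space M. q \<in> E \<and> Q q}" for Q
    using sets.sets_into_space[OF assms(1)] by blast
  have "return_time T A q = n \<longleftrightarrow> 0 < n \<and> (T ^^ n) q \<in> A \<and> (\<forall>m\<in>{0<..<n}. (T ^^ m) q \<notin> A)" if "q \<in> E" for q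
  proof -
    have "q \<in> X" using assms(2) that by blast
    then obtain m where m: "m > 0" "(T ^^ m) q \<in> A" using X_returns(1) by blast
    show ?thesis
    proof
      assume "return_time T A q = n"
      then show "0 < n \<and> (T ^^ n) q \<in> A \<and> (\<forall>m\<in>{0<..<n}. (T ^^ m) q \<notin> A)"
        using return_time[OF m(2,1)] by (intro conjI ballI) simp_all
    next
      assume "0 < n \<and> (T ^^ n) q \<in> A \<and> (\<forall>m\<in>{0<..<n}. (T ^^ m) q \<notin> A)"
      then show "return_time T A q = n" by (intro return_time_eqI) auto
    qed
  qed
  then have "{q \<in> E. return_time T A q = n} = {q \<in> E. 0 < n \<and> (T ^^ n) q \<in> A \<and> (\<forall>m\<in>{0<..<n}. (T ^^ m) q \<notin> A)}"
    by (intro Collect_cong conj_cong) simp_all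
  also have "\<dots> =
      {q \<in> space M. q \<in> E \<and> 0 < n \<and> (T ^^ n) q \<in> A \<and> (\<forall>m\<in>{0<..<n}. (T ^^ m) q \<notin> A)}"
    by (rule Collect_sub)
  also have "\<dots> \<in> sets M" by measurable
  finally show ?thesis .
qed

text \<open>Cut \<open>E\<close> by the backward return time and its preimage by the forward one.
  The pieces with time \<open>n\<close> correspond under \<open>T ^^ n\<close>, which preserves the
  measure, and the pieces are summed.\<close>

lemma F_preimage:
  assumes E: "E \<in> sets M" "E \<subseteq> X"
  shows "{q \<in> X. F q \<in> E} \<in> sets M" "measure M {q \<in> X. F q \<in> E} = measure M E"
proof -
  interpret sw: invertible_system M Ti T A by (rule swap)
  define B where "B n = {q \<in> X. return_time T A q = n \<and> F q \<in> E}" for n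
  define C where "C n = {p \<in> E. return_time Ti A p = n}" for n
  have C: "C n \<in> sets M" for n
    unfolding C_def using sw.return_time_level_sets[of E n] E by (simp add: recurrent_part_commute)
  have BC: "B n = (T ^^ n) -` C n \<inter> space M" for n
  proof (intro equalityI subsetI)
    fix q assume "q \<in> B n"
    then have q: "q \<in> X" "return_time T A q = n" "F q \<in> E" by (auto simp: B_def)
    then have "(T ^^ n) q \<in> C n" using F_in_X(2)[OF q(1)] by (simp add: C_def first_return_eq)
    then show "q \<in> (T ^^ n) -` C n \<inter> space M" using q X_subset by auto
  next
    fix q assume q: "q \<in> (T ^^ n) -` C n \<inter> space M"
    define p where "p = (T ^^ n) q"
    have p: "p \<in> E" "return_time Ti A p = n" "p \<in> X" using q E by (auto simp: p_def C_def)
    have "Fi p = q" using iter_cancel[of q n 0] q p by (simp add: first_return_eq p_def)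
    then show "q \<in> B n" using Fi_in_X[OF p(3)] p by (auto simp: B_def)
  qed
  have B: "B n \<in> sets M" "measure M (B n) = measure M (C n)" for n
    unfolding BC using C iter_invariant by (auto intro: measurable_sets)
  have UB: "{q \<in> X. F q \<in> E} = (\<Union>n. B n)" and UC: "E = (\<Union>n. C n)" by (auto simp: B_def C_def)
  show "{q \<in> X. F q \<in> E} \<in> sets M" unfolding UB using B by auto
  have "(\<lambda>n. measure M (B n)) sums measure M (\<Union>n. B n)"
    by (rule finite_measure_UNION) (use B in \<open>auto simp: disjoint_family_on_def B_def\<close>)
  moreover have "(\<lambda>n. measure M (C n)) sums measure M (\<Union>n. C n)"
    by (rule finite_measure_UNION) (use C in \<open>auto simp: disjoint_family_on_def C_def\<close>)
  ultimately show "measure M {q \<in> X. F q \<in> E} = measure M E"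
    unfolding UB[symmetric] UC[symmetric] B(2) by (rule sums_unique2)
qed

lemma iter_F_in_X: "q \<in> X \<Longrightarrow> (F ^^ n) q \<in> X"
  by (induction n) (auto intro: F_in_X)

lemma F_iter_preimage:
  assumes E: "E \<in> sets M" "E \<subseteq> X"
  shows "{q \<in> X. (F ^^ n) q \<in> E} \<in> sets M \<and> measure M {q \<in> X. (F ^^ n) q \<in> E} = measure M E"
proof (induction n)
  case 0
  have "{q \<in> X. (F ^^ 0) q \<in> E} = E" using E by auto
  then show ?case using E by simp
next
  case (Suc n)
  have "{q \<in> X. (F ^^ Suc n) q \<in> E} = {q \<in> X. F q \<in> {q \<in> X. (F ^^ n) q \<in> E}}"
    using F_in_X(1) by (auto simp: funpow_swap1)
  then show ?case using F_preimage[of "{q \<in> X. (F ^^ n) q \<in> E}"] Suc by auto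
qed

text \<open>Poincare recurrence: the preimages of this set under the iterates of \<open>T\<close>
  are disjoint and of equal measure, while the total mass is finite.\<close>

lemma never_returning_null:
  "measure M {q \<in> A. \<forall>m>0. (T ^^ m) q \<notin> A} = 0"
proof -
  define L where "L = {q \<in> A. \<forall>m>0. (T ^^ m) q \<notin> A}"
  have "L = {q \<in> space M. q \<in> A \<and> (\<forall>m\<in>{0<..}. (T ^^ m) q \<notin> A)}"
    using sets.sets_into_space[OF A_sets] by (auto simp: L_def)
  also have "\<dots> \<in> sets M" by measurable
  finally have L: "L \<in> sets M" .
  have aux: "False" if "(T ^^ i) q \<in> L" "(T ^^ j) q \<in> L" "i < j" for i j q
  proof -
    have "(T ^^ (j - i)) ((T ^^ i) q) = (T ^^ (j - i + i)) q" unfolding funpow_add by simp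
    moreover have "(T ^^ (j - i)) ((T ^^ i) q) \<notin> A" using that by (simp add: L_def)
    ultimately show False using that by (simp add: L_def)
  qed
  have "(\<lambda>n. measure M ((T ^^ n) -` L \<inter> space M)) sums measure M (\<Union>n. (T ^^ n) -` L \<inter> space M)"
  proof (rule finite_measure_UNION)
    show "disjoint_family (\<lambda>n. (T ^^ n) -` L \<inter> space M)"
      unfolding disjoint_family_on_def
    proof (intro ballI impI equals0I)
      fix i j :: nat and q assume "i \<noteq> j" "q \<in> (T ^^ i) -` L \<inter> space M \<inter> ((T ^^ j) -` L \<inter> space M)"
      then show False using aux[of i q j] aux[of j q i] by (cases "i < j") auto
    qed
  qed (use L in \<open>auto intro: measurable_sets\<close>)
  then have "summable (\<lambda>n::nat. measure M L)" unfolding iter_invariant[OF L] by (rule sums_summable)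
  then show ?thesis by (simp add: summable_const_iff L_def)
qed

text \<open>The last visit of such a point belongs to the null set of points that never
  return.\<close>

lemma finitely_returning_null: "{q \<in> A. \<exists>n. \<forall>m>n. (T ^^ m) q \<notin> A} \<in> null_sets M"
proof -
  define L where "L = {q \<in> A. \<forall>m>0. (T ^^ m) q \<notin> A}"
  have "L = {q \<in> space M. q \<in> A \<and> (\<forall>m\<in>{0<..}. (T ^^ m) q \<notin> A)}"
    using sets.sets_into_space[OF A_sets] by (auto simp: L_def)
  also have "\<dots> \<in> sets M" by measurable
  finally have L: "L \<in> sets M" .
  have "(T ^^ n) -` L \<inter> space M \<in> null_sets M" for n
    using never_returning_null iter_invariant[OF L, of n] measurable_sets[OF iter_meas L]
    by (intro null_setsI) (auto simp: emeasure_eq_measure L_def)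
  then have null: "(\<Union>n. (T ^^ n) -` L \<inter> space M) \<in> null_sets M" by (rule null_sets_UN)
  have "{q \<in> A. \<exists>n. \<forall>m>n. (T ^^ m) q \<notin> A} \<subseteq> (\<Union>n. (T ^^ n) -` L \<inter> space M)"
  proof
    fix q assume "q \<in> {q \<in> A. \<exists>n. \<forall>m>n. (T ^^ m) q \<notin> A}"
    then obtain n where q: "q \<in> A" and n: "\<And>m. m > n \<Longrightarrow> (T ^^ m) q \<notin> A" by blast
    define J where "J = {m. (T ^^ m) q \<in> A}"
    have "J \<subseteq> {..n}" using n by (auto simp: J_def not_less[symmetric])
    then have fin: "finite J" using finite_subset by blast
    moreover have "0 \<in> J" using q by (simp add: J_def)
    ultimately have mx: "Max J \<in> J" "\<And>m. m \<in> J \<Longrightarrow> m \<le> Max J" using Max_in by auto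
    have "(T ^^ m) ((T ^^ Max J) q) \<notin> A" if "m > 0" for m
    proof
      assume "(T ^^ m) ((T ^^ Max J) q) \<in> A"
      then have "m + Max J \<in> J" by (simp add: J_def funpow_add)
      then show False using mx(2) that by force
    qed
    then have "(T ^^ Max J) q \<in> L" using mx(1) by (auto simp: L_def J_def)
    then show "q \<in> (\<Union>n. (T ^^ n) -` L \<inter> space M)" using q sets.sets_into_space[OF A_sets] by auto
  qed
  moreover have "{q \<in> A. \<exists>n. \<forall>m>n. (T ^^ m) q \<notin> A} = {q \<in> space M. q \<in> A \<and> (\<exists>n. \<forall>m\<in>{n<..}. (T ^^ m) q \<notin> A)}"
    using sets.sets_into_space[OF A_sets] by auto
  moreover have "\<dots> \<in> sets M" by measurable
  ultimately show ?thesis using null_sets_subset[OF null] by simp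
qed

lemma recurrence: "A - X \<in> null_sets M"
proof -
  interpret sw: invertible_system M Ti T A by (rule swap)
  have "A - X = {q \<in> A. \<exists>n. \<forall>m>n. (T ^^ m) q \<notin> A} \<union> {q \<in> A. \<exists>n. \<forall>m>n. (Ti ^^ m) q \<notin> A}"
    by (auto simp: recurrent_part_def)
  then show ?thesis using finitely_returning_null sw.finitely_returning_null by auto
qed

lemma measure_X: "measure M X = measure M A"
proof -
  have "measure M (A - X) = 0" using recurrence by (simp add: measure_eq_0_null_sets)
  then show ?thesis using finite_measure_Diff[OF A_sets X_sets] X_subset by simp
qed

section \<open>Two-sided orbits of the first return map\<close>

definition orbit_seq :: "(int \<Rightarrow> 'a) \<Rightarrow> bool" where
  "orbit_seq h \<longleftrightarrow> (\<forall>j. h j \<in> X \<and> h (j + 1) = F (h j))"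

definition iterz :: "int \<Rightarrow> 'a \<Rightarrow> 'a" where
  "iterz j q = (if j \<ge> 0 then (F ^^ nat j) q else (Fi ^^ nat (- j)) q)"

lemma iterz_0 [simp]: "iterz 0 q = q"
  by (simp add: iterz_def)

lemma iter_Fi_in_X: "q \<in> X \<Longrightarrow> (Fi ^^ n) q \<in> X"
  by (induction n) (auto intro: Fi_in_X)

lemma iterz_in_X: "q \<in> X \<Longrightarrow> iterz j q \<in> X"
  by (simp add: iterz_def iter_F_in_X iter_Fi_in_X)

lemma iterz_Suc:
  assumes "q \<in> X"
  shows "iterz (j + 1) q = F (iterz j q)"
proof (cases "j \<ge> 0")
  case True
  then show ?thesis by (simp add: iterz_def nat_add_distrib)
next
  case False
  then obtain n where n: "j = - int (Suc n)" by (metis int_cases2 negative_zless not_less nat_int of_nat_0_le_iff minus_zero zero_less_imp_eq_int int_cases of_nat_Suc)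
  have "iterz (j + 1) q = (Fi ^^ n) q" using n by (cases n) (simp_all add: iterz_def nat_add_distrib)
  moreover have "iterz j q = Fi ((Fi ^^ n) q)" using n by (simp add: iterz_def nat_add_distrib)
  ultimately show ?thesis using Fi_in_X(3)[OF iter_Fi_in_X[OF assms]] by simp
qed

lemma orbit_seq_iterz: "q \<in> X \<Longrightarrow> orbit_seq (\<lambda>j. iterz j q)"
  by (simp add: orbit_seq_def iterz_in_X iterz_Suc)

lemma orbit_seq_unique:
  assumes h: "orbit_seq h" and h': "orbit_seq h'" and eq: "h 0 = h' 0"
  shows "h j = h' j"
proof (induction j rule: int_induct[where k = 0])
  case base show ?case by (rule eq)
next
  case (step1 i)
  then show ?case using h h' by (simp add: orbit_seq_def)
next
  case (step2 i)
  have "F (h (i - 1)) = F (h' (i - 1))"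
    using h h' step2 unfolding orbit_seq_def by (metis diff_add_cancel)
  moreover have "h (i - 1) \<in> X" "h' (i - 1) \<in> X" using h h' by (auto simp: orbit_seq_def)
  ultimately show ?case by (metis F_in_X(3))
qed

lemma iterz_shift:
  assumes "q \<in> X"
  shows "iterz j (F q) = iterz (j + 1) q"
proof -
  have "orbit_seq (\<lambda>j. iterz (j + 1) q)"
    unfolding orbit_seq_def using iterz_in_X[OF assms] iterz_Suc[OF assms, of "_ + 1"] by blast
  from orbit_seq_unique[OF orbit_seq_iterz[OF F_in_X(1)[OF assms]] this, of j]
  show ?thesis using iterz_Suc[OF assms, of 0] by simp
qed

lemma iterz_iterz:
  assumes "q \<in> X"
  shows "iterz i (iterz j q) = iterz (i + j) q"
proof -
  have "orbit_seq (\<lambda>i. iterz (i + j) q)"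
    unfolding orbit_seq_def
    using iterz_in_X[OF assms] iterz_Suc[OF assms, of "_ + j"] by (simp add: algebra_simps)
  from orbit_seq_unique[OF orbit_seq_iterz[OF iterz_in_X[OF assms]] this, of j i]
  show ?thesis by simp
qed

lemma iterz_nat: "iterz (int n) q = (F ^^ n) q"
  by (simp add: iterz_def)

lemma iterz_preimage:
  assumes E: "E \<in> sets M" "E \<subseteq> X"
  shows "{q \<in> X. iterz j q \<in> E} \<in> sets M"
proof -
  interpret sw: invertible_system M Ti T A by (rule swap)
  show ?thesis
    using F_iter_preimage[OF E] sw.F_iter_preimage[of E] E
    by (cases "j \<ge> 0") (simp_all add: iterz_def recurrent_part_commute)
qed

end

text \<open>The symbols \<open>\<sigma>\<close> along the orbit of the first return map are independent by \<open>cylinder\<close>. The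
  assumption \<open>coding_local\<close> says that the inverse of the coding is continuous; it makes this inverse
  measurable without any appeal to standard Borel spaces.\<close>

locale bernoulli_coding = invertible_system M T Ti A
  for M :: "'a measure" and T Ti :: "'a \<Rightarrow> 'a" and A :: "'a set" +
  fixes \<sigma> :: "'a \<Rightarrow> 'c" and w :: "'c \<Rightarrow> real" and \<G> :: "'a set set"
  assumes mix: "mixing M T" and pos: "0 < measure M A"
    and countable_symbols: "countable (\<sigma> ` X)"
    and symbol_sets: "\<And>s. {q \<in> X. \<sigma> q = s} \<in> sets M"
    and weight: "\<And>s. s \<in> \<sigma> ` X \<Longrightarrow> 0 < w s \<and> w s < 1"
    and cylinder: "\<And>n a. (\<forall>j<n. a j \<in> \<sigma> ` X) \<Longrightarrow>
      measure M {q \<in> X. \<forall>j<n. \<sigma> ((F ^^ j) q) = a j} = (\<Prod>j<n. w (a j)) * measure M A"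
    and coding_inj: "\<And>h h'. orbit_seq h \<Longrightarrow> orbit_seq h' \<Longrightarrow> (\<And>j. \<sigma> (h j) = \<sigma> (h' j)) \<Longrightarrow> h 0 = h' 0"
    and coding_surj: "\<And>s. (\<And>j. s j \<in> \<sigma> ` X) \<Longrightarrow> \<exists>h. orbit_seq h \<and> (\<forall>j. \<sigma> (h j) = s j)"
    and generator: "sets M = sigma_sets (space M) \<G>" "\<G> \<subseteq> Pow (space M)"
    and coding_local: "\<And>E h. E \<in> \<G> \<Longrightarrow> orbit_seq h \<Longrightarrow> h 0 \<in> E \<Longrightarrow>
      \<exists>m::nat. \<forall>h'. orbit_seq h' \<longrightarrow> (\<forall>j. \<bar>j\<bar> \<le> int m \<longrightarrow> \<sigma> (h' j) = \<sigma> (h j)) \<longrightarrow> h' 0 \<in> E"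
begin

text \<open>The symbols are numbered because the base of the Bernoulli shift is asked to be a
  measure on the real line.\<close>

definition code :: "'c \<Rightarrow> real" where
  "code s = real (to_nat_on (\<sigma> ` X) s)"

text \<open>The default \<open>- 1\<close> is not a code, codes being natural numbers. It extends
  the symbol measurably to the whole space; the measure \<open>U\<close> gives it no mass.\<close>

definition symbol :: "'a \<Rightarrow> real" where
  "symbol q = (if q \<in> X then code (\<sigma> q) else - 1)"

definition U :: "'a measure" where
  "U = uniform_measure M X"

definition P :: "real measure" where
  "P = distr U borel symbol"

definition N :: "(int \<Rightarrow> real) measure" where
  "N = PiM UNIV (\<lambda>_. P)"

definition Y :: "(int \<Rightarrow> real) set" where
  "Y = {x. \<forall>j. x j \<in> code ` \<sigma> ` X}"

definition \<Theta> :: "'a \<Rightarrow> int \<Rightarrow> real" where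
  "\<Theta> q = (\<lambda>j. code (\<sigma> (iterz j q)))"

definition window :: "nat \<Rightarrow> (int \<Rightarrow> real) \<Rightarrow> (int \<Rightarrow> real) set" where
  "window m x = {y \<in> Y. \<forall>j. \<bar>j\<bar> \<le> int m \<longrightarrow> y j = x j}"

definition shift :: "(int \<Rightarrow> real) \<Rightarrow> int \<Rightarrow> real" where
  "shift x = (\<lambda>i. x (i + 1))"

lemma code_eq_iff: "s \<in> \<sigma> ` X \<Longrightarrow> t \<in> \<sigma> ` X \<Longrightarrow> code s = code t \<longleftrightarrow> s = t"
  using inj_on_to_nat_on[OF countable_symbols] by (auto simp: code_def inj_on_def)

lemma measure_X_pos: "0 < measure M X"
  using pos measure_X by simp

lemma X_nonempty: "X \<noteq> {}"
  using measure_X_pos by auto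

lemma symbol_meas [measurable]: "symbol \<in> borel_measurable M"
proof (rule measurableI)
  fix B :: "real set" assume "B \<in> sets borel"
  have "symbol -` B \<inter> space M =
      (\<Union>s\<in>{s \<in> \<sigma> ` X. code s \<in> B}. {q \<in> X. \<sigma> q = s}) \<union> (if - 1 \<in> B then space M - X else {})"
    using X_subset by (auto simp: symbol_def split: if_splits)
  also have "\<dots> \<in> sets M"
    using symbol_sets countable_subset[OF _ countable_symbols, of "{s \<in> \<sigma> ` X. code s \<in> B}"]
    by (intro sets.Un sets.countable_UN') auto
  finally show "symbol -` B \<inter> space M \<in> sets M" .
qed simp

lemma prob_U: "prob_space U"
  unfolding U_def by (rule prob_space_uniform_measure) (use measure_X_pos in \<open>auto simp: emeasure_eq_measure\<close>)

lemma sets_U [measurable_cong]: "sets U = sets M"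
  by (simp add: U_def)

lemma measure_U: "E \<in> sets M \<Longrightarrow> measure U E = measure M (X \<inter> E) / measure M A"
  unfolding U_def using measure_X_pos measure_X
  by (subst measure_uniform_measure) (auto simp: emeasure_eq_measure)

lemma prob_P: "prob_space P"
  unfolding P_def by (rule prob_space.prob_space_distr[OF prob_U]) simp

lemma sets_P [measurable_cong]: "sets P = sets borel"
  by (simp add: P_def)

lemma space_P [simp]: "space P = UNIV"
  by (simp add: P_def)

lemma measure_P: "B \<in> sets borel \<Longrightarrow> measure P B = measure M {q \<in> X. code (\<sigma> q) \<in> B} / measure M A"
proof -
  assume B: "B \<in> sets borel"
  have "measure P B = measure U (symbol -` B \<inter> space M)"
    unfolding P_def using B sets_eq_imp_space_eq[OF sets_U] by (subst measure_distr) auto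
  also have "\<dots> = measure M (X \<inter> (symbol -` B \<inter> space M)) / measure M A"
    by (rule measure_U) (use B in measurable)
  also have "X \<inter> (symbol -` B \<inter> space M) = {q \<in> X. code (\<sigma> q) \<in> B}"
    using X_subset by (auto simp: symbol_def)
  finally show ?thesis .
qed

lemma measure_P_singleton: "s \<in> \<sigma> ` X \<Longrightarrow> measure P {code s} = w s"
proof -
  assume s: "s \<in> \<sigma> ` X"
  have "{q \<in> X. code (\<sigma> q) \<in> {code s}} = {q \<in> X. \<forall>j<1. \<sigma> ((F ^^ j) q) = s}"
    using s by (auto simp: code_eq_iff)
  then show ?thesis using measure_P[of "{code s}"] cylinder[of 1 "\<lambda>_. s"] s pos by simp
qed

lemma countable_codes: "countable (code ` \<sigma> ` X)"
  using countable_symbols by blast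

lemma codes_sets [measurable]: "code ` \<sigma> ` X \<in> sets borel"
  by (rule sets.countable[OF _ countable_codes]) simp

text \<open>The weights sum to one because almost every point of \<open>A\<close> returns and so has
  a symbol; no series is evaluated.\<close>

lemma AE_P: "AE x in P. x \<in> code ` \<sigma> ` X"
proof -
  interpret P: prob_space P by (rule prob_P)
  have "measure P (code ` \<sigma> ` X) = measure M X / measure M A"
  proof -
    have "{q \<in> X. code (\<sigma> q) \<in> code ` \<sigma> ` X} = X" by blast
    then show ?thesis using measure_P[OF codes_sets] by simp
  qed
  then have "measure P (code ` \<sigma> ` X) = 1" using measure_X pos by simp
  then show ?thesis using P.prob_eq_1[of "code ` \<sigma> ` X"] sets_P by simp
qed

lemma prob_N: "prob_space N"
  unfolding N_def by (rule prob_space_PiM) (rule prob_P)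

lemma space_N [simp]: "space N = UNIV"
  by (simp add: N_def space_PiM)

lemma component_meas [measurable]: "(\<lambda>x. x j) \<in> borel_measurable N"
proof -
  have "(\<lambda>x. x j) \<in> measurable N P" unfolding N_def by (rule measurable_component_singleton) simp
  then show ?thesis using measurable_cong_sets[OF refl sets_P] by blast
qed

lemma Y_sets [measurable]: "Y \<in> sets N"
proof -
  have "Y = {x \<in> space N. \<forall>j. x j \<in> code ` \<sigma> ` X}" by (simp add: Y_def)
  also have "\<dots> \<in> sets N" by measurable
  finally show ?thesis .
qed

lemma AE_N: "AE x in N. x \<in> Y"
proof -
  have "AE x in N. x j \<in> code ` \<sigma> ` X" for j
    unfolding N_def
    by (rule AE_PiM_component[where P = "\<lambda>x. x \<in> code ` \<sigma> ` X" and M = "\<lambda>_. P"]) (auto intro: prob_P AE_P)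
  then show ?thesis by (simp add: Y_def AE_all_countable)
qed

lemma Y_null: "space N - Y \<in> null_sets N"
  using AE_iff_null_sets[OF sets.compl_sets[OF Y_sets]] AE_N by simp

lemma window_eq: "window m x = {y \<in> Y. \<forall>j\<in>{- int m..int m}. y j = x j}"
proof -
  have "\<bar>j\<bar> \<le> int m \<longleftrightarrow> j \<in> {- int m..int m}" for j by (auto simp: abs_le_iff)
  then show ?thesis unfolding window_def Ball_def by simp
qed

lemma window_sets: "window m x \<in> sets N"
proof -
  have "window m x = {y \<in> space N. y \<in> Y \<and> (\<forall>j\<in>{- int m..int m}. y j = x j)}"
    by (auto simp: window_eq)
  also have "\<dots> \<in> sets N" by measurable
  finally show ?thesis .
qed

lemma window_self: "x \<in> Y \<Longrightarrow> x \<in> window m x"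
  by (simp add: window_def)

lemma countable_windows: "countable {window m x | m x. x \<in> Y}"
proof -
  define W where "W = (\<lambda>(m, xs). {y \<in> Y. map y [- int m..int m] = xs})"
  have "window m x = W (m, map x [- int m..int m])" for m x
    by (auto simp: window_eq W_def)
  moreover have "map x [- int m..int m] \<in> lists (code ` \<sigma> ` X)" if "x \<in> Y" for x m
    using that by (auto simp: Y_def)
  ultimately have "window m x \<in> W ` (UNIV \<times> lists (code ` \<sigma> ` X))" if "x \<in> Y" for m x
    using that by blast
  then have "{window m x | m x. x \<in> Y} \<subseteq> W ` (UNIV \<times> lists (code ` \<sigma> ` X))" by blast
  then show ?thesis
    by (rule countable_subset) (intro countable_image countable_SIGMA countable_lists countable_codes; simp)
qed

text \<open>The windows form a countable base of the product topology on \<open>Y\<close> with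
  discrete symbols, so an open set is a countable union of them.\<close>

lemma window_open_sets:
  assumes "D \<subseteq> Y" "\<And>x. x \<in> D \<Longrightarrow> \<exists>m. window m x \<subseteq> D"
  shows "D \<in> sets N" "\<exists>C. C \<subseteq> {window m x | m x. x \<in> Y} \<and> D = \<Union>C"
proof -
  define C where "C = {B \<in> {window m x | m x. x \<in> Y}. B \<subseteq> D}"
  have eq: "D = \<Union>C"
  proof (intro equalityI subsetI)
    fix x assume x: "x \<in> D"
    then obtain m where "window m x \<subseteq> D" using assms by blast
    moreover have "x \<in> window m x" using x assms window_self by blast
    moreover have "window m x \<in> {window m x | m x. x \<in> Y}" using x assms(1) by blast
    ultimately show "x \<in> \<Union>C" unfolding C_def by blast
  qed (auto simp: C_def)
  have "countable C" unfolding C_def by (rule countable_subset[OF _ countable_windows]) blast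
  then show "D \<in> sets N" unfolding eq by (rule sets.countable_Union) (auto simp: C_def window_sets)
  show "\<exists>C. C \<subseteq> {window m x | m x. x \<in> Y} \<and> D = \<Union>C" using eq by (intro exI[of _ C]) (auto simp: C_def)
qed

lemma \<Theta>_in_Y: "q \<in> X \<Longrightarrow> \<Theta> q \<in> Y"
  using iterz_in_X by (simp add: \<Theta>_def Y_def)

lemma \<Theta>_bij: "bij_betw \<Theta> X Y"
proof (rule bij_betwI')
  fix q q' assume q: "q \<in> X" "q' \<in> X"
  show "\<Theta> q = \<Theta> q' \<longleftrightarrow> q = q'"
  proof
    assume "\<Theta> q = \<Theta> q'"
    then have "\<sigma> (iterz j q) = \<sigma> (iterz j q')" for j
    proof -
      have "\<Theta> q j = \<Theta> q' j" using \<open>\<Theta> q = \<Theta> q'\<close> by simp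
      then show ?thesis
        using iterz_in_X[OF q(1)] iterz_in_X[OF q(2)] unfolding \<Theta>_def by (simp add: code_eq_iff)
    qed
    from coding_inj[OF orbit_seq_iterz[OF q(1)] orbit_seq_iterz[OF q(2)] this]
    show "q = q'" by simp
  qed simp
next
  fix q assume "q \<in> X" then show "\<Theta> q \<in> Y" by (rule \<Theta>_in_Y)
next
  fix x assume x: "x \<in> Y"
  then have "\<forall>j. \<exists>s. s \<in> \<sigma> ` X \<and> x j = code s" by (auto simp: Y_def)
  then obtain s where s: "\<forall>j. s j \<in> \<sigma> ` X \<and> x j = code (s j)" by (rule choice[THEN exE])
  then obtain h where h: "orbit_seq h" "\<And>j. \<sigma> (h j) = s j" using coding_surj[of s] by blast
  have h0: "h 0 \<in> X" using h by (simp add: orbit_seq_def)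
  have "iterz j (h 0) = h j" for j
    using orbit_seq_unique[OF orbit_seq_iterz[OF h0] h(1)] by simp
  then have "\<Theta> (h 0) = x" using h s by (simp add: \<Theta>_def fun_eq_iff)
  then show "\<exists>q\<in>X. x = \<Theta> q" using h0 by blast
qed

lemma \<Theta>_shift: "q \<in> X \<Longrightarrow> \<Theta> (F q) = shift (\<Theta> q)"
  by (simp add: \<Theta>_def shift_def iterz_shift)

lemma symbol_iter_sets: "{q \<in> X. \<sigma> (iterz j q) = s} \<in> sets M"
  using iterz_preimage[OF symbol_sets[of s], of j] iterz_in_X by (simp cong: conj_cong)

lemma \<Theta>_preimage:
  assumes "E \<in> sets N"
  shows "{q \<in> X. \<Theta> q \<in> E} \<in> sets M"
proof -
  have "\<Theta> \<in> measurable (restrict_space M X) N"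
  proof -
    have "(\<lambda>q. code (\<sigma> (iterz j q))) \<in> measurable (restrict_space M X) P" for j
    proof (rule measurableI)
      fix B :: "real set" assume "B \<in> sets P"
      have "(\<lambda>q. code (\<sigma> (iterz j q))) -` B \<inter> space (restrict_space M X)
          = (\<Union>s\<in>{s \<in> \<sigma> ` X. code s \<in> B}. {q \<in> X. \<sigma> (iterz j q) = s})"
        using X_subset iterz_in_X by (auto simp: space_restrict_space)
      also have "\<dots> \<in> sets M"
        using symbol_iter_sets countable_subset[OF _ countable_symbols, of "{s \<in> \<sigma> ` X. code s \<in> B}"]
        by (intro sets.countable_UN') auto
      finally show "(\<lambda>q. code (\<sigma> (iterz j q))) -` B \<inter> space (restrict_space M X) \<in> sets (restrict_space M X)"
        by (subst sets_restrict_space_iff) (auto simp: space_restrict_space)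
    qed simp
    then have "(\<lambda>q. \<lambda>j\<in>UNIV. code (\<sigma> (iterz j q))) \<in> measurable (restrict_space M X) N"
      unfolding N_def by (intro measurable_restrict)
    then show ?thesis by (simp add: \<Theta>_def[abs_def] restrict_def)
  qed
  from measurable_sets[OF this assms]
  have "\<Theta> -` E \<inter> X \<in> sets M"
    using X_subset by (subst (asm) sets_restrict_space_iff) (auto simp: space_restrict_space Int_absorb2)
  also have "\<Theta> -` E \<inter> X = {q \<in> X. \<Theta> q \<in> E}" by auto
  finally show ?thesis .
qed

text \<open>Measurability of the inverse coding. By \<open>coding_local\<close> the set of codes of
  a generator is open in \<open>Y\<close>, hence measurable, and the generators suffice.\<close>

lemma \<Theta>_image:
  assumes "E \<in> sets M"
  shows "{x \<in> Y. the_inv_into X \<Theta> x \<in> E} \<in> sets N"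
proof -
  let ?g = "the_inv_into X \<Theta>"
  have g: "?g x \<in> X" "\<Theta> (?g x) = x" if "x \<in> Y" for x
    using bij_betwE[OF bij_betw_the_inv_into[OF \<Theta>_bij]] f_the_inv_into_f_bij_betw[OF \<Theta>_bij] that by auto
  have "?g \<in> measurable (restrict_space N Y) M"
  proof (rule measurable_sigma_sets[OF generator])
    show "?g \<in> space (restrict_space N Y) \<rightarrow> space M"
      using g X_subset by (auto simp: space_restrict_space)
    fix E assume E: "E \<in> \<G>"
    define D where "D = {x \<in> Y. ?g x \<in> E}"
    have "D \<in> sets N"
    proof (rule window_open_sets(1))
      show "D \<subseteq> Y" by (auto simp: D_def)
      fix x assume "x \<in> D"
      then have x: "x \<in> Y" "?g x \<in> E" by (auto simp: D_def)
      obtain m :: nat where m: "\<And>h'. orbit_seq h' \<Longrightarrow> (\<forall>j. \<bar>j\<bar> \<le> int m \<longrightarrow> \<sigma> (h' j) = \<sigma> (iterz j (?g x))) \<Longrightarrow> h' 0 \<in> E"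
        using coding_local[OF E orbit_seq_iterz[OF g(1)[OF x(1)]]] x(2) by auto
      have "window m x \<subseteq> D"
      proof
        fix y assume "y \<in> window m x"
        then have y: "y \<in> Y" "\<And>j. \<bar>j\<bar> \<le> int m \<Longrightarrow> y j = x j" by (auto simp: window_def)
        have "\<sigma> (iterz j (?g y)) = \<sigma> (iterz j (?g x))" if "\<bar>j\<bar> \<le> int m" for j
        proof -
          have "\<Theta> (?g y) j = \<Theta> (?g x) j" using y(2)[OF that] g x y by simp
          then show ?thesis using g(1) x y iterz_in_X by (simp add: \<Theta>_def code_eq_iff)
        qed
        then have "iterz 0 (?g y) \<in> E" using m[OF orbit_seq_iterz[OF g(1)[OF y(1)]]] by blast
        then show "y \<in> D" using y by (simp add: D_def)
      qed
      then show "\<exists>m. window m x \<subseteq> D" by blast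
    qed
    moreover have "?g -` E \<inter> space (restrict_space N Y) = D" by (auto simp: D_def space_restrict_space)
    ultimately show "?g -` E \<inter> space (restrict_space N Y) \<in> sets (restrict_space N Y)"
      by (subst sets_restrict_space_iff) (auto simp: D_def)
  qed
  from measurable_sets[OF this assms]
  have "?g -` E \<inter> Y \<in> sets N"
    by (subst (asm) sets_restrict_space_iff) (auto simp: space_restrict_space)
  also have "?g -` E \<inter> Y = {x \<in> Y. ?g x \<in> E}" by auto
  finally show ?thesis .
qed

text \<open>The law in \<open>cylinder\<close> concerns future symbols only. Since the first return
  map preserves the measure, the symmetric window is pushed \<open>m\<close> returns into the
  future, where it occupies the positions from 0 to \<open>2 * m\<close>.\<close>

lemma measure_window:
  assumes x: "x \<in> Y"
  shows "measure M {q \<in> X. \<Theta> q \<in> window m x} = measure N (window m x) * measure M A"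
proof -
  have "\<forall>j. \<exists>s. s \<in> \<sigma> ` X \<and> x j = code s" using x by (auto simp: Y_def)
  then obtain s where s: "\<forall>j. s j \<in> \<sigma> ` X \<and> x j = code (s j)" by (rule choice[THEN exE])
  define Z where "Z = {q \<in> X. \<forall>j. \<bar>j\<bar> \<le> int m \<longrightarrow> \<sigma> (iterz j q) = s j}"
  have Z: "{q \<in> X. \<Theta> q \<in> window m x} = Z"
  proof -
    have "\<Theta> q \<in> window m x \<longleftrightarrow> (\<forall>j. \<bar>j\<bar> \<le> int m \<longrightarrow> \<sigma> (iterz j q) = s j)" if "q \<in> X" for q
      using \<Theta>_in_Y[OF that] iterz_in_X[OF that] s by (auto simp: window_def \<Theta>_def code_eq_iff)
    then show ?thesis by (auto simp: Z_def)
  qed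
  have Zs: "Z \<in> sets M" using \<Theta>_preimage[OF window_sets, of m x] Z by simp
  have "{q \<in> X. (F ^^ m) q \<in> Z} = {q \<in> X. \<forall>j<2 * m + 1. \<sigma> ((F ^^ j) q) = s (int j - int m)}" (is "?L = ?R")
  proof -
    have "(F ^^ m) q \<in> Z \<longleftrightarrow> (\<forall>j<2 * m + 1. \<sigma> ((F ^^ j) q) = s (int j - int m))" if q: "q \<in> X" for q
    proof -
      have it: "iterz j ((F ^^ m) q) = iterz (j + int m) q" for j
        using iterz_iterz[OF q, of j "int m"] by (simp add: iterz_nat)
      show ?thesis
      proof
        assume "(F ^^ m) q \<in> Z"
        then have z: "\<sigma> (iterz (j + int m) q) = s j" if "\<bar>j\<bar> \<le> int m" for j using that it by (simp add: Z_def)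
        show "\<forall>j<2 * m + 1. \<sigma> ((F ^^ j) q) = s (int j - int m)"
        proof (intro allI impI)
          fix j assume "j < 2 * m + 1"
          then have "\<bar>int j - int m\<bar> \<le> int m" by linarith
          from z[OF this] show "\<sigma> ((F ^^ j) q) = s (int j - int m)" by (simp add: iterz_nat)
        qed
      next
        assume r: "\<forall>j<2 * m + 1. \<sigma> ((F ^^ j) q) = s (int j - int m)"
        have "\<sigma> (iterz (j + int m) q) = s j" if "\<bar>j\<bar> \<le> int m" for j
        proof -
          have k: "nat (j + int m) < 2 * m + 1" "int (nat (j + int m)) = j + int m" using that by linarith+
          show ?thesis
            using r[rule_format, OF k(1)] unfolding iterz_nat[symmetric] k(2) by simp
        qed
        then show "(F ^^ m) q \<in> Z" using it iter_F_in_X[OF q] by (simp add: Z_def)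
      qed
    qed
    then show ?thesis by blast
  qed
  note LR = this
  have Zsub: "Z \<subseteq> X" by (auto simp: Z_def)
  have "measure M Z = measure M {q \<in> X. (F ^^ m) q \<in> Z}" using F_iter_preimage[OF Zs Zsub, of m] by simp
  also have "\<dots> = (\<Prod>j<2 * m + 1. w (s (int j - int m))) * measure M A"
    unfolding LR by (rule cylinder) (use s in blast)
  also have "(\<Prod>j<2 * m + 1. w (s (int j - int m))) = (\<Prod>j\<in>{- int m..int m}. w (s j))"
    by (rule prod.reindex_bij_witness[of _ "\<lambda>j. nat (j + int m)" "\<lambda>j. int j - int m"]) auto
  also have "\<dots> = (\<Prod>j\<in>{- int m..int m}. measure P {x j})"
    using s measure_P_singleton by (intro prod.cong) auto
  also have "\<dots> = measure N (window m x)"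
  proof -
    interpret P: prob_space P by (rule prob_P)
    interpret N: prob_space N by (rule prob_N)
    define E where "E = prod_emb UNIV (\<lambda>_. P) {- int m..int m} (Pi\<^sub>E {- int m..int m} (\<lambda>j. {x j}))"
    have Eeq: "E = {y. \<forall>j\<in>{- int m..int m}. y j = x j}"
      by (auto simp: E_def prod_emb_def PiE_iff)
    have "emeasure N E = (\<Prod>j\<in>{- int m..int m}. emeasure P {x j})"
      unfolding N_def E_def by (rule emeasure_PiM_emb) (auto simp: prob_P sets_P)
    also have "\<dots> = ennreal (\<Prod>j\<in>{- int m..int m}. measure P {x j})"
      by (simp add: P.emeasure_eq_measure prod_ennreal)
    finally have mE: "measure N E = (\<Prod>j\<in>{- int m..int m}. measure P {x j})"
      by (simp add: N.emeasure_eq_measure prod_nonneg)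
    have "E \<in> sets N"
    proof -
      have "E = {y \<in> space N. \<forall>j\<in>{- int m..int m}. y j = x j}" by (simp add: Eeq)
      also have "\<dots> \<in> sets N" by measurable
      finally show ?thesis .
    qed
    moreover have "AE y in N. y \<in> E \<longleftrightarrow> y \<in> window m x"
      using AE_N by eventually_elim (simp add: Eeq window_eq)
    ultimately have "emeasure N E = emeasure N (window m x)"
      using emeasure_eq_AE window_sets by blast
    then have "measure N E = measure N (window m x)" by (simp add: measure_def)
    then show ?thesis using mE by simp
  qed
  finally show ?thesis using Z by simp
qed

definition MX :: "'a measure" where
  "MX = restrict_space (induced_measure M A) X"

lemma sets_MX: "E \<in> sets MX \<longleftrightarrow> E \<in> sets M \<and> E \<subseteq> X"
proof -
  have "sets MX = {E \<inter> X | E. E \<in> sets (restrict_space M A)}"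
    unfolding MX_def induced_measure_def by (auto simp: sets_restrict_space)
  also have "\<dots> = {E \<inter> A \<inter> X | E. E \<in> sets M}" by (auto simp: sets_restrict_space)
  finally have "sets MX = {E \<inter> A \<inter> X | E. E \<in> sets M}" .
  then show ?thesis using X_subset(1) A_sets X_sets by (auto intro!: exI[of _ E])
qed

lemma space_MX: "space MX = X"
  using X_subset by (auto simp: MX_def induced_measure_def space_restrict_space space_scale_measure)

lemma emeasure_MX:
  assumes "E \<in> sets M" "E \<subseteq> X"
  shows "emeasure MX E = ennreal (measure M E / measure M A)"
proof -
  have AX: "A \<inter> space M = A" "X \<subseteq> A" using X_subset sets.sets_into_space[OF A_sets] by auto
  have "emeasure MX E = emeasure (induced_measure M A) E"
    unfolding MX_def
  proof (rule emeasure_restrict_space)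
    have "X \<inter> A \<in> sets M" by measurable
    then show "X \<inter> space (induced_measure M A) \<in> sets (induced_measure M A)"
      unfolding induced_measure_def using AX
      by (simp add: space_scale_measure space_restrict_space sets_restrict_space_iff Int_absorb2)
  qed (use assms in simp)
  also have "\<dots> = inverse (emeasure M A) * emeasure M E"
    unfolding induced_measure_def using assms AX
    by (simp add: emeasure_restrict_space)
  also have "\<dots> = ennreal (inverse (measure M A)) * ennreal (measure M E)"
    using pos by (simp add: emeasure_eq_measure inverse_ennreal)
  finally show ?thesis by (simp add: ennreal_mult'[symmetric] divide_inverse mult.commute)
qed

lemma sets_restrict_Y: "E \<in> sets (restrict_space N Y) \<longleftrightarrow> E \<in> sets N \<and> E \<subseteq> Y"
  by (subst sets_restrict_space_iff) auto

lemma \<Theta>_meas: "\<Theta> \<in> measurable MX (restrict_space N Y)"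
proof (rule measurableI)
  fix E assume "E \<in> sets (restrict_space N Y)"
  then have "E \<in> sets N" by (simp add: sets_restrict_Y)
  then have "{q \<in> X. \<Theta> q \<in> E} \<in> sets M" by (rule \<Theta>_preimage)
  moreover have "\<Theta> -` E \<inter> space MX = {q \<in> X. \<Theta> q \<in> E}" by (auto simp: space_MX)
  ultimately show "\<Theta> -` E \<inter> space MX \<in> sets MX" by (auto simp: sets_MX)
qed (auto simp: space_MX space_restrict_space \<Theta>_in_Y)

lemma \<Theta>_inv_meas: "the_inv_into X \<Theta> \<in> measurable (restrict_space N Y) MX"
proof (rule measurableI)
  show "the_inv_into X \<Theta> x \<in> space MX" if "x \<in> space (restrict_space N Y)" for x
    using bij_betwE[OF bij_betw_the_inv_into[OF \<Theta>_bij]] that by (auto simp: space_MX space_restrict_space)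
  fix E assume "E \<in> sets MX"
  then have "{x \<in> Y. the_inv_into X \<Theta> x \<in> E} \<in> sets N" using \<Theta>_image by (simp add: sets_MX)
  moreover have "the_inv_into X \<Theta> -` E \<inter> space (restrict_space N Y) = {x \<in> Y. the_inv_into X \<Theta> x \<in> E}"
    by (auto simp: space_restrict_space)
  ultimately show "the_inv_into X \<Theta> -` E \<inter> space (restrict_space N Y) \<in> sets (restrict_space N Y)"
    by (auto simp: sets_restrict_Y)
qed

text \<open>Both measures agree on windows by \<open>measure_window\<close>, and windows generate
  the sigma-algebra of \<open>Y\<close>.\<close>

lemma \<Theta>_distr: "distr MX (restrict_space N Y) \<Theta> = restrict_space N Y"
proof (rule measure_eqI_generator_eq_countable)
  interpret N: prob_space N by (rule prob_N)
  let ?W = "{window m x | m x. x \<in> Y}"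
  \<comment> \<open>The empty set is added since windows may be disjoint; two that meet intersect in
    the window of the larger radius around a common sequence.\<close>
  let ?E = "insert {} ?W"
  show "Int_stable ?E"
  proof (rule Int_stableI)
    fix a b assume ab: "a \<in> ?E" "b \<in> ?E"
    show "a \<inter> b \<in> ?E"
    proof (cases "a \<inter> b = {}")
      case False
      then obtain z where z1: "z \<in> a \<inter> b" by blast
      moreover obtain m x where "a = window m x" using ab(1) z1 by auto
      moreover obtain m' x' where "b = window m' x'" using ab(2) z1 by auto
      ultimately have z: "z \<in> a \<inter> b" "a = window m x" "b = window m' x'" by auto
      have mx: "\<bar>j\<bar> \<le> int (max m m') \<longleftrightarrow> \<bar>j\<bar> \<le> int m \<or> \<bar>j\<bar> \<le> int m'" for j by linarith
      have "a \<inter> b = window (max m m') z" using z unfolding window_def mx by auto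
      moreover have "z \<in> Y" using z by (simp add: window_def)
      ultimately show ?thesis by blast
    qed simp
  qed
  show EP: "?E \<subseteq> Pow Y" by (auto simp: window_def)
  show "emeasure (distr MX (restrict_space N Y) \<Theta>) B = emeasure (restrict_space N Y) B" if "B \<in> ?E" for B
  proof (cases "B = {}")
    case False
    then obtain m x where B: "B = window m x" "x \<in> Y" using \<open>B \<in> ?E\<close> by blast
    have BY: "B \<subseteq> Y" "B \<in> sets N" using B window_sets by (auto simp: window_def)
    have "emeasure (distr MX (restrict_space N Y) \<Theta>) B = emeasure MX (\<Theta> -` B \<inter> space MX)"
      using BY by (intro emeasure_distr \<Theta>_meas) (simp add: sets_restrict_Y)
    also have "\<Theta> -` B \<inter> space MX = {q \<in> X. \<Theta> q \<in> B}" by (auto simp: space_MX)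
    also have "emeasure MX \<dots> = ennreal (measure M {q \<in> X. \<Theta> q \<in> B} / measure M A)"
      by (rule emeasure_MX) (use \<Theta>_preimage[OF BY(2)] in auto)
    also have "\<dots> = emeasure N B" using measure_window[OF B(2), of m] B pos by (simp add: N.emeasure_eq_measure)
    also have "\<dots> = emeasure (restrict_space N Y) B"
      using BY by (subst emeasure_restrict_space) auto
    finally show ?thesis .
  qed simp
  have eq: "sets (restrict_space N Y) = sigma_sets Y ?E"
  proof (intro equalityI subsetI)
    fix E assume E: "E \<in> sets (restrict_space N Y)"
    let ?S = "sigma Y ?E"
    have sS: "sets ?S = sigma_sets Y ?E" "space ?S = Y" using EP by (simp_all add: sets_measure_of space_measure_of)
    \<comment> \<open>The identity is shown measurable from the sigma-algebra generated by windows
      to the product sigma-algebra. It suffices to treat one coordinate, whose preimages are unions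
      of windows.\<close>
    have "(\<lambda>x. \<lambda>j\<in>UNIV. x j) \<in> measurable ?S N" unfolding N_def
    proof (intro measurable_restrict)
      fix j :: int
      show "(\<lambda>x. x j) \<in> measurable ?S P"
      proof (rule measurableI)
        fix B :: "real set" assume "B \<in> sets P"
        define D where "D = {x \<in> Y. x j \<in> B}"
        have "\<exists>C. C \<subseteq> ?W \<and> D = \<Union>C"
        proof (rule window_open_sets(2))
          fix x assume "x \<in> D"
          then have "window (nat \<bar>j\<bar>) x \<subseteq> D" by (auto simp: D_def window_def)
          then show "\<exists>m. window m x \<subseteq> D" by blast
        qed (auto simp: D_def)
        then obtain C where C: "C \<subseteq> ?W" "D = \<Union>C" by blast
        have "countable C" using C countable_windows countable_subset by blast
        then have "D \<in> sets ?S" unfolding C(2)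
          by (rule sets.countable_Union) (use C in \<open>auto simp: sS intro: sigma_sets.Basic\<close>)
        then show "(\<lambda>x. x j) -` B \<inter> space ?S \<in> sets ?S" unfolding sS D_def by (simp add: vimage_def Int_def conj_commute)
      qed simp
    qed
    then have m: "(\<lambda>x. x) \<in> measurable ?S N" by (simp add: restrict_def)
    have "(\<lambda>x. x) -` E \<inter> space ?S \<in> sets ?S" by (rule measurable_sets[OF m]) (use E in \<open>simp add: sets_restrict_Y\<close>)
    then show "E \<in> sigma_sets Y ?E" using E unfolding sS by (simp add: sets_restrict_Y Int_absorb2)
  next
    fix E assume "E \<in> sigma_sets Y ?E"
    moreover have "sigma_sets Y ?E \<subseteq> sets (restrict_space N Y)"
    proof -
      have "sigma_sets (space (restrict_space N Y)) ?E \<subseteq> sets (restrict_space N Y)"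
        by (rule sets.sigma_sets_subset) (auto simp: sets_restrict_Y window_sets, auto simp: window_def)
      then show ?thesis by (simp add: space_restrict_space)
    qed
    ultimately show "E \<in> sets (restrict_space N Y)" by blast
  qed
  then show "sets (distr MX (restrict_space N Y) \<Theta>) = sigma_sets Y ?E" by simp
  show "sets (restrict_space N Y) = sigma_sets Y ?E" by (rule eq)
  show "?W \<subseteq> ?E" by blast
  show "\<Union> ?W = Y"
  proof (intro equalityI subsetI)
    fix x assume "x \<in> Y"
    then show "x \<in> \<Union> ?W" using window_self[of x 0] by blast
  qed (auto simp: window_def)
  show "countable ?W" by (rule countable_windows)
  show "emeasure (distr MX (restrict_space N Y) \<Theta>) a \<noteq> \<infinity>" if "a \<in> ?W" for a
  proof -
    have "emeasure MX (\<Theta> -` a \<inter> space MX) \<noteq> \<infinity>"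
      using emeasure_MX[of "\<Theta> -` a \<inter> space MX"] emeasure_notin_sets[of "\<Theta> -` a \<inter> space MX" MX] sets_MX
      by (cases "\<Theta> -` a \<inter> space MX \<in> sets MX") auto
    then show ?thesis using that
      by (subst emeasure_distr[OF \<Theta>_meas]) (auto simp: sets_restrict_Y window_sets, auto simp: window_def)
  qed
qed

end

section \<open>Ergodicity of both systems and their Kakutani equivalence\<close>

context bernoulli_coding
begin

text \<open>Mixing of an invariant set with itself shows that its measure equals its own
  square.\<close>

lemma ergodic_M: "ergodic_automorphism M T"
  unfolding ergodic_automorphism_def
proof (intro conjI ballI impI)
  show "prob_space M" by unfold_locales
  show "T \<in> measurable M M" by (rule T_meas)
  show bij: "bij_betw T (space M) (space M)"
    by (rule bij_betw_byWitness[where f' = Ti])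
      (use Ti_T T_Ti measurable_space[OF T_meas] measurable_space[OF Ti_meas] in auto)
  have "the_inv_into (space M) T x = Ti x" if "x \<in> space M" for x
    using the_inv_into_f_f[OF bij_betw_imp_inj_on[OF bij], of "Ti x"] T_Ti[OF that]
      measurable_space[OF Ti_meas that] by simp
  then show "the_inv_into (space M) T \<in> measurable M M"
    using Ti_meas measurable_cong[of M "the_inv_into (space M) T" Ti M] by blast
  show "distr M M T = M"
    by (rule measure_eqI) (simp_all add: emeasure_distr emeasure_eq_measure invariant)
  fix E assume E: "E \<in> sets M" "T -` E \<inter> space M = E"
  have "(T ^^ n) q \<in> E" if "q \<in> E" for n q
    using that E(2) by (induction n) auto
  then have "(T ^^ n) -` E \<inter> E = E" for n by auto
  then have "(\<lambda>n::nat. measure M E) \<longlonglongrightarrow> measure M E * measure M E"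
    using mix[unfolded mixing_def, rule_format, OF E(1) E(1)] by simp
  then have "measure M E = measure M E * measure M E"
    using LIMSEQ_unique[OF tendsto_const] by blast
  then show "measure M E = 0 \<or> measure M E = 1" by simp
qed

lemma shift_meas: "shift \<in> measurable N N" "(\<lambda>x i. x (i - 1)) \<in> measurable N N"
proof -
  have "(\<lambda>x. \<lambda>i\<in>UNIV. x (i + k)) \<in> measurable N N" for k :: int
    unfolding N_def by (intro measurable_restrict measurable_component_singleton) simp
  from this[of 1] this[of "- 1"] show "shift \<in> measurable N N" "(\<lambda>x i. x (i - 1)) \<in> measurable N N"
    by (simp_all add: shift_def[abs_def] restrict_def)
qed

lemma shift_bij: "bij_betw shift UNIV UNIV"
  by (rule bij_betw_byWitness[where f' = "\<lambda>x i. x (i - 1)"]) (auto simp: shift_def)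

lemma distr_shift: "distr N N shift = N"
proof -
  have "distr (PiM UNIV (\<lambda>_. P)) (PiM UNIV (\<lambda>_. P)) (\<lambda>\<omega>. \<lambda>n\<in>UNIV. \<omega> (n + 1)) = PiM UNIV (\<lambda>_::int. P)"
    by (rule distr_PiM_reindex) (auto simp: prob_P inj_on_def)
  then show ?thesis by (simp add: N_def shift_def[abs_def] restrict_def)
qed

lemma measure_N_eq:
  assumes E: "E \<in> sets N"
  shows "measure N E = measure M {q \<in> X. \<Theta> q \<in> E} / measure M A"
proof -
  interpret N: prob_space N by (rule prob_N)
  have EY: "E \<inter> Y \<in> sets (restrict_space N Y)" using E Y_sets by (simp add: sets_restrict_Y)
  have "AE y in N. y \<in> E \<longleftrightarrow> y \<in> E \<inter> Y" using AE_N by eventually_elim simp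
  then have "emeasure N E = emeasure N (E \<inter> Y)"
    using emeasure_eq_AE E Y_sets sets.Int by blast
  also have "\<dots> = emeasure (restrict_space N Y) (E \<inter> Y)"
    by (subst emeasure_restrict_space) auto
  also have "\<dots> = emeasure (distr MX (restrict_space N Y) \<Theta>) (E \<inter> Y)" by (simp add: \<Theta>_distr)
  also have "\<dots> = emeasure MX (\<Theta> -` (E \<inter> Y) \<inter> space MX)" by (rule emeasure_distr[OF \<Theta>_meas EY])
  also have "\<Theta> -` (E \<inter> Y) \<inter> space MX = {q \<in> X. \<Theta> q \<in> E}" using \<Theta>_in_Y by (auto simp: space_MX)
  also have "emeasure MX \<dots> = ennreal (measure M {q \<in> X. \<Theta> q \<in> E} / measure M A)"
    by (rule emeasure_MX) (use \<Theta>_preimage[OF E] in auto)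
  finally show ?thesis using pos by (simp add: N.emeasure_eq_measure)
qed

text \<open>Transported from mixing of \<open>T\<close> instead of a zero-one law. \<open>W\<close>
  consists of the points whose forward orbit meets the invariant set \<open>E'\<close>. A point
  outside \<open>W\<close> never enters \<open>W\<close>, so mixing makes \<open>W\<close> or its
  complement null. Within \<open>X\<close> nothing is gained by passing to \<open>W\<close>: visits
  to \<open>A\<close> are iterated returns, and these preserve \<open>E'\<close>.\<close>

lemma ergodic_N: "ergodic_automorphism N shift"
  unfolding ergodic_automorphism_def space_N
proof (intro conjI ballI impI)
  show "prob_space N" by (rule prob_N)
  show "shift \<in> measurable N N" by (rule shift_meas)
  show "bij_betw shift UNIV UNIV" by (rule shift_bij)
  have "the_inv_into UNIV shift = (\<lambda>x i. x (i - 1))"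
  proof
    fix x :: "int \<Rightarrow> real"
    have "shift (\<lambda>i. x (i - 1)) = x" by (simp add: shift_def)
    then show "the_inv_into UNIV shift x = (\<lambda>i. x (i - 1))"
      using the_inv_into_f_f[OF bij_betw_imp_inj_on[OF shift_bij], of "\<lambda>i. x (i - 1)"] by simp
  qed
  then show "the_inv_into UNIV shift \<in> measurable N N" using shift_meas(2) by simp
  show "distr N N shift = N" by (rule distr_shift)
  fix E assume E: "E \<in> sets N" "shift -` E \<inter> UNIV = E"
  define E' where "E' = {q \<in> X. \<Theta> q \<in> E}"
  have E'[measurable]: "E' \<in> sets M" unfolding E'_def by (rule \<Theta>_preimage[OF E(1)])
  have inv1: "q \<in> E' \<longleftrightarrow> F q \<in> E'" if "q \<in> X" for q
    using that E(2) F_in_X(1)[OF that] \<Theta>_shift[OF that] by (auto simp: E'_def)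
  have inv: "q \<in> E' \<longleftrightarrow> (F ^^ k) q \<in> E'" if "q \<in> X" for q k
    using inv1 iter_F_in_X[OF that] by (induction k) auto
  define W where "W = {q \<in> space M. \<exists>n. (T ^^ n) q \<in> E'}"
  have W: "W \<in> sets M" unfolding W_def by measurable
  have "(T ^^ n) -` W \<inter> (space M - W) = {}" for n
  proof (rule equals0I)
    fix q assume "q \<in> (T ^^ n) -` W \<inter> (space M - W)"
    then have q: "q \<in> space M" "q \<notin> W" "(T ^^ n) q \<in> W" by auto
    then obtain m where "(T ^^ m) ((T ^^ n) q) \<in> E'" by (auto simp: W_def)
    then have "(T ^^ (m + n)) q \<in> E'" by (simp add: funpow_add)
    then show False using q by (auto simp: W_def)
  qed
  then have "(\<lambda>n::nat. 0) \<longlonglongrightarrow> measure M W * measure M (space M - W)"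
    using mix[unfolded mixing_def, rule_format, OF W sets.compl_sets[OF W]] by simp
  then have W01: "measure M W = 0 \<or> measure M (space M - W) = 0"
    using LIMSEQ_unique[OF tendsto_const] by fastforce
  have sub: "E' \<subseteq> W"
  proof
    fix q assume "q \<in> E'"
    then have "q \<in> space M" "(T ^^ 0) q \<in> E'" using X_subset by (auto simp: E'_def)
    then show "q \<in> W" unfolding W_def by blast
  qed
  have WX: "q \<in> E'" if "q \<in> X" "q \<in> W" for q
  proof -
    obtain n where n: "(T ^^ n) q \<in> E'" using \<open>q \<in> W\<close> by (auto simp: W_def)
    then have "(T ^^ n) q \<in> A" using X_subset by (auto simp: E'_def)
    then obtain k where "(T ^^ n) q = (F ^^ k) q" using visit_is_return[OF \<open>q \<in> X\<close>] by blast
    then show ?thesis using inv[OF \<open>q \<in> X\<close>] n by simp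
  qed
  from W01 have "measure M E' = 0 \<or> measure M E' = measure M A"
  proof
    assume "measure M W = 0"
    then have "measure M E' = 0" using finite_measure_mono[OF sub W] by (simp add: measure_le_0_iff)
    then show ?thesis by simp
  next
    assume "measure M (space M - W) = 0"
    moreover have "X - E' \<subseteq> space M - W" using WX X_subset by blast
    ultimately have "measure M (X - E') = 0"
      using finite_measure_mono[of "X - E'" "space M - W"] W by (simp add: measure_le_0_iff)
    moreover have "E' \<subseteq> X" by (auto simp: E'_def)
    ultimately show ?thesis using finite_measure_Diff[OF X_sets E'] measure_X by simp
  qed
  then show "measure N E = 0 \<or> measure N E = 1"
    using measure_N_eq[OF E(1)] pos by (auto simp: E'_def)
qed

text \<open>Inducing is needed on one side only: on the side of the shift the set is the whole
  space, with the shift as its own first return map.\<close>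

lemma induced_N: "induced_measure N UNIV = N"
proof -
  interpret N: prob_space N by (rule prob_N)
  have "restrict_space N UNIV = N"
  proof (rule measure_eqI)
    show s: "sets (restrict_space N UNIV) = sets N" by (simp add: sets_restrict_space)
    show "emeasure (restrict_space N UNIV) E = emeasure N E" if "E \<in> sets (restrict_space N UNIV)" for E
      by (subst emeasure_restrict_space) (use that s sets.top[of N] in auto)
  qed
  moreover have "emeasure N UNIV = 1" using N.emeasure_space_1 by simp
  ultimately show ?thesis by (simp add: induced_measure_def)
qed

lemma first_return_UNIV: "first_return S UNIV = S"
proof
  fix x
  have "(LEAST n::nat. 0 < n \<and> (S ^^ n) x \<in> UNIV) = 1" by (rule Least_equality) auto
  then show "first_return S UNIV x = S x" by (simp add: first_return_def)
qed

lemma isomorphic: "isomorphic_mod_null (induced_measure M A) F N shift"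
  unfolding isomorphic_mod_null_def
proof (intro bexI exI conjI ballI)
  have AX: "A \<inter> space M = A" using sets.sets_into_space[OF A_sets] by auto
  have spA: "space (induced_measure M A) = A"
    using AX by (auto simp: induced_measure_def space_scale_measure space_restrict_space)
  have sA: "E \<in> sets (induced_measure M A) \<longleftrightarrow> E \<in> sets M \<and> E \<subseteq> A" for E
    unfolding induced_measure_def using AX by (simp add: sets_restrict_space_iff conj_commute)
  show XA: "X \<in> sets (induced_measure M A)" using sA X_sets X_subset by simp
  show "Y \<in> sets N" by (rule Y_sets)
  show "space (induced_measure M A) - X \<in> null_sets (induced_measure M A)"
  proof (rule null_setsI)
    show AXs: "space (induced_measure M A) - X \<in> sets (induced_measure M A)" using XA by blast
    have "emeasure (restrict_space M A) (A - X) = emeasure M (A - X)"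
      by (rule emeasure_restrict_space) (use AX in auto)
    also have "\<dots> = 0" using recurrence by auto
    finally show "emeasure (induced_measure M A) (space (induced_measure M A) - X) = 0"
      unfolding spA by (simp add: induced_measure_def)
  qed
  show "space N - Y \<in> null_sets N" by (rule Y_null)
  show "F \<in> X \<rightarrow> X" using F_in_X by blast
  show "shift \<in> Y \<rightarrow> Y" by (auto simp: shift_def Y_def)
  show "bij_betw \<Theta> X Y" by (rule \<Theta>_bij)
  show "\<Theta> \<in> measurable (restrict_space (induced_measure M A) X) (restrict_space N Y)"
    using \<Theta>_meas by (simp only: MX_def)
  show "the_inv_into X \<Theta> \<in> measurable (restrict_space N Y) (restrict_space (induced_measure M A) X)"
    using \<Theta>_inv_meas by (simp only: MX_def)
  show "distr (restrict_space (induced_measure M A) X) (restrict_space N Y) \<Theta> = restrict_space N Y"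
    using \<Theta>_distr by (simp only: MX_def)
  show "\<Theta> (F q) = shift (\<Theta> q)" if "q \<in> X" for q by (rule \<Theta>_shift[OF that])
qed

theorem loosely_bernoulli: "loosely_bernoulli M T"
proof -
  interpret N: prob_space N by (rule prob_N)
  have "kakutani_equivalent M T N shift"
    unfolding kakutani_equivalent_def
  proof (intro conjI bexI)
    show "isomorphic_mod_null (induced_measure M A) F (induced_measure N UNIV) (first_return shift UNIV)"
      unfolding induced_N first_return_UNIV by (rule isomorphic)
    show "0 < emeasure M A" using pos by (simp add: emeasure_eq_measure)
    show "0 < emeasure N UNIV" using N.emeasure_space_1 by simp
    show "UNIV \<in> sets N" using sets.top[of N] by simp
  qed (rule ergodic_M ergodic_N A_sets)+
  then have "kakutani_equivalent M T (PiM (UNIV :: int set) (\<lambda>_. P)) (\<lambda>x i. x (i + 1))"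
    by (simp add: N_def shift_def[abs_def])
  moreover obtain q where q: "q \<in> X" using X_nonempty by blast
  \<comment> \<open>An atom of weight strictly between 0 and 1 witnesses that the base of the
    Bernoulli shift is non-trivial.\<close>
  then have "0 < measure P {code (\<sigma> q)}" "measure P {code (\<sigma> q)} < 1"
    using measure_P_singleton[of "\<sigma> q"] weight[of "\<sigma> q"] by auto
  then have "\<exists>B\<in>sets P. 0 < measure P B \<and> measure P B < 1"
    using sets_P by (intro bexI[of _ "{code (\<sigma> q)}"]) auto
  ultimately show ?thesis
    unfolding loosely_bernoulli_def using prob_P sets_P by blast
qed

end

section \<open>Topology and measurability on the space of lines\<close>

text \<open>Exact agreement on one compact set, without any closeness, is all that is extracted from
  the topology. It suffices because lines are determined by vertices, and it also serves to exploit
  the discreteness of the group.\<close>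

lemma compact_open_determined:
  assumes "openin compact_open_topology W" "f \<in> W"
  shows "\<exists>K. compact K \<and> (\<forall>f'. continuous_on UNIV f' \<longrightarrow> (\<forall>x\<in>K. f' x = f x) \<longrightarrow> f' \<in> W)"
  using assms unfolding compact_open_topology_def openin_topology_generated_by_iff
proof (induction arbitrary: f rule: generate_topology_on.induct)
  case (Int a b)
  obtain K where K: "compact K" "\<forall>f'. continuous_on UNIV f' \<longrightarrow> (\<forall>x\<in>K. f' x = f x) \<longrightarrow> f' \<in> a"
    using Int.IH(1)[of f] Int.prems by blast
  obtain K' where K': "compact K'" "\<forall>f'. continuous_on UNIV f' \<longrightarrow> (\<forall>x\<in>K'. f' x = f x) \<longrightarrow> f' \<in> b"
    using Int.IH(2)[of f] Int.prems by blast
  show ?case using K K' by (intro exI[of _ "K \<union> K'"]) (auto intro: compact_Un)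
next
  case (UN \<K>)
  then obtain k where k: "k \<in> \<K>" "f \<in> k" by blast
  then show ?case using UN.IH[OF k] by blast
next
  case (Basis s)
  then obtain K U where s: "s = {f. continuous_on UNIV f \<and> f ` K \<subseteq> U}" "compact K" by blast
  then show ?case using Basis.prems by (intro exI[of _ K]) (auto simp: image_subset_iff)
qed auto

lemma openin_evaluation:
  assumes "open U"
  shows "openin compact_open_topology {f. continuous_on UNIV f \<and> f x \<in> U}"
proof -
  have "{f. continuous_on UNIV f \<and> f ` {x} \<subseteq> U} \<in> {{f. continuous_on UNIV f \<and> f ` K \<subseteq> U} | K U. compact K \<and> open U}"
    using assms compact_sing by blast
  then show ?thesis unfolding compact_open_topology_def by (simp add: topology_generated_by_Basis)
qed

lemma space_borel_of [simp]: "space (borel_of X) = topspace X"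
  unfolding borel_of_def by (rule space_measure_of) (auto dest: openin_subset)

lemma sets_borel_of: "sets (borel_of X) = sigma_sets (topspace X) {U. openin X U}"
  unfolding borel_of_def by (rule sets_measure_of) (auto dest: openin_subset)

lemma borel_of_open: "openin X U \<Longrightarrow> U \<in> sets (borel_of X)"
  by (auto simp: sets_borel_of)

lemma measurable_borel_of:
  assumes "f \<in> space M \<rightarrow> topspace X" "\<And>U. openin X U \<Longrightarrow> f -` U \<inter> space M \<in> sets M"
  shows "f \<in> measurable M (borel_of X)"
  by (rule measurable_sigma_sets[OF sets_borel_of]) (use assms in \<open>auto dest: openin_subset\<close>)

section \<open>Cylinders of lines and the topology they generate\<close>

locale lf_tree = simplicial_tree V for V :: "'a::metric_space set" +
  assumes locally_finite: "x \<in> V \<Longrightarrow> finite {y \<in> V. dist x y = 1}"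
begin

lemma finite_sphere:
  assumes "x \<in> V"
  shows "finite {y \<in> V. dist x y = real n}"
proof (induction n)
  case 0
  have "{y \<in> V. dist x y = real 0} \<subseteq> {x}" by auto
  then show ?case using finite_subset by blast
next
  case (Suc n)
  have "{y \<in> V. dist x y = real (Suc n)} \<subseteq> (\<Union>z\<in>{y \<in> V. dist x y = real n}. {y \<in> V. dist z y = 1})"
  proof
    fix y assume "y \<in> {y \<in> V. dist x y = real (Suc n)}"
    then have y: "y \<in> V" "dist x y = real n + 1" by auto
    then obtain z where z: "btw x z y" "dist x z = real n" using segment_exists[of "real n" x y] by auto
    then have "z \<in> V" "dist z y = 1" using vertex_between[OF assms z] y by (auto simp: btw_def)
    then show "y \<in> (\<Union>z\<in>{y \<in> V. dist x y = real n}. {y \<in> V. dist z y = 1})" using z y by auto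
  qed
  moreover have "finite (\<Union>z\<in>{y \<in> V. dist x y = real n}. {y \<in> V. dist z y = 1})"
    using Suc locally_finite by auto
  ultimately show ?case by (rule finite_subset)
qed

lemma finite_ball: "x \<in> V \<Longrightarrow> finite {y \<in> V. dist x y \<le> R}"
proof -
  assume x: "x \<in> V"
  have "{y \<in> V. dist x y \<le> R} \<subseteq> (\<Union>n\<in>{..nat \<lfloor>R\<rfloor>}. {y \<in> V. dist x y = real n})"
  proof
    fix y assume "y \<in> {y \<in> V. dist x y \<le> R}"
    moreover obtain n where "dist x y = real n" using vertex_dist[OF x, of y] calculation by auto
    ultimately show "y \<in> (\<Union>n\<in>{..nat \<lfloor>R\<rfloor>}. {y \<in> V. dist x y = real n})" by (auto simp: le_nat_floor)
  qed
  then show ?thesis using finite_sphere[OF x] finite_subset by (metis (no_types, lifting) finite_UN finite_atMost)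
qed

lemma countable_V: "countable V"
proof -
  obtain x where x: "x \<in> V" using vertices_nonempty by blast
  have "V \<subseteq> (\<Union>n. {y \<in> V. dist x y = real n})" using vertex_dist[OF x] by blast
  moreover have "countable (\<Union>n. {y \<in> V. dist x y = real n})"
    using finite_sphere[OF x] by (intro countable_UN) (auto intro: countable_finite)
  ultimately show ?thesis using countable_subset by blast
qed

definition cyl :: "int \<Rightarrow> 'a \<Rightarrow> int \<Rightarrow> 'a \<Rightarrow> (real \<Rightarrow> 'a) set" where
  "cyl a w b w' = {l \<in> geodesics V. l (of_int a) = w \<and> l (of_int b) = w'}"

lemma geodesic_continuous: "l \<in> geodesics V \<Longrightarrow> continuous_on UNIV l"
  by (auto simp: geodesics_def intro: isometric_continuous)

lemma topspace_geodesics: "topspace (geodesics_topology V) = geodesics V"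
proof -
  have "geodesics V \<subseteq> topspace compact_open_topology"
    using openin_subset[OF openin_evaluation[OF open_UNIV, of 0]] geodesic_continuous by auto
  then show ?thesis by (auto simp: geodesics_topology_def)
qed

lemma openin_vertex_at: "openin (geodesics_topology V) {l \<in> geodesics V. l (of_int a) = w}"
proof (cases "w \<in> V")
  case True
  have iff: "l (of_int a) = w \<longleftrightarrow> l (of_int a) \<in> ball w 1" if "l \<in> geodesics V" for l
    using vertices_separated[OF True geodesicsD(2)[OF that], of a] by (cases "w = l (of_int a)") auto
  have "{l \<in> geodesics V. l (of_int a) = w} = {f. continuous_on UNIV f \<and> f (of_int a) \<in> ball w 1} \<inter> geodesics V"
  proof (intro equalityI subsetI)
    fix l assume "l \<in> {l \<in> geodesics V. l (of_int a) = w}"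
    then show "l \<in> {f. continuous_on UNIV f \<and> f (of_int a) \<in> ball w 1} \<inter> geodesics V"
      using iff[of l] geodesic_continuous[of l] by simp
  qed (use iff in simp)
  then show ?thesis unfolding geodesics_topology_def openin_subtopology
    by (intro exI conjI) (rule openin_evaluation[OF open_ball])
next
  case False
  then have "{l \<in> geodesics V. l (of_int a) = w} = {}" using geodesicsD(2) by blast
  then show ?thesis by (simp only: openin_empty)
qed

lemma openin_cyl: "openin (geodesics_topology V) (cyl a w b w')"
proof -
  have eq: "cyl a w b w' = {l \<in> geodesics V. l (of_int a) = w} \<inter> {l \<in> geodesics V. l (of_int b) = w'}"
    by (auto simp: cyl_def)
  show ?thesis unfolding eq by (intro openin_Int openin_vertex_at)
qed

lemma cyl_agree:
  assumes "l \<in> cyl a w b w'" "l' \<in> cyl a w b w'" "of_int a \<le> t" "t \<le> of_int b"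
  shows "l t = l' t"
  using geodesics_eq_between[of l l' "of_int a" "of_int a" "of_int b" "of_int b" t] assms by (simp add: cyl_def)

text \<open>A line is determined between two of its vertices, so prescribing it at times
  \<open>- n\<close> and \<open>n\<close> prescribes it on any compact set of times in between. The
  form valid for all large \<open>n\<close> leaves room to enlarge the window.\<close>

lemma openin_geodesics_iff:
  "openin (geodesics_topology V) D \<longleftrightarrow> D \<subseteq> geodesics V \<and>
     (\<forall>l\<in>D. \<exists>m::nat. \<forall>n\<ge>m. cyl (- int n) (l (of_int (- int n))) (int n) (l (of_int (int n))) \<subseteq> D)"
proof
  assume op: "openin (geodesics_topology V) D"
  then obtain W where W: "openin compact_open_topology W" "D = W \<inter> geodesics V"
    by (auto simp: geodesics_topology_def openin_subtopology)
  show "D \<subseteq> geodesics V \<and>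
     (\<forall>l\<in>D. \<exists>m::nat. \<forall>n\<ge>m. cyl (- int n) (l (of_int (- int n))) (int n) (l (of_int (int n))) \<subseteq> D)"
  proof (intro conjI ballI)
    fix l assume l: "l \<in> D"
    then have lW: "l \<in> W" using W(2) by simp
    obtain K where K: "compact K" "\<forall>f'. continuous_on UNIV f' \<longrightarrow> (\<forall>x\<in>K. f' x = l x) \<longrightarrow> f' \<in> W"
      using compact_open_determined[OF W(1) lW] by blast
    obtain B where B: "\<forall>x\<in>K. \<bar>x\<bar> \<le> B" using compact_imp_bounded[OF K(1)] by (auto simp: bounded_iff)
    obtain m :: nat where m: "B \<le> real m" using real_arch_simple by blast
    have "cyl (- int n) (l (of_int (- int n))) (int n) (l (of_int (int n))) \<subseteq> D" if n: "n \<ge> m" for n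
    proof
      fix l' assume l': "l' \<in> cyl (- int n) (l (of_int (- int n))) (int n) (l (of_int (int n)))"
      have lc: "l \<in> cyl (- int n) (l (of_int (- int n))) (int n) (l (of_int (int n)))"
        using l W by (auto simp: cyl_def)
      have "l' x = l x" if "x \<in> K" for x
      proof (rule cyl_agree[OF l' lc])
        have "\<bar>x\<bar> \<le> B" using B \<open>x \<in> K\<close> by blast
        moreover have "real m \<le> real n" using n by simp
        ultimately have "\<bar>x\<bar> \<le> real n" using m by linarith
        then have "- real n \<le> x \<and> x \<le> real n" by linarith
        then show "of_int (- int n) \<le> x" "x \<le> of_int (int n)" by simp_all
      qed
      moreover have g: "l' \<in> geodesics V" using l' by (simp add: cyl_def)
      ultimately have "l' \<in> W" using K(2)[rule_format, OF geodesic_continuous[OF g]] by blast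
      then show "l' \<in> D" using g W(2) by simp
    qed
    then show "\<exists>m::nat. \<forall>n\<ge>m. cyl (- int n) (l (of_int (- int n))) (int n) (l (of_int (int n))) \<subseteq> D" by blast
  qed (use W in auto)
next
  assume D: "D \<subseteq> geodesics V \<and>
     (\<forall>l\<in>D. \<exists>m::nat. \<forall>n\<ge>m. cyl (- int n) (l (of_int (- int n))) (int n) (l (of_int (int n))) \<subseteq> D)"
  show "openin (geodesics_topology V) D"
  proof (subst openin_subopen, intro ballI)
    fix l assume l: "l \<in> D"
    then obtain m :: nat where m: "\<forall>n\<ge>m. cyl (- int n) (l (of_int (- int n))) (int n) (l (of_int (int n))) \<subseteq> D"
      using D[THEN conjunct2, rule_format, OF l] by blast
    let ?C = "cyl (- int m) (l (of_int (- int m))) (int m) (l (of_int (int m)))"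
    have "l \<in> geodesics V" using D l by blast
    then have "l \<in> ?C" by (simp add: cyl_def)
    moreover have "?C \<subseteq> D" using m[rule_format, OF order_refl] .
    ultimately show "\<exists>T. openin (geodesics_topology V) T \<and> l \<in> T \<and> T \<subseteq> D"
      by (intro exI[of _ ?C] conjI openin_cyl)
  qed
qed

text \<open>The countable family indexing this union keeps only the cylinders with
  \<open>n > 0\<close> and end vertices at the exact distance, the non-degenerate ones to which
  \<open>cyl_iff\<close> applies.\<close>

lemma open_as_cylinders:
  assumes "openin (geodesics_topology V) D"
  shows "D = (\<Union>(n, w, w')\<in>{(n, w, w'). n > 0 \<and> w \<in> V \<and> w' \<in> V \<and> dist w w' = real (2 * n) \<and> cyl (- int n) w (int n) w' \<subseteq> D}.
      cyl (- int n) w (int n) w')" (is "D = ?U")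
proof (intro equalityI subsetI)
  fix l assume l: "l \<in> D"
  have lg: "l \<in> geodesics V" using assms l by (simp only: openin_geodesics_iff) blast
  obtain m :: nat where m: "\<forall>n\<ge>m. cyl (- int n) (l (of_int (- int n))) (int n) (l (of_int (int n))) \<subseteq> D"
    using assms l by (simp only: openin_geodesics_iff) blast
  define n where "n = Suc m"
  let ?w = "l (of_int (- int n))" and ?w' = "l (of_int (int n))"
  have "cyl (- int n) ?w (int n) ?w' \<subseteq> D"
  proof -
    have "m \<le> n" by (simp add: n_def)
    then show ?thesis using m by blast
  qed
  moreover have "dist ?w ?w' = real (2 * n)" using geodesicsD(1)[OF lg] by simp
  moreover have "?w \<in> V" "?w' \<in> V" by (rule geodesicsD(2)[OF lg])+
  moreover have "l \<in> cyl (- int n) ?w (int n) ?w'" using lg by (simp add: cyl_def)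
  ultimately show "l \<in> ?U" by (intro UN_I[of "(n, ?w, ?w')"]) (auto simp: n_def)
qed auto

section \<open>Borel sets of ends, and cylinders in Hopf coordinates\<close>

lemma topspace_ends: "topspace (ends_topology V) = ends"
proof -
  obtain x where x: "x \<in> V" using vertices_nonempty by blast
  have "\<xi> \<in> {\<xi> \<in> ends. x \<in> ray_to x \<xi>}" if "\<xi> \<in> ends" for \<xi>
    using shadow_self[OF that, of x] by (simp add: shadow_def)
  then show ?thesis unfolding ends_topology_def topology_generated_by_topspace using x by blast
qed

lemma openin_shadow: "x \<in> V \<Longrightarrow> y \<in> V \<Longrightarrow> openin (ends_topology V) (shadow x y)"
  unfolding ends_topology_def shadow_def by (rule topology_generated_by_Basis) blast

abbreviation "ends_borel \<equiv> borel_of (ends_topology V)"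

lemma shadow_sets: "x \<in> V \<Longrightarrow> y \<in> V \<Longrightarrow> shadow x y \<in> sets ends_borel"
  by (intro borel_of_open openin_shadow)

text \<open>By \<open>shadow_common\<close> every end lies in the two shadows of some vertex
  \<open>w\<close>, where the cocycle has a constant value; so a preimage is a countable union of
  intersections of two shadows.\<close>

lemma busemann_meas:
  assumes x: "x \<in> V" and y: "y \<in> V"
  shows "(\<lambda>\<xi>. busemann V \<xi> x y) \<in> borel_measurable ends_borel"
proof (rule measurableI)
  fix B :: "real set"
  have "(\<lambda>\<xi>. busemann V \<xi> x y) -` B \<inter> space ends_borel =
      (\<Union>w\<in>{w \<in> V. dist x w - dist w y \<in> B}. shadow x w \<inter> shadow y w)" (is "?L = ?R")
  proof (intro equalityI subsetI)
    fix \<xi> assume "\<xi> \<in> ?L"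
    then have xi: "\<xi> \<in> ends" "busemann V \<xi> x y \<in> B" by (auto simp: topspace_ends)
    obtain w where w: "w \<in> V" "\<xi> \<in> shadow x w" "\<xi> \<in> shadow y w" using shadow_common[OF xi(1) x] by blast
    then show "\<xi> \<in> ?R" using busemann_eq[OF x w(2,3)] xi by auto
  next
    fix \<xi> assume "\<xi> \<in> ?R"
    then obtain w where w: "w \<in> V" "\<xi> \<in> shadow x w" "\<xi> \<in> shadow y w" "dist x w - dist w y \<in> B" by blast
    then show "\<xi> \<in> ?L" using busemann_eq[OF x w(2,3)] shadow_ends by (auto simp: topspace_ends)
  qed
  also have "?R \<in> sets ends_borel"
    using x y countable_subset[OF _ countable_V, of "{w \<in> V. dist x w - dist w y \<in> B}"]
    by (intro sets.countable_UN') (auto intro!: sets.Int shadow_sets)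
  finally show "?L \<in> sets ends_borel" .
qed simp

lemma busemann_antisym:
  assumes "\<xi> \<in> ends" "x \<in> V" "y \<in> V"
  shows "busemann V \<xi> y x = - busemann V \<xi> x y"
proof -
  obtain w where w: "w \<in> V" "\<xi> \<in> shadow x w" "\<xi> \<in> shadow y w" using shadow_common[OF assms(1,2)] by blast
  then show ?thesis using busemann_eq[OF assms(2) w(2,3)] busemann_eq[OF assms(3) w(3,2)] by (simp add: dist_commute)
qed

text \<open>Take \<open>u\<close> on the line so far towards its end that the ray from
  \<open>w'\<close> has joined it, and \<open>v\<close> likewise towards the origin and for
  \<open>w\<close>. The overlap \<open>[w, w']\<close> makes \<open>v\<close>, \<open>w\<close>,
  \<open>w'\<close>, \<open>u\<close> geodesic in this order, and the segment from \<open>v\<close>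
  to \<open>u\<close> is part of the line.\<close>

lemma line_through:
  assumes l: "l \<in> geodesics V" and w: "w \<in> V" "w' \<in> V" "w \<noteq> w'"
    and s: "origin l \<in> shadow w' w" "end_of l \<in> shadow w w'"
  obtains s :: int where "l (of_int s) = w" "l (of_int s + dist w w') = w'"
proof -
  note e = line_ends[OF l]
  have l0: "l 0 \<in> V" using l by (simp add: geodesics_def)
  obtain u where u: "end_of l \<in> shadow (l 0) u" "end_of l \<in> shadow w' u" using shadow_common[OF e(1) l0, of w'] by blast
  obtain v where v: "origin l \<in> shadow (l 0) v" "origin l \<in> shadow w v" using shadow_common[OF e(2) l0, of w] by blast
  have lu: "u = l (dist (l 0) u)" using u shadow_iff[OF e(1)] ray_line(1)[OF l, of "dist (l 0) u" 0] by simp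
  have lv: "v = l (- dist (l 0) v)" using v shadow_iff[OF e(2)] ray_line(2)[OF l, of "dist (l 0) v" 0] by simp
  have b1: "btw w w' u" using shadow_trans(2)[OF s(2) u(2)] .
  have b2: "btw v w w'" using shadow_trans(2)[OF s(1) v(2)] by (simp add: btw_sym)
  have b3: "btw v w u" by (rule btw_local_global'[OF b2 b1 w(3)])
  have b4: "btw v w' u" by (rule btw_local_global[OF b2 b1 w(3)])
  define p where "p = - dist (l 0) v"
  have lvu: "dist v u = dist (l 0) u - p"
    unfolding p_def
    using geodesicsD(1)[OF l, of "- dist (l 0) v" "dist (l 0) u"] lu[symmetric] lv[symmetric]
      zero_le_dist[of "l 0" u] zero_le_dist[of "l 0" v] by simp
  have pt: "z = l (p + dist v z)" if "btw v z u" for z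
  proof (rule segment_unique[OF that])
    have le: "dist v z \<le> dist v u" using that by (simp add: btw_def)
    have "btw (l p) (l (p + dist v z)) (l (dist (l 0) u))" by (rule geodesic_btw[OF l]) (use le lvu in auto)
    then show "btw v (l (p + dist v z)) u" using lu lv by (simp add: p_def)
    show "dist v z = dist v (l (p + dist v z))" using geodesicsD(1)[OF l, of p "p + dist v z"] lv by (simp add: p_def)
  qed
  have lw: "w = l (p + dist v w)" by (rule pt[OF b3])
  have lw': "w' = l (p + dist v w')" by (rule pt[OF b4])
  obtain s where s: "p + dist v w = of_int s" using geodesic_vertex_int[OF l, of "p + dist v w"] lw w(1) by auto
  have "dist v w' = dist v w + dist w w'" using b2 by (simp add: btw_def)
  then have "p + dist v w' = of_int s + dist w w'" using s by simp
  then have "l (of_int s + dist w w') = w'" using lw' by (simp only:)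
  moreover have "l (of_int s) = w" using lw s by simp
  ultimately show ?thesis using that by blast
qed

text \<open>In Hopf coordinates a cylinder is a product of opposite shadows on which each pair of
  ends leaves a single time coordinate. By \<open>busemann_line\<close>, half the difference of the
  cocycles is the time from the foot to the passage through \<open>w\<close>.\<close>

lemma cyl_iff:
  assumes l: "l \<in> geodesics V" and y: "y \<in> V" and w: "w \<in> V" "w' \<in> V" and d: "dist w w' = of_int (b - a)" "a < b"
  shows "l \<in> cyl a w b w' \<longleftrightarrow> origin l \<in> shadow w' w \<and> end_of l \<in> shadow w w' \<and>
    busemann V (end_of l) y w - busemann V (origin l) y w = 2 * of_int (a - foot y l)"
proof
  assume "l \<in> cyl a w b w'"
  then have lw: "l (of_int a) = w" "l (of_int b) = w'" by (auto simp: cyl_def)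
  have "end_of l \<in> shadow w w'"
    using shadow_iff[OF line_ends(1)[OF l]] ray_line(1)[OF l, of "dist w w'" "of_int a"] lw d by simp
  moreover have "origin l \<in> shadow w' w"
    using shadow_iff[OF line_ends(2)[OF l]] ray_line(2)[OF l, of "dist w w'" "of_int b"] lw d by (simp add: dist_commute)
  ultimately show "origin l \<in> shadow w' w \<and> end_of l \<in> shadow w w' \<and>
    busemann V (end_of l) y w - busemann V (origin l) y w = 2 * of_int (a - foot y l)"
    using busemann_line[OF y l, of a] lw by simp
next
  assume r: "origin l \<in> shadow w' w \<and> end_of l \<in> shadow w w' \<and>
    busemann V (end_of l) y w - busemann V (origin l) y w = 2 * of_int (a - foot y l)"
  have "w \<noteq> w'" using d by auto
  then obtain s :: int where s: "l (of_int s) = w" "l (of_int s + dist w w') = w'"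
    using line_through[OF l w] r by blast
  have "s = a" using busemann_line[OF y l, of s] s r by simp
  then show "l \<in> cyl a w b w'" using s l d by (simp add: cyl_def)
qed

end

subsection \<open>The Bowen-Margulis measure of a cylinder\<close>

locale ps_tree = lf_tree V for V :: "'a::metric_space set" +
  fixes \<Gamma> :: "('a \<Rightarrow> 'a) set" and \<delta> :: real and \<mu> :: "'a \<Rightarrow> 'a tree_end measure" and y0 :: 'a
  assumes ps: "patterson_sullivan V \<Gamma> \<delta> \<mu>" and y0: "y0 \<in> V"
begin

lemma sets_mu: "x \<in> V \<Longrightarrow> sets (\<mu> x) = sets ends_borel"
  and finite_mu: "x \<in> V \<Longrightarrow> finite_measure (\<mu> x)"
  and mu_equivariant: "g \<in> \<Gamma> \<Longrightarrow> x \<in> V \<Longrightarrow> distr (\<mu> x) ends_borel (end_action g) = \<mu> (g x)"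
  and mu_density: "x \<in> V \<Longrightarrow> y \<in> V \<Longrightarrow>
    \<mu> x = density (\<mu> y) (\<lambda>\<xi>. ennreal (exp (- \<delta> * busemann V \<xi> x y)))"
  using ps unfolding patterson_sullivan_def by blast+

lemma space_mu: "x \<in> V \<Longrightarrow> space (\<mu> x) = ends"
  using sets_eq_imp_space_eq[OF sets_mu] by (simp add: topspace_ends)

lemma busemann_meas_mu:
  assumes "z \<in> V" "x \<in> V" "y \<in> V"
  shows "(\<lambda>\<xi>. busemann V \<xi> x y) \<in> borel_measurable (\<mu> z)"
  using busemann_meas[OF assms(2,3)] measurable_cong_sets[OF sets_mu[OF assms(1)] refl] by blast

lemma shadow_sets_mu: "z \<in> V \<Longrightarrow> x \<in> V \<Longrightarrow> y \<in> V \<Longrightarrow> shadow x y \<in> sets (\<mu> z)"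
  using shadow_sets sets_mu by blast

definition H :: "'a tree_end \<times> 'a tree_end \<times> int \<Rightarrow> real \<Rightarrow> 'a" where
  "H = the_inv_into (geodesics V) (hopf_param y0)"

definition lines :: "('a tree_end \<times> 'a tree_end \<times> int) set" where
  "lines = {(\<xi>, \<eta>, t). \<xi> \<in> ends \<and> \<eta> \<in> ends \<and> \<xi> \<noteq> \<eta>}"

lemma H_props:
  assumes "(\<xi>, \<eta>, t) \<in> lines"
  shows "H (\<xi>, \<eta>, t) \<in> geodesics V" "origin (H (\<xi>, \<eta>, t)) = \<xi>" "end_of (H (\<xi>, \<eta>, t)) = \<eta>" "foot y0 (H (\<xi>, \<eta>, t)) = t"
proof -
  note b = hopf_param_bij[OF y0, folded lines_def]
  show "H (\<xi>, \<eta>, t) \<in> geodesics V"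
    unfolding H_def using bij_betwE[OF bij_betw_the_inv_into[OF b]] assms by blast
  have "hopf_param y0 (H (\<xi>, \<eta>, t)) = (\<xi>, \<eta>, t)"
    unfolding H_def by (rule f_the_inv_into_f_bij_betw[OF b]) (use assms in simp)
  then show "origin (H (\<xi>, \<eta>, t)) = \<xi>" "end_of (H (\<xi>, \<eta>, t)) = \<eta>" "foot y0 (H (\<xi>, \<eta>, t)) = t"
    by (simp_all add: hopf_param_eq)
qed

definition prod3 where
  "prod3 = \<mu> y0 \<Otimes>\<^sub>M (\<mu> y0 \<Otimes>\<^sub>M count_space (UNIV :: int set))"

definition hopf_space where
  "hopf_space = restrict_space prod3 {(\<xi>, \<eta>, t). \<xi> \<noteq> \<eta>}"

definition dens :: "'a tree_end \<times> 'a tree_end \<times> int \<Rightarrow> ennreal" where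
  "dens = (\<lambda>(\<xi>, \<eta>, t). ennreal (1 / visual_dist y0 \<xi> \<eta> powr (2 * \<delta>)))"

abbreviation "BM \<equiv> bowen_margulis V \<delta> \<mu> y0"

lemma BM_eq: "BM = distr (density hopf_space dens) (borel_of (geodesics_topology V)) H"
  unfolding bowen_margulis_def hopf_space_def dens_def H_def prod3_def ..

lemma space_prod3: "space prod3 = {(\<xi>, \<eta>, t). \<xi> \<in> ends \<and> \<eta> \<in> ends}"
  by (auto simp: prod3_def space_pair_measure space_mu[OF y0])

lemma space_hopf_space: "space hopf_space = lines"
  by (auto simp: hopf_space_def space_restrict_space space_prod3 lines_def)

text \<open>The lines running from \<open>w\<close> to \<open>w'\<close>, with arbitrary time
  coordinate. Countably many pieces cover the pairs of distinct ends; the measurability of the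
  complement of the diagonal is deduced from this.\<close>

definition piece :: "'a \<Rightarrow> 'a \<Rightarrow> ('a tree_end \<times> 'a tree_end \<times> int) set" where
  "piece w w' = shadow w' w \<times> (shadow w w' \<times> UNIV)"

lemma piece_sets:
  assumes "w \<in> V" "w' \<in> V"
  shows "piece w w' \<in> sets prod3"
  unfolding piece_def prod3_def
  by (intro pair_measureI shadow_sets_mu y0 assms) simp

lemma piece_subset: "w \<noteq> w' \<Longrightarrow> piece w w' \<subseteq> lines"
proof
  fix z assume ne: "w \<noteq> w'" and "z \<in> piece w w'"
  then obtain \<xi> \<eta> t where z: "z = (\<xi>, \<eta>, t)" "\<xi> \<in> shadow w' w" "\<eta> \<in> shadow w w'" by (auto simp: piece_def)
  have e: "\<xi> \<in> ends" "\<eta> \<in> ends" using z shadow_ends by blast+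
  have "\<xi> \<noteq> \<eta>"
  proof
    assume "\<xi> = \<eta>"
    then have "btw w' w w'" using shadow_trans(2)[OF z(2), of w'] z(3) by simp
    then show False using ne by (simp add: btw_def dist_commute)
  qed
  then show "z \<in> lines" using z e by (simp add: lines_def)
qed

lemma lines_eq: "lines = (\<Union>(w, w')\<in>{(w, w'). w \<in> V \<and> w' \<in> V \<and> w \<noteq> w'}. piece w w')"
proof (intro equalityI subsetI)
  fix z assume "z \<in> lines"
  then obtain \<xi> \<eta> t where z: "z = (\<xi>, \<eta>, t)" "(\<xi>, \<eta>, t) \<in> lines" by (auto simp: lines_def)
  note l = H_props[OF z(2)]
  let ?l = "H (\<xi>, \<eta>, t)"
  have "?l \<in> cyl 0 (?l (of_int 0)) 1 (?l (of_int 1))" using l by (simp add: cyl_def)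
  moreover have d: "dist (?l (of_int 0)) (?l (of_int 1)) = of_int (1 - 0)" using geodesicsD(1)[OF l(1)] by simp
  ultimately have "\<xi> \<in> shadow (?l (of_int 1)) (?l (of_int 0)) \<and> \<eta> \<in> shadow (?l (of_int 0)) (?l (of_int 1))"
    using cyl_iff[OF l(1) y0 geodesicsD(2)[OF l(1)] geodesicsD(2)[OF l(1)] d] l by simp
  then have "z \<in> piece (?l (of_int 0)) (?l (of_int 1))" using z by (simp add: piece_def)
  moreover have "?l (of_int 0) \<in> V" "?l (of_int 1) \<in> V" by (rule geodesicsD(2)[OF l(1)])+
  moreover have "?l (of_int 0) \<noteq> ?l (of_int 1)" using d by auto
  ultimately show "z \<in> (\<Union>(w, w')\<in>{(w, w'). w \<in> V \<and> w' \<in> V \<and> w \<noteq> w'}. piece w w')" by blast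
qed (use piece_subset in auto)

lemma countable_pairs: "countable {(w, w'). w \<in> V \<and> w' \<in> V \<and> Q w w'}"
  by (rule countable_subset[of _ "V \<times> V"]) (auto intro: countable_V)

lemma lines_sets: "lines \<in> sets prod3"
  unfolding lines_eq by (intro sets.countable_UN' countable_pairs) (auto intro: piece_sets)

lemma distinct_Int: "{(\<xi>, \<eta>, t). \<xi> \<noteq> \<eta>} \<inter> space prod3 = lines"
  by (auto simp: space_prod3 lines_def)

lemma sets_hopf_space: "E \<in> sets hopf_space \<longleftrightarrow> E \<in> sets prod3 \<and> E \<subseteq> lines"
proof -
  have "E \<in> sets hopf_space \<longleftrightarrow> E \<in> sets prod3 \<and> E \<subseteq> {(\<xi>, \<eta>, t). \<xi> \<noteq> \<eta>}"
    unfolding hopf_space_def using sets_restrict_space_iff[of "{(\<xi>, \<eta>, t). \<xi> \<noteq> \<eta>}" prod3 E] distinct_Int lines_sets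
    by auto
  then show ?thesis using sets.sets_into_space[of E prod3] by (auto simp: space_prod3 lines_def)
qed

lemma busemann_meas_prod3:
  assumes "w \<in> V"
  shows "(\<lambda>z. busemann V (fst z) y0 w) \<in> borel_measurable prod3"
    "(\<lambda>z. busemann V (fst (snd z)) y0 w) \<in> borel_measurable prod3"
    "(\<lambda>z. snd (snd z)) \<in> measurable prod3 (count_space UNIV)"
proof -
  have m: "(\<lambda>\<xi>. busemann V \<xi> y0 w) \<in> borel_measurable (\<mu> y0)" by (rule busemann_meas_mu[OF y0 y0 assms])
  show "(\<lambda>z. busemann V (fst z) y0 w) \<in> borel_measurable prod3"
    unfolding prod3_def by (rule measurable_compose[OF measurable_fst m])
  show "(\<lambda>z. busemann V (fst (snd z)) y0 w) \<in> borel_measurable prod3"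
    unfolding prod3_def by (rule measurable_compose[OF measurable_compose[OF measurable_snd measurable_fst] m])
  show "(\<lambda>z. snd (snd z)) \<in> measurable prod3 (count_space UNIV)"
    unfolding prod3_def by (rule measurable_compose[OF measurable_snd measurable_snd])
qed

lemma H_cyl:
  assumes w: "w \<in> V" "w' \<in> V" and d: "dist w w' = of_int (b - a)" "a < b"
  shows "{z \<in> lines. H z \<in> cyl a w b w'} = {(\<xi>, \<eta>, t). \<xi> \<in> shadow w' w \<and> \<eta> \<in> shadow w w' \<and>
    busemann V \<eta> y0 w - busemann V \<xi> y0 w = 2 * of_int (a - t)}" (is "?L = ?R")
proof -
  have ne: "w \<noteq> w'" using d by auto
  have iff: "(\<xi>, \<eta>, t) \<in> ?L \<longleftrightarrow> (\<xi>, \<eta>, t) \<in> ?R" for \<xi> \<eta> t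
  proof (cases "(\<xi>, \<eta>, t) \<in> lines")
    case True
    show ?thesis using True cyl_iff[OF H_props(1)[OF True] y0 w d] H_props[OF True] by simp
  next
    case False
    then have "(\<xi>, \<eta>, t) \<notin> piece w w'" using piece_subset[OF ne] by blast
    then show ?thesis using False by (auto simp: piece_def)
  qed
  show ?thesis
  proof (rule set_eqI)
    fix z :: "'a tree_end \<times> 'a tree_end \<times> int"
    obtain \<xi> \<eta> t where z: "z = (\<xi>, \<eta>, t)" by (rule prod_cases3)
    show "z \<in> ?L \<longleftrightarrow> z \<in> ?R" unfolding z by (rule iff)
  qed
qed

lemma H_cyl_sets:
  assumes w: "w \<in> V" "w' \<in> V" and d: "dist w w' = of_int (b - a)" "a < b"
  shows "{z \<in> lines. H z \<in> cyl a w b w'} \<in> sets prod3"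
proof -
  note [measurable] = busemann_meas_prod3[OF w(1)]
  have "{z \<in> space prod3. busemann V (fst (snd z)) y0 w - busemann V (fst z) y0 w = 2 * of_int (a - snd (snd z))} \<in> sets prod3"
    by measurable
  moreover have "{z \<in> lines. H z \<in> cyl a w b w'} = piece w w' \<inter>
      {z \<in> space prod3. busemann V (fst (snd z)) y0 w - busemann V (fst z) y0 w = 2 * of_int (a - snd (snd z))}"
    unfolding H_cyl[OF assms] using shadow_ends by (auto simp: piece_def space_prod3)
  ultimately show ?thesis using piece_sets[OF w] by simp
qed

lemma H_meas: "H \<in> measurable hopf_space (borel_of (geodesics_topology V))"
proof (rule measurable_borel_of)
  show "H \<in> space hopf_space \<rightarrow> topspace (geodesics_topology V)"
    unfolding space_hopf_space topspace_geodesics using H_props(1) by (auto simp: lines_def)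
  fix D assume D: "openin (geodesics_topology V) D"
  define I where "I = {(n, w, w'). n > 0 \<and> w \<in> V \<and> w' \<in> V \<and> dist w w' = real (2 * n) \<and> cyl (- int n) w (int n) w' \<subseteq> D}"
  have D_eq: "D = (\<Union>(n, w, w')\<in>I. cyl (- int n) w (int n) w')"
    unfolding I_def by (rule open_as_cylinders[OF D])
  have "countable I"
    by (rule countable_subset[of _ "UNIV \<times> V \<times> V"]) (auto simp: I_def intro: countable_V)
  have "H -` D \<inter> space hopf_space = (\<Union>(n, w, w')\<in>I. {z \<in> lines. H z \<in> cyl (- int n) w (int n) w'})"
    unfolding space_hopf_space by (subst D_eq) auto
  also have "\<dots> \<in> sets prod3"
  proof (rule sets.countable_UN'[OF \<open>countable I\<close>], rule image_subsetI)
    fix i assume "i \<in> I"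
    then obtain n w w' where i: "i = (n, w, w')" "n > 0" "w \<in> V" "w' \<in> V" "dist w w' = real (2 * n)"
      by (auto simp: I_def)
    have "{z \<in> lines. H z \<in> cyl (- int n) w (int n) w'} \<in> sets prod3"
      by (rule H_cyl_sets) (use i in auto)
    then show "(case i of (n, w, w') \<Rightarrow> {z \<in> lines. H z \<in> cyl (- int n) w (int n) w'}) \<in> sets prod3"
      using i by simp
  qed
  finally show "H -` D \<inter> space hopf_space \<in> sets hopf_space"
    by (auto simp: sets_hopf_space space_hopf_space)
qed

lemma dens_piece:
  assumes w: "w \<in> V" "w' \<in> V" "w \<noteq> w'" and z: "(\<xi>, \<eta>, t) \<in> piece w w'"
  shows "dens (\<xi>, \<eta>, t) = ennreal (exp (\<delta> * busemann V \<xi> y0 w)) * ennreal (exp (\<delta> * busemann V \<eta> y0 w))"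
proof -
  have zl: "(\<xi>, \<eta>, t) \<in> lines" using piece_subset[OF w(3)] z by blast
  note l = H_props[OF zl]
  let ?l = "H (\<xi>, \<eta>, t)"
  obtain s :: int where s: "?l (of_int s) = w"
    using line_through[OF l(1) w] l z by (auto simp: piece_def)
  define D where "D = dist y0 (?l (of_int t))"
  have v: "visual_dist y0 \<xi> \<eta> = exp (- D)" using visual_dist_line[OF y0 l(1)] l by (simp add: D_def)
  have b: "busemann V \<xi> y0 w + busemann V \<eta> y0 w = 2 * D"
    using busemann_line[OF y0 l(1), of s] l s by (simp add: D_def)
  have "1 / visual_dist y0 \<xi> \<eta> powr (2 * \<delta>) = exp (\<delta> * (2 * D))"
    unfolding v by (simp add: powr_def exp_minus[symmetric] inverse_eq_divide[symmetric] algebra_simps)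
  also have "\<dots> = exp (\<delta> * busemann V \<xi> y0 w) * exp (\<delta> * busemann V \<eta> y0 w)"
    unfolding b[symmetric] by (simp add: distrib_left exp_add)
  finally show ?thesis by (simp add: dens_def ennreal_mult)
qed

text \<open>The visual distance is defined by a diameter of an intersection of rays, which is
  awkward to measure. On each piece the density is a function of two Busemann cocycles by
  \<open>dens_piece\<close>, and countably many pieces suffice.\<close>

lemma dens_meas: "dens \<in> borel_measurable hopf_space"
proof (rule measurableI)
  fix B :: "ennreal set" assume B: "B \<in> sets borel"
  define f where "f w z = ennreal (exp (\<delta> * busemann V (fst z) y0 w)) * ennreal (exp (\<delta> * busemann V (fst (snd z)) y0 w))"
    for w and z :: "'a tree_end \<times> 'a tree_end \<times> int"
  have dp: "dens z = f w z" if "w \<in> V" "w' \<in> V" "w \<noteq> w'" "z \<in> piece w w'" for w w' z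
  proof -
    obtain \<xi> \<eta> t where "z = (\<xi>, \<eta>, t)" using prod_cases3 by blast
    then show ?thesis using dens_piece[OF that(1-3), of \<xi> \<eta> t] that(4) by (simp add: f_def)
  qed
  have "dens -` B \<inter> space hopf_space =
      (\<Union>(w, w')\<in>{(w, w'). w \<in> V \<and> w' \<in> V \<and> w \<noteq> w'}. piece w w' \<inter> (f w -` B \<inter> space prod3))" (is "?L = ?R")
  proof (intro equalityI subsetI)
    fix z assume "z \<in> ?L"
    then have z: "z \<in> lines" "dens z \<in> B" by (auto simp: space_hopf_space)
    obtain w w' where w: "w \<in> V" "w' \<in> V" "w \<noteq> w'" "z \<in> piece w w'" using z(1) unfolding lines_eq by blast
    have "z \<in> space prod3" using z(1) sets.sets_into_space[OF lines_sets] by blast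
    then show "z \<in> ?R" using w z dp[OF w] by auto
  next
    fix z assume "z \<in> ?R"
    then obtain w w' where w: "w \<in> V" "w' \<in> V" "w \<noteq> w'" "z \<in> piece w w'" and "f w z \<in> B" by blast
    then show "z \<in> ?L" using dp[OF w] piece_subset[OF w(3)] by (auto simp: space_hopf_space)
  qed
  also have "?R \<in> sets prod3"
  proof (rule sets.countable_UN'[OF countable_pairs], rule image_subsetI)
    fix p assume "p \<in> {(w, w'). w \<in> V \<and> w' \<in> V \<and> w \<noteq> w'}"
    then obtain w w' where p: "p = (w, w')" "w \<in> V" "w' \<in> V" by auto
    note [measurable] = busemann_meas_prod3[OF p(2)]
    have "f w \<in> borel_measurable prod3" unfolding f_def by measurable
    then have "f w -` B \<inter> space prod3 \<in> sets prod3" using B by (rule measurable_sets)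
    then show "(case p of (w, w') \<Rightarrow> piece w w' \<inter> (f w -` B \<inter> space prod3)) \<in> sets prod3"
      using piece_sets[OF p(2,3)] p by auto
  qed
  finally show "dens -` B \<inter> space hopf_space \<in> sets hopf_space"
    by (auto simp: sets_hopf_space space_hopf_space)
qed simp

lemma emeasure_shadow:
  assumes w: "w \<in> V" and S: "S \<in> sets (\<mu> y0)"
  shows "emeasure (\<mu> w) S = (\<integral>\<^sup>+\<xi>. ennreal (exp (\<delta> * busemann V \<xi> y0 w)) * indicator S \<xi> \<partial>\<mu> y0)"
proof -
  note [measurable] = busemann_meas_mu[OF y0 w y0]
  have "emeasure (\<mu> w) S = emeasure (density (\<mu> y0) (\<lambda>\<xi>. ennreal (exp (- \<delta> * busemann V \<xi> w y0)))) S"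
    using mu_density[OF w y0] by simp
  also have "\<dots> = (\<integral>\<^sup>+\<xi>. ennreal (exp (- \<delta> * busemann V \<xi> w y0)) * indicator S \<xi> \<partial>\<mu> y0)"
    by (rule emeasure_density) (use S in measurable)
  also have "\<dots> = (\<integral>\<^sup>+\<xi>. ennreal (exp (\<delta> * busemann V \<xi> y0 w)) * indicator S \<xi> \<partial>\<mu> y0)"
    by (rule nn_integral_cong) (simp add: space_mu[OF y0] busemann_antisym[OF _ y0 w])
  finally show ?thesis .
qed

text \<open>On the lines through \<open>w\<close>, the visual distance of the ends is \<open>exp\<close> of minus half the sum of
  their Busemann cocycles between \<open>y0\<close> and \<open>w\<close>. So the density of the Bowen-Margulis measure moves the
  base point of both Patterson-Sullivan factors from \<open>y0\<close> to \<open>w\<close>, where it disappears.\<close>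

lemma emeasure_cyl:
  assumes w: "w \<in> V" "w' \<in> V" and d: "dist w w' = of_int (b - a)" "a < b"
  shows "emeasure BM (cyl a w b w') = emeasure (\<mu> w) (shadow w' w) * emeasure (\<mu> w) (shadow w w')"
proof -
  have ne: "w \<noteq> w'" using d by auto
  define E where "E = {z \<in> lines. H z \<in> cyl a w b w'}"
  have E: "E \<in> sets prod3" "E \<subseteq> lines" unfolding E_def using H_cyl_sets[OF assms] by auto
  define p where "p \<xi> = ennreal (exp (\<delta> * busemann V \<xi> y0 w)) * indicator (shadow w' w) \<xi>" for \<xi>
  define q where "q \<eta> = ennreal (exp (\<delta> * busemann V \<eta> y0 w)) * indicator (shadow w w') \<eta>" for \<eta>
  \<comment> \<open>The time constraint. For fixed ends in the two shadows exactly one integer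
    \<open>t\<close> satisfies it, so integrating over \<open>t\<close> contributes the factor 1 and
    leaves a product of two integrals.\<close>
  define r where "r \<xi> \<eta> t = (indicator {t. busemann V \<eta> y0 w - busemann V \<xi> y0 w = 2 * of_int (a - t)} t :: ennreal)"
    for \<xi> \<eta> and t :: int
  note [measurable] = busemann_meas_prod3[OF w(1)] busemann_meas_mu[OF y0 y0 w(1)]
  note [measurable] = shadow_sets_mu[OF y0 w] shadow_sets_mu[OF y0 w(2,1)]
  have pm [measurable]: "p \<in> borel_measurable (\<mu> y0)" and qm [measurable]: "q \<in> borel_measurable (\<mu> y0)"
    unfolding p_def q_def by measurable
  have rm: "(\<lambda>(\<xi>, \<eta>, t). r \<xi> \<eta> t) \<in> borel_measurable prod3"
  proof -
    have "(\<lambda>z. indicator {z \<in> space prod3. busemann V (fst (snd z)) y0 w - busemann V (fst z) y0 w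
        = 2 * of_int (a - snd (snd z))} z :: ennreal) \<in> borel_measurable prod3" by measurable
    then show ?thesis
      by (rule measurable_cong[THEN iffD1, rotated]) (auto simp: r_def indicator_def)
  qed
  have "emeasure BM (cyl a w b w') = emeasure (density hopf_space dens) (H -` cyl a w b w' \<inter> space (density hopf_space dens))"
    unfolding BM_eq by (rule emeasure_distr) (use H_meas borel_of_open[OF openin_cyl] in auto)
  also have "H -` cyl a w b w' \<inter> space (density hopf_space dens) = E"
    by (auto simp: E_def space_hopf_space)
  also have "emeasure (density hopf_space dens) E = (\<integral>\<^sup>+z. dens z * indicator E z \<partial>hopf_space)"
    by (rule emeasure_density[OF dens_meas]) (use E in \<open>simp add: sets_hopf_space\<close>)
  also have "\<dots> = (\<integral>\<^sup>+z. dens z * indicator E z * indicator {(\<xi>, \<eta>, t). \<xi> \<noteq> \<eta>} z \<partial>prod3)"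
    unfolding hopf_space_def by (rule nn_integral_restrict_space) (simp add: distinct_Int lines_sets)
  also have "\<dots> = (\<integral>\<^sup>+z. (\<lambda>(\<xi>, \<eta>, t). p \<xi> * (q \<eta> * r \<xi> \<eta> t)) z \<partial>prod3)"
  proof (rule nn_integral_cong)
    fix z assume "z \<in> space prod3"
    obtain \<xi> \<eta> t where z: "z = (\<xi>, \<eta>, t)" using prod_cases3 by blast
    show "dens z * indicator E z * indicator {(\<xi>, \<eta>, t). \<xi> \<noteq> \<eta>} z = (\<lambda>(\<xi>, \<eta>, t). p \<xi> * (q \<eta> * r \<xi> \<eta> t)) z"
    proof (cases "z \<in> E")
      case True
      then have 1: "\<xi> \<in> shadow w' w" "\<eta> \<in> shadow w w'" "busemann V \<eta> y0 w - busemann V \<xi> y0 w = 2 * of_int (a - t)"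
        unfolding E_def H_cyl[OF assms] z by auto
      then have "z \<in> piece w w'" by (simp add: z piece_def)
      moreover have "\<xi> \<noteq> \<eta>" using E(2) True z by (auto simp: lines_def)
      ultimately show ?thesis using True 1 dens_piece[OF w ne] by (simp add: z p_def q_def r_def mult.assoc)
    next
      case False
      then have "\<not> (\<xi> \<in> shadow w' w \<and> \<eta> \<in> shadow w w' \<and> busemann V \<eta> y0 w - busemann V \<xi> y0 w = 2 * of_int (a - t))"
        unfolding E_def H_cyl[OF assms] z by auto
      then show ?thesis using False by (auto simp: z p_def q_def r_def indicator_def)
    qed
  qed
  also have "\<dots> = (\<integral>\<^sup>+\<xi>. \<integral>\<^sup>+u. p \<xi> * (q (fst u) * r \<xi> (fst u) (snd u)) \<partial>(\<mu> y0 \<Otimes>\<^sub>M count_space UNIV) \<partial>\<mu> y0)"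
  proof -
    interpret m: finite_measure "\<mu> y0" by (rule finite_mu[OF y0])
    interpret c: sigma_finite_measure "count_space (UNIV :: int set)" by (rule sigma_finite_measure_count_space)
    interpret s: sigma_finite_measure "\<mu> y0 \<Otimes>\<^sub>M count_space (UNIV :: int set)"
      by (rule sigma_finite_pair_measure) unfold_locales
    have "(\<lambda>z. p (fst z) * (q (fst (snd z)) * (\<lambda>(\<xi>, \<eta>, t). r \<xi> \<eta> t) z)) \<in> borel_measurable prod3"
      using rm unfolding prod3_def by measurable
    then have "(\<lambda>(\<xi>, \<eta>, t). p \<xi> * (q \<eta> * r \<xi> \<eta> t)) \<in> borel_measurable prod3"
      by (rule measurable_cong[THEN iffD1, rotated]) auto
    from s.nn_integral_fst[OF this[unfolded prod3_def]]
    show ?thesis unfolding prod3_def by (simp add: case_prod_unfold)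
  qed
  also have "\<dots> = (\<integral>\<^sup>+\<xi>. p \<xi> * (\<integral>\<^sup>+\<eta>. q \<eta> \<partial>\<mu> y0) \<partial>\<mu> y0)"
  proof (rule nn_integral_cong)
    fix \<xi> assume "\<xi> \<in> space (\<mu> y0)"
    then have xi: "\<xi> \<in> ends" by (simp add: space_mu[OF y0])
    interpret c: sigma_finite_measure "count_space (UNIV :: int set)" by (rule sigma_finite_measure_count_space)
    have rm': "(\<lambda>u. r \<xi> (fst u) (snd u)) \<in> borel_measurable (\<mu> y0 \<Otimes>\<^sub>M count_space UNIV)"
    proof -
      have "(\<lambda>u. (\<lambda>(\<xi>, \<eta>, t). r \<xi> \<eta> t) (\<xi>, u)) \<in> borel_measurable (\<mu> y0 \<Otimes>\<^sub>M count_space UNIV)"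
        using measurable_compose[OF measurable_Pair1'[OF \<open>\<xi> \<in> space (\<mu> y0)\<close>] rm[unfolded prod3_def]] .
      then show ?thesis by (simp add: case_prod_beta)
    qed
    have qr: "(\<lambda>u. q (fst u) * r \<xi> (fst u) (snd u)) \<in> borel_measurable (\<mu> y0 \<Otimes>\<^sub>M count_space (UNIV :: int set))"
      using rm' by measurable
    show "(\<integral>\<^sup>+u. p \<xi> * (q (fst u) * r \<xi> (fst u) (snd u)) \<partial>(\<mu> y0 \<Otimes>\<^sub>M count_space UNIV)) = p \<xi> * (\<integral>\<^sup>+\<eta>. q \<eta> \<partial>\<mu> y0)"
    proof (cases "\<xi> \<in> shadow w' w")
      case False
      then show ?thesis by (simp add: p_def)
    next
      case True
      have "(\<integral>\<^sup>+u. p \<xi> * (q (fst u) * r \<xi> (fst u) (snd u)) \<partial>(\<mu> y0 \<Otimes>\<^sub>M count_space UNIV)) =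
          p \<xi> * (\<integral>\<^sup>+u. q (fst u) * r \<xi> (fst u) (snd u) \<partial>(\<mu> y0 \<Otimes>\<^sub>M count_space UNIV))"
        by (rule nn_integral_cmult[OF qr])
      also have "(\<integral>\<^sup>+u. q (fst u) * r \<xi> (fst u) (snd u) \<partial>(\<mu> y0 \<Otimes>\<^sub>M count_space UNIV)) =
          (\<integral>\<^sup>+\<eta>. \<integral>\<^sup>+t. q \<eta> * r \<xi> \<eta> t \<partial>count_space UNIV \<partial>\<mu> y0)"
        using c.nn_integral_fst[OF qr] by simp
      also have "\<dots> = (\<integral>\<^sup>+\<eta>. q \<eta> \<partial>\<mu> y0)"
      proof (rule nn_integral_cong)
        fix \<eta> assume "\<eta> \<in> space (\<mu> y0)"
        show "(\<integral>\<^sup>+t. q \<eta> * r \<xi> \<eta> t \<partial>count_space UNIV) = q \<eta>"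
        proof (cases "\<eta> \<in> shadow w w'")
          case False
          then show ?thesis by (simp add: q_def)
        next
          case eta: True
          \<comment> \<open>The cocycles do not depend on the time coordinate, so they are evaluated
            on the line with foot at time 0. It passes \<open>w\<close> at time \<open>s\<close>;
            passing \<open>w\<close> at time \<open>a\<close> therefore means that the foot is at
            time \<open>a - s\<close>.\<close>
          have zl: "(\<xi>, \<eta>, 0) \<in> lines" using piece_subset[OF ne] True eta by (auto simp: piece_def)
          note l = H_props[OF zl]
          obtain s :: int where s: "H (\<xi>, \<eta>, 0) (of_int s) = w"
            using line_through[OF l(1) w ne] l True eta by auto
          have bb: "busemann V \<eta> y0 w - busemann V \<xi> y0 w = 2 * of_int s"
            using busemann_line[OF y0 l(1), of s] l s by simp
          have "{t. busemann V \<eta> y0 w - busemann V \<xi> y0 w = 2 * of_int (a - t)} = {a - s}"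
            unfolding bb by auto
          then have "r \<xi> \<eta> = indicator {a - s}" by (auto simp: r_def fun_eq_iff)
          then have "(\<integral>\<^sup>+t. q \<eta> * r \<xi> \<eta> t \<partial>count_space UNIV) = q \<eta> * (\<integral>\<^sup>+t. indicator {a - s} t \<partial>count_space UNIV)"
            by (simp add: nn_integral_cmult)
          then show ?thesis by simp
        qed
      qed
      finally show ?thesis .
    qed
  qed
  also have "\<dots> = (\<integral>\<^sup>+\<xi>. p \<xi> \<partial>\<mu> y0) * (\<integral>\<^sup>+\<eta>. q \<eta> \<partial>\<mu> y0)" by (rule nn_integral_multc) simp
  also have "(\<integral>\<^sup>+\<xi>. p \<xi> \<partial>\<mu> y0) = emeasure (\<mu> w) (shadow w' w)"
    unfolding p_def by (rule emeasure_shadow[symmetric]) (use w shadow_sets_mu y0 in auto)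
  also have "(\<integral>\<^sup>+\<eta>. q \<eta> \<partial>\<mu> y0) = emeasure (\<mu> w) (shadow w w')"
    unfolding q_def by (rule emeasure_shadow[symmetric]) (use w shadow_sets_mu y0 in auto)
  finally show ?thesis .
qed

lemma shadow_scaling:
  assumes x: "x \<in> V" "x' \<in> V" and S: "S \<in> sets ends_borel" and b: "\<And>\<xi>. \<xi> \<in> S \<Longrightarrow> busemann V \<xi> x' x = k"
  shows "emeasure (\<mu> x') S = ennreal (exp (- \<delta> * k)) * emeasure (\<mu> x) S"
proof -
  note [measurable] = busemann_meas_mu[OF x(1) x(2,1)]
  have S': "S \<in> sets (\<mu> x)" using S sets_mu[OF x(1)] by simp
  have "emeasure (\<mu> x') S = emeasure (density (\<mu> x) (\<lambda>\<xi>. ennreal (exp (- \<delta> * busemann V \<xi> x' x)))) S"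
    using mu_density[OF x(2,1)] by simp
  also have "\<dots> = (\<integral>\<^sup>+\<xi>. ennreal (exp (- \<delta> * busemann V \<xi> x' x)) * indicator S \<xi> \<partial>\<mu> x)"
    by (rule emeasure_density) (use S' in measurable)
  also have "\<dots> = (\<integral>\<^sup>+\<xi>. ennreal (exp (- \<delta> * k)) * indicator S \<xi> \<partial>\<mu> x)"
    by (rule nn_integral_cong) (auto simp: indicator_def b)
  finally show ?thesis using S' by (simp add: nn_integral_cmult)
qed

end

section \<open>The quotient system\<close>

text \<open>Bijective steps allow the recursion to run backwards as well; used to follow a two-sided
  sequence of group elements.\<close>

lemma int_recursion:
  assumes "\<And>j::int. bij (f j)"
  shows "\<exists>K. K 0 = x \<and> (\<forall>j. K (j + 1) = f j (K j))"
proof -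
  define K where "K j = (if j \<ge> 0 then rec_nat x (\<lambda>i. f (int i)) (nat j)
    else rec_nat x (\<lambda>i. inv (f (- int i - 1))) (nat (- j)))" for j
  have "K (j + 1) = f j (K j)" for j
  proof (cases "j \<ge> 0")
    case True
    then show ?thesis by (simp add: K_def nat_add_distrib)
  next
    case False
    define n where "n = nat (- j - 1)"
    have j: "j = - int n - 1" using False by (simp add: n_def)
    have n: "nat (- j) = Suc n" using j by simp
    have "K j = inv (f j) (rec_nat x (\<lambda>i. inv (f (- int i - 1))) n)"
      using False n j by (simp add: K_def)
    moreover have "K (j + 1) = rec_nat x (\<lambda>i. inv (f (- int i - 1))) n"
      using j by (cases n) (simp_all add: K_def nat_add_distrib)
    ultimately show ?thesis using surj_f_inv_f[OF bij_is_surj[OF assms]] by metis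
  qed
  moreover have "K 0 = x" by (simp add: K_def)
  ultimately show ?thesis by blast
qed

locale bm_quotient = ps_tree V \<Gamma> \<delta> \<mu> y0
  for V :: "'a::metric_space set" and \<Gamma> \<delta> \<mu> y0 +
  fixes Q :: "(real \<Rightarrow> 'a) set measure"
  assumes discrete: "discrete_subgroup V \<Gamma>" and delta: "0 < \<delta>"
    and null_fixed: "\<And>g x. g \<in> \<Gamma> \<Longrightarrow> g \<noteq> id \<Longrightarrow> elliptic g \<Longrightarrow> x \<in> V \<Longrightarrow>
      {\<xi> \<in> ends. end_action g \<xi> = \<xi>} \<in> null_sets (\<mu> x)"
    and induced: "induced_on_quotient V \<Gamma> (bowen_margulis V \<delta> \<mu> y0) Q"
    and prob_Q: "prob_space Q"
    and mix_Q: "mixing Q quotient_shift"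
begin

lemma \<Gamma>_aut: "g \<in> \<Gamma> \<Longrightarrow> aut g"
  using discrete tree_automorphism_aut unfolding discrete_subgroup_def by blast

lemma \<Gamma>_id: "id \<in> \<Gamma>" and \<Gamma>_comp: "g \<in> \<Gamma> \<Longrightarrow> h \<in> \<Gamma> \<Longrightarrow> g \<circ> h \<in> \<Gamma>" and \<Gamma>_inv: "g \<in> \<Gamma> \<Longrightarrow> inv g \<in> \<Gamma>"
  using discrete unfolding discrete_subgroup_def by blast+

lemma \<Gamma>_dist: "g \<in> \<Gamma> \<Longrightarrow> dist (g x) (g y) = dist x y" and \<Gamma>_V: "g \<in> \<Gamma> \<Longrightarrow> x \<in> V \<Longrightarrow> g x \<in> V"
  and inv_\<Gamma>: "g \<in> \<Gamma> \<Longrightarrow> inv g (g x) = x" and \<Gamma>_inv_eq: "g \<in> \<Gamma> \<Longrightarrow> g (inv g x) = x"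
  using autD[OF \<Gamma>_aut] by blast+

lemma \<Gamma>_btw: "g \<in> \<Gamma> \<Longrightarrow> btw (g x) (g y) (g z) \<longleftrightarrow> btw x y z"
  by (rule aut_btw[OF \<Gamma>_aut])

section \<open>Finite stabilisers and the choice of the marked path\<close>

lemma \<Gamma>_eqI:
  assumes "g \<in> \<Gamma>" "inv g \<circ> h = id"
  shows "h = g"
proof
  fix x
  have "g ((inv g \<circ> h) x) = g x" using assms(2) by simp
  then show "h x = g x" using \<Gamma>_inv_eq[OF assms(1)] by simp
qed

text \<open>Discreteness gives a neighbourhood of the identity containing no other element of
  \<open>\<Gamma>\<close>, and membership in it is decided on a compact set \<open>K\<close>. If
  \<open>K\<close> lies within distance \<open>B\<close> of \<open>x\<close>, the ends of the edges
  meeting \<open>K\<close> lie within \<open>B + 1\<close>, and fixing them fixes \<open>K\<close>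
  pointwise.\<close>

lemma ball_fixator:
  assumes x: "x \<in> V"
  shows "\<exists>R. \<forall>g\<in>\<Gamma>. (\<forall>v\<in>V. dist x v \<le> R \<longrightarrow> g v = v) \<longrightarrow> g = id"
proof -
  have "openin (subtopology compact_open_topology \<Gamma>) {id}"
    using discrete \<Gamma>_id by (simp add: discrete_subgroup_def)
  then obtain W where W: "openin compact_open_topology W" "{id} = W \<inter> \<Gamma>" by (auto simp: openin_subtopology)
  then have "id \<in> W" by blast
  then obtain K where K: "compact K" "\<forall>f'. continuous_on UNIV f' \<longrightarrow> (\<forall>x\<in>K. f' x = id x) \<longrightarrow> f' \<in> W"
    using compact_open_determined[OF W(1)] by blast
  obtain B where B: "\<forall>z\<in>K. dist x z \<le> B"
    using compact_imp_bounded[OF K(1)] bounded_any_center[of K x] by blast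
  have "g = id" if g: "g \<in> \<Gamma>" and fx: "\<forall>v\<in>V. dist x v \<le> B + 1 \<longrightarrow> g v = v" for g
  proof -
    have "g z = id z" if z: "z \<in> K" for z
    proof -
      have "g z = z"
      proof (rule aut_fixes_point[OF \<Gamma>_aut[OF g]])
        fix v assume v: "v \<in> V" "dist v z \<le> 1"
        have "dist x v \<le> B + 1" using B z v dist_triangle[of x v z] by (force simp: dist_commute)
        then show "g v = v" using fx v by blast
      qed
      then show ?thesis by simp
    qed
    moreover have "continuous_on UNIV g"
      using \<Gamma>_aut[OF g] by (auto simp: aut_def intro: isometric_continuous)
    ultimately have "g \<in> W" using K(2) by blast
    then show "g = id" using W(2) g by blast
  qed
  then show ?thesis by blast
qed

text \<open>The stabiliser acts on a finite ball around \<open>x\<close>, and by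
  \<open>ball_fixator\<close> faithfully if the radius is large.\<close>

lemma finite_stabiliser:
  assumes x: "x \<in> V"
  shows "finite {g \<in> \<Gamma>. g x = x}"
proof -
  obtain R where R: "\<forall>g\<in>\<Gamma>. (\<forall>v\<in>V. dist x v \<le> R \<longrightarrow> g v = v) \<longrightarrow> g = id" using ball_fixator[OF x] by blast
  define B where "B = {v \<in> V. dist x v \<le> R}"
  have fin: "finite (PiE B (\<lambda>_. B))" using finite_ball[OF x] by (simp add: B_def finite_PiE)
  have "inj_on (\<lambda>g. restrict g B) {g \<in> \<Gamma>. g x = x}"
  proof (rule inj_onI)
    fix g h assume gh: "g \<in> {g \<in> \<Gamma>. g x = x}" "h \<in> {g \<in> \<Gamma>. g x = x}" "restrict g B = restrict h B"
    have "(inv g \<circ> h) v = v" if "v \<in> V" "dist x v \<le> R" for v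
    proof -
      have "v \<in> B" using that by (simp add: B_def)
      then have "g v = h v" using fun_cong[OF gh(3), of v] by simp
      then show ?thesis using inv_\<Gamma>[of g v] gh by simp
    qed
    then have "inv g \<circ> h = id" using R gh \<Gamma>_comp \<Gamma>_inv by blast
    then show "g = h" using \<Gamma>_eqI gh by blast
  qed
  moreover have "(\<lambda>g. restrict g B) ` {g \<in> \<Gamma>. g x = x} \<subseteq> PiE B (\<lambda>_. B)"
  proof
    fix f assume "f \<in> (\<lambda>g. restrict g B) ` {g \<in> \<Gamma>. g x = x}"
    then obtain g where g: "g \<in> \<Gamma>" "g x = x" "f = restrict g B" by blast
    have "g v \<in> B" if "v \<in> B" for v
      using that \<Gamma>_V[OF g(1)] \<Gamma>_dist[OF g(1), of x v] g(2) by (simp add: B_def)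
    then show "f \<in> PiE B (\<lambda>_. B)" using g(3) by auto
  qed
  ultimately show ?thesis using fin inj_on_finite by blast
qed

lemma countable_\<Gamma>: "countable \<Gamma>"
proof -
  obtain x where x: "x \<in> V" using vertices_nonempty by blast
  have "finite {g \<in> \<Gamma>. g x = y}" for y
  proof (cases "\<exists>g0\<in>\<Gamma>. g0 x = y")
    case True
    then obtain g0 where g0: "g0 \<in> \<Gamma>" "g0 x = y" by blast
    have "{g \<in> \<Gamma>. g x = y} \<subseteq> (\<lambda>h. g0 \<circ> h) ` {g \<in> \<Gamma>. g x = x}"
    proof
      fix g assume g: "g \<in> {g \<in> \<Gamma>. g x = y}"
      have "g = g0 \<circ> (inv g0 \<circ> g)" using \<Gamma>_inv_eq[OF g0(1)] by auto
      moreover have "inv g0 \<circ> g \<in> {g \<in> \<Gamma>. g x = x}"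
        using g g0 \<Gamma>_comp \<Gamma>_inv inv_\<Gamma>[OF g0(1), of x] by auto
      ultimately show "g \<in> (\<lambda>h. g0 \<circ> h) ` {g \<in> \<Gamma>. g x = x}" by blast
    qed
    then show ?thesis using finite_stabiliser[OF x] finite_surj by blast
  next
    case False
    then have "{g \<in> \<Gamma>. g x = y} = {}" by blast
    then show ?thesis by (simp only: finite.emptyI)
  qed
  then have "countable (\<Union>y\<in>V. {g \<in> \<Gamma>. g x = y})"
    using countable_V by (intro countable_UN) (auto intro: countable_finite)
  moreover have "\<Gamma> \<subseteq> (\<Union>y\<in>V. {g \<in> \<Gamma>. g x = y})" using \<Gamma>_V x by blast
  ultimately show ?thesis using countable_subset by blast
qed

lemma sets_BM: "sets BM = sets (borel_of (geodesics_topology V))"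
  by (simp add: BM_eq)

lemma space_BM: "space BM = geodesics V"
  by (simp add: BM_eq topspace_geodesics)

lemma cyl_sets_BM: "cyl a w b w' \<in> sets BM"
  using borel_of_open[OF openin_cyl] by (simp add: sets_BM)

lemma induced_integral:
  assumes "f \<in> borel_measurable BM" "\<And>l. l \<in> geodesics V \<Longrightarrow> F (orbit \<Gamma> l) = (\<integral>\<^sup>+ g. f (g \<circ> l) \<partial>count_space \<Gamma>)"
  shows "(\<integral>\<^sup>+ l. f l \<partial>BM) = (\<integral>\<^sup>+ q. F q \<partial>Q)"
  using induced assms unfolding induced_on_quotient_def by blast

text \<open>Every line starts with one of countably many edges, so otherwise the Bowen-Margulis
  measure would vanish. Yet integrating the constant 1 through the quotient gives the cardinality of
  \<open>\<Gamma>\<close>, which is not 0.\<close>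

lemma edge_with_mass: "\<exists>x\<in>V. \<exists>y\<in>V. dist x y = 1 \<and> 0 < emeasure BM (cyl 0 x 1 y)"
proof (rule ccontr)
  assume *: "\<not> ?thesis"
  have "cyl 0 x 1 y \<in> null_sets BM" if "x \<in> V" "y \<in> V" "dist x y = 1" for x y
  proof (rule null_setsI)
    show "emeasure BM (cyl 0 x 1 y) = 0" using * that not_gr_zero by blast
  qed (rule cyl_sets_BM)
  then have "(\<Union>(x, y)\<in>{(x, y). x \<in> V \<and> y \<in> V \<and> dist x y = 1}. cyl 0 x 1 y) \<in> null_sets BM"
    by (intro null_sets_UN' countable_pairs) auto
  moreover have "space BM \<subseteq> (\<Union>(x, y)\<in>{(x, y). x \<in> V \<and> y \<in> V \<and> dist x y = 1}. cyl 0 x 1 y)"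
  proof
    fix l assume "l \<in> space BM"
    then have l: "l \<in> geodesics V" by (simp add: space_BM)
    have "l \<in> cyl 0 (l (of_int 0)) 1 (l (of_int 1))" using l by (simp add: cyl_def)
    moreover have "l (of_int 0) \<in> V" "l (of_int 1) \<in> V" by (rule geodesicsD(2)[OF l])+
    moreover have "dist (l (of_int 0)) (l (of_int 1)) = 1" using geodesicsD(1)[OF l] by simp
    ultimately show "l \<in> (\<Union>(x, y)\<in>{(x, y). x \<in> V \<and> y \<in> V \<and> dist x y = 1}. cyl 0 x 1 y)" by blast
  qed
  ultimately have zero: "emeasure BM (space BM) = 0"
    using emeasure_eq_0[OF null_setsD2 null_setsD1] by blast
  interpret Q: prob_space Q by (rule prob_Q)
  have "(\<integral>\<^sup>+ l. 1 \<partial>BM) = (\<integral>\<^sup>+ q. (\<integral>\<^sup>+ g. 1 \<partial>count_space \<Gamma>) \<partial>Q)"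
    by (rule induced_integral) auto
  then have "emeasure BM (space BM) = emeasure (count_space \<Gamma>) \<Gamma>"
    using Q.emeasure_space_1 by simp
  moreover have "emeasure (count_space \<Gamma>) \<Gamma> \<noteq> 0"
    using \<Gamma>_id by (subst emeasure_count_space_eq_0) auto
  ultimately show False using zero by simp
qed

text \<open>An edge of positive mass has positive shadows on both sides. Outside the null set
  \<open>Fix\<close>, each non-trivial element of the finite stabiliser of \<open>x\<close> moves
  some vertex of the ray, so a vertex \<open>w\<close> beyond all of these has trivial joint
  stabiliser with \<open>x\<close>, as fixing \<open>x\<close> and \<open>w\<close> fixes the
  segment between them. The shadows of the countably many such \<open>w\<close> cover almost all of
  the forward shadow, hence one of them is charged, while the backward shadow only grows when the
  path is prolonged.\<close>

lemma marked_path: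
  "\<exists>c0\<in>V. \<exists>c1\<in>V. \<exists>N>0. dist c0 c1 = real N \<and> (\<forall>g\<in>\<Gamma>. g c0 = c0 \<longrightarrow> g c1 = c1 \<longrightarrow> g = id) \<and>
    0 < emeasure BM (cyl 0 c0 (int N) c1)"
proof -
  obtain x y where xy: "x \<in> V" "y \<in> V" "dist x y = 1" "0 < emeasure BM (cyl 0 x 1 y)"
    using edge_with_mass by blast
  have "emeasure BM (cyl 0 x 1 y) = emeasure (\<mu> x) (shadow y x) * emeasure (\<mu> x) (shadow x y)"
    by (rule emeasure_cyl) (use xy in auto)
  then have pos: "0 < emeasure (\<mu> x) (shadow y x)" "0 < emeasure (\<mu> x) (shadow x y)"
    using xy(4) by (auto simp: zero_less_iff_neq_zero)
  define St where "St = {g \<in> \<Gamma>. g x = x} - {id}"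
  have fin: "finite St" using finite_stabiliser[OF xy(1)] by (simp add: St_def)
  define Fix where "Fix = (\<Union>g\<in>St. {\<xi> \<in> ends. end_action g \<xi> = \<xi>})"
  have Fix: "Fix \<in> null_sets (\<mu> x)" unfolding Fix_def
  proof (rule null_sets_UN'[OF countable_finite[OF fin]])
    fix g assume "g \<in> St"
    then show "{\<xi> \<in> ends. end_action g \<xi> = \<xi>} \<in> null_sets (\<mu> x)"
      using null_fixed[of g x] xy(1) by (auto simp: St_def elliptic_def)
  qed
  define W where "W = {w \<in> V. btw x y w \<and> (\<forall>g\<in>\<Gamma>. g x = x \<longrightarrow> g w = w \<longrightarrow> g = id)}"
  have cov: "shadow x y \<subseteq> Fix \<union> (\<Union>w\<in>W. shadow x w)"
  proof
    fix \<xi> assume xi: "\<xi> \<in> shadow x y"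
    then have xe: "\<xi> \<in> ends" using shadow_ends by blast
    show "\<xi> \<in> Fix \<union> (\<Union>w\<in>W. shadow x w)"
    proof (cases "\<xi> \<in> Fix")
      case False
      have "\<exists>n. g (ray x \<xi> (real n)) \<noteq> ray x \<xi> (real n)" if "g \<in> St" for g
        using fixes_ray_fixes_end[of g \<xi> x] \<Gamma>_aut[of g] that False xe xy(1) by (auto simp: Fix_def St_def)
      then have "\<forall>g. \<exists>n. g \<in> St \<longrightarrow> g (ray x \<xi> (real n)) \<noteq> ray x \<xi> (real n)" by blast
      then obtain n where n: "\<forall>g. g \<in> St \<longrightarrow> g (ray x \<xi> (real (n g))) \<noteq> ray x \<xi> (real (n g))"
        by (rule choice[THEN exE])
      \<comment> \<open>The inserted 0 covers a trivial stabiliser; the successor gives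
        \<open>m \<ge> 1\<close>, so that \<open>y\<close> lies on the segment from \<open>x\<close>
        to \<open>w\<close>.\<close>
      define m where "m = Suc (Max (insert 0 (n ` St)))"
      have nm: "n g \<le> m" if "g \<in> St" for g
        using Max_ge[of "insert 0 (n ` St)" "n g"] fin that by (simp add: m_def le_Suc_eq)
      define w where "w = ray x \<xi> (real m)"
      have "w \<in> V" unfolding w_def by (rule ray_vertex[OF xe xy(1)])
      moreover have "btw x y w"
      proof -
        have "ray x \<xi> 1 = y" using xi shadow_iff[OF xe, of x y] xy(3) by simp
        then show ?thesis using ray_btw[OF xe, of 1 "real m" x] by (simp add: w_def m_def)
      qed
      moreover have "g = id" if g: "g \<in> \<Gamma>" "g x = x" "g w = w" for g
      proof (rule ccontr)
        assume "g \<noteq> id"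
        then have St: "g \<in> St" using g by (simp add: St_def)
        let ?z = "ray x \<xi> (real (n g))"
        have b: "btw x ?z w" unfolding w_def using nm[OF St] by (intro ray_btw[OF xe]) auto
        have "btw x (g ?z) w" using \<Gamma>_btw[OF g(1), of x ?z w] b g by simp
        moreover have "dist x (g ?z) = dist x ?z" using \<Gamma>_dist[OF g(1), of x ?z] g by simp
        ultimately have "g ?z = ?z" using segment_unique b by blast
        then show False using n St by blast
      qed
      ultimately have "w \<in> W" by (simp add: W_def)
      moreover have "\<xi> \<in> shadow x w" unfolding w_def using shadow_ray[OF xe] by simp
      ultimately show ?thesis by blast
    qed simp
  qed
  have "\<exists>w\<in>W. 0 < emeasure (\<mu> x) (shadow x w)"
  proof (rule ccontr)
    assume *: "\<not> ?thesis"
    have "shadow x w \<in> null_sets (\<mu> x)" if "w \<in> W" for w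
    proof (rule null_setsI)
      show "emeasure (\<mu> x) (shadow x w) = 0" using * that not_gr_zero by blast
      show "shadow x w \<in> sets (\<mu> x)" using that xy(1) by (intro shadow_sets_mu) (auto simp: W_def)
    qed
    moreover have "countable W" by (rule countable_subset[OF _ countable_V]) (auto simp: W_def)
    ultimately have "Fix \<union> (\<Union>w\<in>W. shadow x w) \<in> null_sets (\<mu> x)"
      by (intro null_sets.Un Fix null_sets_UN') auto
    then have "emeasure (\<mu> x) (shadow x y) = 0"
      using cov emeasure_eq_0[OF null_setsD2 null_setsD1] by blast
    then show False using pos by simp
  qed
  then obtain w where w: "w \<in> V" "btw x y w" "\<forall>g\<in>\<Gamma>. g x = x \<longrightarrow> g w = w \<longrightarrow> g = id"
    and wpos: "0 < emeasure (\<mu> x) (shadow x w)" by (auto simp: W_def)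
  have ne: "x \<noteq> y" using xy(3) by auto
  have "shadow y x \<subseteq> shadow w x"
    using shadow_extend[of _ y x w] w(2) ne by (auto simp: btw_sym)
  then have "0 < emeasure (\<mu> x) (shadow w x)"
    using pos(1) emeasure_mono[of "shadow y x" "shadow w x" "\<mu> x"] shadow_sets_mu[OF xy(1) w(1) xy(1)]
    by (meson less_le_trans)
  moreover obtain N where N: "dist x w = real N" using vertex_dist[OF xy(1) w(1)] by blast
  moreover have "dist x w \<ge> 1" using w(2) xy(3) by (simp add: btw_def)
  ultimately have "0 < emeasure BM (cyl 0 x (int N) w)"
    using emeasure_cyl[OF xy(1) w(1), of "int N" 0] wpos by (simp add: zero_less_iff_neq_zero)
  moreover have "N > 0" using N \<open>dist x w \<ge> 1\<close> by (cases N) auto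
  ultimately show ?thesis using xy(1) w N by blast
qed

section \<open>Topology of the quotient and the shift on it\<close>

definition Qtop :: "(real \<Rightarrow> 'a) set topology" where
  "Qtop = quotient_topology (geodesics_topology V) (orbit \<Gamma>)"

lemma openin_Qtop: "openin Qtop U \<longleftrightarrow> U \<subseteq> orbit \<Gamma> ` geodesics V \<and> openin (geodesics_topology V) {l \<in> geodesics V. orbit \<Gamma> l \<in> U}"
  unfolding Qtop_def openin_quotient_topology topspace_geodesics ..

lemma topspace_Qtop: "topspace Qtop = orbit \<Gamma> ` geodesics V"
proof -
  have "{l \<in> geodesics V. orbit \<Gamma> l \<in> orbit \<Gamma> ` geodesics V} = geodesics V" by blast
  then have "openin Qtop (orbit \<Gamma> ` geodesics V)"
    using openin_Qtop openin_topspace[of "geodesics_topology V"] by (simp add: topspace_geodesics)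
  then show ?thesis using openin_subset openin_Qtop[of "topspace Qtop"] by blast
qed

lemma sets_Q: "sets Q = sets (borel_of Qtop)"
  using induced unfolding induced_on_quotient_def quotient_borel_def Qtop_def by blast

lemma space_Q: "space Q = orbit \<Gamma> ` geodesics V"
  using sets_eq_imp_space_eq[OF sets_Q] by (simp add: topspace_Qtop)

lemma open_sets_Q: "openin Qtop U \<Longrightarrow> U \<in> sets Q"
  using borel_of_open by (simp add: sets_Q)

text \<open>All integer times of a window are compared, not only its two ends: this relation is
  inherited by smaller windows and is compatible with time shifts and with the group action.\<close>

definition agree :: "nat \<Rightarrow> (real \<Rightarrow> 'a) \<Rightarrow> (real \<Rightarrow> 'a) \<Rightarrow> bool" where
  "agree n l l' \<longleftrightarrow> (\<forall>j::int. \<bar>j\<bar> \<le> int n \<longrightarrow> l' (of_int j) = l (of_int j))"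

lemma openin_window:
  "openin (geodesics_topology V) D \<longleftrightarrow> D \<subseteq> geodesics V \<and>
     (\<forall>l\<in>D. \<exists>n. \<forall>l'\<in>geodesics V. agree n l l' \<longrightarrow> l' \<in> D)"
proof -
  have 1: "(\<exists>m::nat. \<forall>n\<ge>m. cyl (- int n) (l (of_int (- int n))) (int n) (l (of_int (int n))) \<subseteq> D)
    \<longleftrightarrow> (\<exists>n. \<forall>l'\<in>geodesics V. agree n l l' \<longrightarrow> l' \<in> D)" if l: "l \<in> geodesics V" for l
  proof
    assume "\<exists>m::nat. \<forall>n\<ge>m. cyl (- int n) (l (of_int (- int n))) (int n) (l (of_int (int n))) \<subseteq> D"
    then obtain n :: nat where n: "cyl (- int n) (l (of_int (- int n))) (int n) (l (of_int (int n))) \<subseteq> D" by blast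
    have "l' \<in> D" if "l' \<in> geodesics V" "agree n l l'" for l'
    proof -
      have "l' \<in> cyl (- int n) (l (of_int (- int n))) (int n) (l (of_int (int n)))"
        using that(2)[unfolded agree_def, rule_format, of "- int n"] that(2)[unfolded agree_def, rule_format, of "int n"]
          that(1) by (simp add: cyl_def)
      then show ?thesis using n by blast
    qed
    then show "\<exists>n. \<forall>l'\<in>geodesics V. agree n l l' \<longrightarrow> l' \<in> D" by blast
  next
    assume "\<exists>n. \<forall>l'\<in>geodesics V. agree n l l' \<longrightarrow> l' \<in> D"
    then obtain n where n: "\<forall>l'\<in>geodesics V. agree n l l' \<longrightarrow> l' \<in> D" by blast
    have "cyl (- int m) (l (of_int (- int m))) (int m) (l (of_int (int m))) \<subseteq> D" if "m \<ge> n" for m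
    proof
      fix l' assume l': "l' \<in> cyl (- int m) (l (of_int (- int m))) (int m) (l (of_int (int m)))"
      have lc: "l \<in> cyl (- int m) (l (of_int (- int m))) (int m) (l (of_int (int m)))" using l by (simp add: cyl_def)
      have "agree n l l'" unfolding agree_def
      proof (intro allI impI)
        fix j :: int assume "\<bar>j\<bar> \<le> int n"
        then have "- int m \<le> j" "j \<le> int m" using that by auto
        then show "l' (of_int j) = l (of_int j)" using cyl_agree[OF l' lc, of "of_int j"] by (simp add: of_int_le_iff[symmetric] del: of_int_le_iff)
      qed
      then show "l' \<in> D" using n l' by (simp add: cyl_def)
    qed
    then show "\<exists>m::nat. \<forall>n\<ge>m. cyl (- int n) (l (of_int (- int n))) (int n) (l (of_int (int n))) \<subseteq> D" by blast
  qed
  then show ?thesis unfolding openin_geodesics_iff by (meson subsetD)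
qed

lemma openin_reparam:
  assumes "openin (geodesics_topology V) D"
  shows "openin (geodesics_topology V) {l \<in> geodesics V. (\<lambda>t. l (t + of_int k)) \<in> D}"
  unfolding openin_window
proof (intro conjI ballI)
  fix l assume l: "l \<in> {l \<in> geodesics V. (\<lambda>t. l (t + of_int k)) \<in> D}"
  then obtain n where n: "\<forall>l'\<in>geodesics V. agree n (\<lambda>t. l (t + of_int k)) l' \<longrightarrow> l' \<in> D"
    using assms unfolding openin_window by blast
  have "l' \<in> {l \<in> geodesics V. (\<lambda>t. l (t + of_int k)) \<in> D}"
    if l': "l' \<in> geodesics V" "agree (n + nat \<bar>k\<bar>) l l'" for l'
  proof -
    have "agree n (\<lambda>t. l (t + of_int k)) (\<lambda>t. l' (t + of_int k))" unfolding agree_def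
    proof (intro allI impI)
      fix j :: int assume "\<bar>j\<bar> \<le> int n"
      then have "\<bar>j + k\<bar> \<le> int (n + nat \<bar>k\<bar>)" by linarith
      from l'(2)[unfolded agree_def, rule_format, OF this]
      show "l' (of_int j + of_int k) = l (of_int j + of_int k)" by simp
    qed
    then show ?thesis using n geodesic_reparam[OF l'(1)] l'(1) by blast
  qed
  then show "\<exists>n. \<forall>l'\<in>geodesics V. agree n l l' \<longrightarrow> l' \<in> {l \<in> geodesics V. (\<lambda>t. l (t + of_int k)) \<in> D}" by blast
qed blast

lemma orbit_self: "l \<in> orbit \<Gamma> l"
  unfolding orbit_def using \<Gamma>_id by (intro image_eqI[of _ _ id]) auto

lemma orbit_comp: "g \<in> \<Gamma> \<Longrightarrow> orbit \<Gamma> (g \<circ> l) = orbit \<Gamma> l"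
proof (intro equalityI subsetI)
  assume g: "g \<in> \<Gamma>"
  fix l' assume "l' \<in> orbit \<Gamma> (g \<circ> l)"
  then obtain h where "h \<in> \<Gamma>" "l' = (h \<circ> g) \<circ> l" by (auto simp: orbit_def comp_assoc)
  then show "l' \<in> orbit \<Gamma> l" using \<Gamma>_comp g unfolding orbit_def by blast
next
  assume g: "g \<in> \<Gamma>"
  fix l' assume "l' \<in> orbit \<Gamma> l"
  then obtain h where h: "h \<in> \<Gamma>" "l' = h \<circ> l" by (auto simp: orbit_def)
  then have "l' = (h \<circ> inv g) \<circ> (g \<circ> l)" using inv_\<Gamma>[OF g] by auto
  then show "l' \<in> orbit \<Gamma> (g \<circ> l)" using \<Gamma>_comp \<Gamma>_inv g h unfolding orbit_def by blast
qed

lemma orbit_eq_iff: "orbit \<Gamma> l = orbit \<Gamma> l' \<longleftrightarrow> (\<exists>g\<in>\<Gamma>. l' = g \<circ> l)"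
proof
  assume "orbit \<Gamma> l = orbit \<Gamma> l'"
  then have "l' \<in> orbit \<Gamma> l" using orbit_self by blast
  then show "\<exists>g\<in>\<Gamma>. l' = g \<circ> l" by (auto simp: orbit_def)
qed (use orbit_comp in auto)

definition translate :: "int \<Rightarrow> (real \<Rightarrow> 'a) set \<Rightarrow> (real \<Rightarrow> 'a) set" where
  "translate k q = (\<lambda>l t. l (t + of_int k)) ` q"

lemma translate_orbit: "translate k (orbit \<Gamma> l) = orbit \<Gamma> (\<lambda>t. l (t + of_int k))"
  by (simp add: translate_def orbit_def image_image comp_def)

lemma quotient_shift_eq: "quotient_shift = translate 1"
  by (simp add: fun_eq_iff quotient_shift_def translate_def geodesic_shift_def[abs_def])

lemma translate_meas: "translate k \<in> measurable Q Q"
proof -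
  have "translate k \<in> measurable Q (borel_of Qtop)"
  proof (rule measurable_borel_of)
    show "translate k \<in> space Q \<rightarrow> topspace Qtop"
      using geodesic_reparam by (auto simp: space_Q topspace_Qtop translate_orbit)
    fix U assume U: "openin Qtop U"
    have "{l \<in> geodesics V. orbit \<Gamma> l \<in> translate k -` U \<inter> space Q} =
        {l \<in> geodesics V. (\<lambda>t. l (t + of_int k)) \<in> {l \<in> geodesics V. orbit \<Gamma> l \<in> U}}"
      using geodesic_reparam by (auto simp: space_Q translate_orbit)
    then have "openin Qtop (translate k -` U \<inter> space Q)"
      unfolding openin_Qtop using openin_reparam[of "{l \<in> geodesics V. orbit \<Gamma> l \<in> U}" k] U
      by (auto simp: openin_Qtop space_Q)
    then show "translate k -` U \<inter> space Q \<in> sets Q" by (rule open_sets_Q)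
  qed
  then show ?thesis using measurable_cong_sets[OF refl sets_Q] by blast
qed

lemma translate_pow: "(translate k ^^ n) (orbit \<Gamma> l) = orbit \<Gamma> (\<lambda>t. l (t + of_int (int n * k)))"
  by (induction n) (simp_all add: translate_orbit algebra_simps)

end

section \<open>Visits of a line to translates of the marked path\<close>

locale marked_quotient = bm_quotient V \<Gamma> \<delta> \<mu> y0 Q
  for V :: "'a::metric_space set" and \<Gamma> \<delta> \<mu> y0 Q +
  fixes c0 c1 :: 'a and N :: nat
  assumes c0: "c0 \<in> V" and c1: "c1 \<in> V" and dist_c: "dist c0 c1 = real N" and N_pos: "N > 0"
    and rigid: "\<And>g. g \<in> \<Gamma> \<Longrightarrow> g c0 = c0 \<Longrightarrow> g c1 = c1 \<Longrightarrow> g = id"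
    and mass: "0 < emeasure BM (cyl 0 c0 (int N) c1)"
begin

text \<open>The line traverses the translate by \<open>g\<close> of the marked path, starting at
  time \<open>k\<close>. Only its end points are prescribed; uniqueness of segments does the
  rest.\<close>

definition hit :: "(real \<Rightarrow> 'a) \<Rightarrow> ('a \<Rightarrow> 'a) \<Rightarrow> int \<Rightarrow> bool" where
  "hit l g k \<longleftrightarrow> l (of_int k) = g c0 \<and> l (of_int (k + int N)) = g c1"

definition visit :: "(real \<Rightarrow> 'a) \<Rightarrow> int \<Rightarrow> bool" where
  "visit l k \<longleftrightarrow> (\<exists>g\<in>\<Gamma>. hit l g k)"

definition C :: "(real \<Rightarrow> 'a) set" where
  "C = cyl 0 c0 (int N) c1"

definition A :: "(real \<Rightarrow> 'a) set set" where
  "A = orbit \<Gamma> ` C"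

text \<open>The distance is an integer for elements of \<open>\<Gamma>\<close>, and the floor only
  changes its type. On symbols this is the return time.\<close>

definition len :: "('a \<Rightarrow> 'a) \<Rightarrow> int" where
  "len g = \<lfloor>dist c0 (g c0)\<rfloor>"

lemma len: "g \<in> \<Gamma> \<Longrightarrow> of_int (len g) = dist c0 (g c0)"
proof -
  assume "g \<in> \<Gamma>"
  then obtain n where "dist c0 (g c0) = real n" using vertex_dist[OF c0 \<Gamma>_V[OF _ c0]] by blast
  then show ?thesis by (simp add: len_def)
qed

lemma \<Gamma>_eq_iff: "g \<in> \<Gamma> \<Longrightarrow> g x = y \<longleftrightarrow> x = inv g y"
  using inv_\<Gamma> \<Gamma>_inv_eq by auto

text \<open>This is where the trivial stabiliser of the marked path makes symbols well
  defined.\<close>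

lemma hit_unique: "g \<in> \<Gamma> \<Longrightarrow> h \<in> \<Gamma> \<Longrightarrow> hit l g k \<Longrightarrow> hit l h k \<Longrightarrow> g = h"
proof -
  assume g: "g \<in> \<Gamma>" "h \<in> \<Gamma>" and "hit l g k" "hit l h k"
  then have "g c0 = h c0" "g c1 = h c1" by (simp_all add: hit_def)
  then have "(inv h \<circ> g) c0 = c0" "(inv h \<circ> g) c1 = c1" using inv_\<Gamma>[OF g(2)] by simp_all
  then have "inv h \<circ> g = id" using rigid \<Gamma>_comp \<Gamma>_inv g by blast
  then show "g = h" using \<Gamma>_eqI g by blast
qed

lemma hit_comp: "h \<in> \<Gamma> \<Longrightarrow> hit (h \<circ> l) g k \<longleftrightarrow> hit l (inv h \<circ> g) k"
  by (simp add: hit_def \<Gamma>_eq_iff)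

lemma hit_shift: "hit (\<lambda>t. l (t + of_int m)) g k \<longleftrightarrow> hit l g (k + m)"
  by (simp add: hit_def ac_simps)

lemma visit_comp: "h \<in> \<Gamma> \<Longrightarrow> visit (h \<circ> l) k \<longleftrightarrow> visit l k"
proof
  assume h: "h \<in> \<Gamma>" and "visit (h \<circ> l) k"
  then show "visit l k" unfolding visit_def using hit_comp[OF h] \<Gamma>_comp \<Gamma>_inv h by blast
next
  assume h: "h \<in> \<Gamma>" and "visit l k"
  then obtain g where g: "g \<in> \<Gamma>" "hit l g k" by (auto simp: visit_def)
  have "inv h \<circ> (h \<circ> g) = g" using inv_\<Gamma>[OF h] by auto
  then have "hit (h \<circ> l) (h \<circ> g) k" using hit_comp[OF h] g by simp
  then show "visit (h \<circ> l) k" unfolding visit_def using \<Gamma>_comp h g by blast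
qed

lemma visit_shift: "visit (\<lambda>t. l (t + of_int m)) k \<longleftrightarrow> visit l (k + m)"
  by (simp add: visit_def hit_shift)

lemma C_iff: "l \<in> C \<longleftrightarrow> l \<in> geodesics V \<and> hit l id 0"
  by (auto simp: C_def cyl_def hit_def)

lemma C_geodesic: "l \<in> C \<Longrightarrow> l \<in> geodesics V"
  by (simp add: C_iff)

lemma normalise:
  assumes "l \<in> geodesics V" "g \<in> \<Gamma>" "hit l g k"
  shows "inv g \<circ> (\<lambda>t. l (t + of_int k)) \<in> C" "orbit \<Gamma> (inv g \<circ> (\<lambda>t. l (t + of_int k))) = orbit \<Gamma> (\<lambda>t. l (t + of_int k))"
proof -
  have "hit (inv g \<circ> (\<lambda>t. l (t + of_int k))) id 0"
    unfolding hit_comp[OF \<Gamma>_inv[OF assms(2)]] hit_shift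
    using assms autD(3)[OF \<Gamma>_aut[OF assms(2)]] by (simp add: inv_inv_eq)
  then show "inv g \<circ> (\<lambda>t. l (t + of_int k)) \<in> C"
    using aut_line[OF \<Gamma>_aut[OF \<Gamma>_inv[OF assms(2)]] geodesic_reparam[OF assms(1)]] by (simp add: C_iff)
  show "orbit \<Gamma> (inv g \<circ> (\<lambda>t. l (t + of_int k))) = orbit \<Gamma> (\<lambda>t. l (t + of_int k))"
    by (rule orbit_comp[OF \<Gamma>_inv[OF assms(2)]])
qed

lemma A_iff:
  assumes "l \<in> geodesics V"
  shows "orbit \<Gamma> l \<in> A \<longleftrightarrow> visit l 0"
proof
  assume "orbit \<Gamma> l \<in> A"
  then obtain l' where l': "l' \<in> C" "orbit \<Gamma> l' = orbit \<Gamma> l" by (auto simp: A_def)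
  then obtain g where g: "g \<in> \<Gamma>" "l = g \<circ> l'" using orbit_eq_iff by blast
  have "visit l' 0" using l' \<Gamma>_id unfolding C_iff visit_def by blast
  then show "visit l 0" using g visit_comp by simp
next
  assume "visit l 0"
  then obtain g where "g \<in> \<Gamma>" "hit l g 0" by (auto simp: visit_def)
  note n = normalise[OF assms this]
  have "orbit \<Gamma> (inv g \<circ> (\<lambda>t. l (t + of_int 0))) \<in> A" unfolding A_def using n(1) by blast
  then show "orbit \<Gamma> l \<in> A" using n(2) by simp
qed

definition rep :: "(real \<Rightarrow> 'a) set \<Rightarrow> real \<Rightarrow> 'a" where
  "rep q = (SOME l. l \<in> C \<and> orbit \<Gamma> l = q)"

text \<open>An element carrying one line of \<open>C\<close> to another maps the marked path to
  itself, so it is trivial. Hence \<open>A\<close> is a faithful copy of \<open>C\<close>, and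
  \<open>rep\<close> is the inverse of the projection.\<close>

lemma C_unique:
  assumes "l \<in> C" "l' \<in> C" "orbit \<Gamma> l = orbit \<Gamma> l'"
  shows "l = l'"
proof -
  obtain g where g: "g \<in> \<Gamma>" "l' = g \<circ> l" using orbit_eq_iff assms(3) by blast
  have "hit l (inv g \<circ> id) 0" using assms(2) hit_comp[OF g(1), of l id 0] g(2) by (simp add: C_iff)
  then have "inv g \<circ> id = id" using hit_unique[of "inv g \<circ> id" id] assms(1) \<Gamma>_inv g \<Gamma>_id by (simp add: C_iff)
  then have "g = id" using \<Gamma>_eqI[OF g(1), of id] by simp
  then show ?thesis using g by simp
qed

lemma rep_orbit: "l \<in> C \<Longrightarrow> rep (orbit \<Gamma> l) = l"
  unfolding rep_def by (rule some_equality) (use C_unique in auto)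

lemma rep_props:
  assumes "q \<in> A"
  shows "rep q \<in> C" "orbit \<Gamma> (rep q) = q"
proof -
  obtain l where "l \<in> C" "q = orbit \<Gamma> l" using assms by (auto simp: A_def)
  then show "rep q \<in> C" "orbit \<Gamma> (rep q) = q" using rep_orbit by simp_all
qed

lemma agree_hit:
  assumes "agree n l l'" "\<bar>k\<bar> \<le> int n" "\<bar>k + int N\<bar> \<le> int n"
  shows "hit l' g k \<longleftrightarrow> hit l g k"
  using assms(1)[unfolded agree_def, rule_format, OF assms(2)] assms(1)[unfolded agree_def, rule_format, OF assms(3)]
  unfolding hit_def by simp

text \<open>The projection to the quotient is an open map, as the group preserves agreement on
  windows. Measurable sets of orbits are obtained in this way as images of open sets of
  lines.\<close>

lemma open_image:
  assumes "openin (geodesics_topology V) D"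
  shows "openin Qtop (orbit \<Gamma> ` D)"
proof -
  have D: "D \<subseteq> geodesics V" using assms by (simp add: openin_window)
  have "openin (geodesics_topology V) {l \<in> geodesics V. orbit \<Gamma> l \<in> orbit \<Gamma> ` D}"
    unfolding openin_window
  proof (intro conjI ballI)
    fix l assume "l \<in> {l \<in> geodesics V. orbit \<Gamma> l \<in> orbit \<Gamma> ` D}"
    then obtain d where d: "d \<in> D" "orbit \<Gamma> l = orbit \<Gamma> d" by blast
    then obtain g where g: "g \<in> \<Gamma>" "d = g \<circ> l" using orbit_eq_iff by blast
    obtain n where n: "\<forall>l'\<in>geodesics V. agree n d l' \<longrightarrow> l' \<in> D" using assms d unfolding openin_window by blast
    have "l' \<in> {l \<in> geodesics V. orbit \<Gamma> l \<in> orbit \<Gamma> ` D}" if l': "l' \<in> geodesics V" "agree n l l'" for l'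
    proof -
      have "agree n d (g \<circ> l')" using l'(2) g by (simp add: agree_def)
      then have "g \<circ> l' \<in> D" using n aut_line[OF \<Gamma>_aut[OF g(1)] l'(1)] by blast
      then show ?thesis using orbit_comp[OF g(1), of l'] l'(1) by (auto simp: image_iff intro!: bexI[of _ "g \<circ> l'"])
    qed
    then show "\<exists>n. \<forall>l'\<in>geodesics V. agree n l l' \<longrightarrow> l' \<in> {l \<in> geodesics V. orbit \<Gamma> l \<in> orbit \<Gamma> ` D}" by blast
  qed blast
  then show ?thesis unfolding openin_Qtop using D by blast
qed

lemma open_C: "openin (geodesics_topology V) C"
  unfolding C_def by (rule openin_cyl)

lemma translate_inverse: "q \<in> space Q \<Longrightarrow> translate (- k) (translate k q) = q"
  by (auto simp: space_Q translate_orbit)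

sublocale sys: invertible_system Q "translate 1" "translate (- 1)" A
proof (intro invertible_system.intro invertible_system_axioms.intro)
  show "translate (- 1) (translate 1 x) = x" "translate 1 (translate (- 1) x) = x" if "x \<in> space Q" for x
    using translate_inverse[OF that, of 1] translate_inverse[OF that, of "- 1"] by simp_all
  show "measure Q (translate 1 -` E \<inter> space Q) = measure Q E" if "E \<in> sets Q" for E
    using mixing_imp_invariant[OF prob_Q mix_Q[unfolded quotient_shift_eq] translate_meas that] .
  show "A \<in> sets Q" unfolding A_def by (intro open_sets_Q open_image open_C)
qed (rule prob_Q translate_meas)+

lemma iterate_in_A:
  assumes "l \<in> geodesics V"
  shows "(translate 1 ^^ n) (orbit \<Gamma> l) \<in> A \<longleftrightarrow> visit l (int n)"
    "(translate (- 1) ^^ n) (orbit \<Gamma> l) \<in> A \<longleftrightarrow> visit l (- int n)"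
  unfolding translate_pow A_iff[OF geodesic_reparam[OF assms]] visit_shift by simp_all

lemma X_iff:
  assumes "l \<in> geodesics V"
  shows "orbit \<Gamma> l \<in> sys.X \<longleftrightarrow> visit l 0 \<and> (\<forall>n. \<exists>m>n. visit l (int m)) \<and> (\<forall>n. \<exists>m>n. visit l (- int m))"
  unfolding recurrent_part_def mem_Collect_eq iterate_in_A[OF assms] A_iff[OF assms] ..

definition ret :: "(real \<Rightarrow> 'a) set \<Rightarrow> int" where
  "ret q = int (return_time (translate 1) A q)"

definition \<sigma> :: "(real \<Rightarrow> 'a) set \<Rightarrow> 'a \<Rightarrow> 'a" where
  "\<sigma> q = (THE g. g \<in> \<Gamma> \<and> hit (rep q) g (ret q))"

lemma \<sigma>_eqI: "l \<in> C \<Longrightarrow> g \<in> \<Gamma> \<Longrightarrow> hit l g (ret (orbit \<Gamma> l)) \<Longrightarrow> \<sigma> (orbit \<Gamma> l) = g"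
  unfolding \<sigma>_def rep_orbit by (rule the_equality) (auto intro: hit_unique)

text \<open>On representatives the first return map shifts time to the next visit and then pulls
  back by the symbol, which puts the visited translate onto the marked path itself.\<close>

lemma ret_props:
  assumes l: "l \<in> C" and X: "orbit \<Gamma> l \<in> sys.X"
  shows "0 < ret (orbit \<Gamma> l)" "\<sigma> (orbit \<Gamma> l) \<in> \<Gamma>" "hit l (\<sigma> (orbit \<Gamma> l)) (ret (orbit \<Gamma> l))"
    "\<And>j. 0 < j \<Longrightarrow> j < ret (orbit \<Gamma> l) \<Longrightarrow> \<not> visit l j"
    "len (\<sigma> (orbit \<Gamma> l)) = ret (orbit \<Gamma> l)"
    "inv (\<sigma> (orbit \<Gamma> l)) \<circ> (\<lambda>t. l (t + of_int (ret (orbit \<Gamma> l)))) \<in> C"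
    "sys.F (orbit \<Gamma> l) = orbit \<Gamma> (inv (\<sigma> (orbit \<Gamma> l)) \<circ> (\<lambda>t. l (t + of_int (ret (orbit \<Gamma> l)))))"
proof -
  note lg = C_geodesic[OF l]
  obtain m where m: "m > 0" "(translate 1 ^^ m) (orbit \<Gamma> l) \<in> A" using sys.X_returns[OF X] by blast
  note rt = sys.return_time[OF m(2,1), unfolded iterate_in_A[OF lg]]
  show pos: "0 < ret (orbit \<Gamma> l)" using rt(1) by (simp add: ret_def)
  obtain g where g: "g \<in> \<Gamma>" "hit l g (ret (orbit \<Gamma> l))" using rt(2) by (auto simp: visit_def ret_def)
  have sg: "\<sigma> (orbit \<Gamma> l) = g" by (rule \<sigma>_eqI[OF l g])
  show s: "\<sigma> (orbit \<Gamma> l) \<in> \<Gamma>" "hit l (\<sigma> (orbit \<Gamma> l)) (ret (orbit \<Gamma> l))" using g sg by simp_all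
  show "\<not> visit l j" if "0 < j" "j < ret (orbit \<Gamma> l)" for j
    using rt(3)[of "nat j"] that by (simp add: ret_def nat_less_iff)
  have "dist c0 (g c0) = of_int (ret (orbit \<Gamma> l))"
    using geodesicsD(1)[OF lg, of 0 "of_int (ret (orbit \<Gamma> l))"] g l pos by (simp add: hit_def C_iff)
  then show "len (\<sigma> (orbit \<Gamma> l)) = ret (orbit \<Gamma> l)" unfolding sg len_def by simp
  show "inv (\<sigma> (orbit \<Gamma> l)) \<circ> (\<lambda>t. l (t + of_int (ret (orbit \<Gamma> l)))) \<in> C"
    by (rule normalise(1)[OF lg s])
  have "sys.F (orbit \<Gamma> l) = orbit \<Gamma> (\<lambda>t. l (t + of_int (ret (orbit \<Gamma> l))))"
    by (simp add: first_return_eq translate_pow ret_def)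
  then show "sys.F (orbit \<Gamma> l) = orbit \<Gamma> (inv (\<sigma> (orbit \<Gamma> l)) \<circ> (\<lambda>t. l (t + of_int (ret (orbit \<Gamma> l)))))"
    using normalise(2)[OF lg s] by simp
qed

subsection \<open>Aligned translates of the marked path\<close>

text \<open>The translate by \<open>g\<close> of the path from \<open>c0\<close> to \<open>c1\<close> prolongs this path, in the same direction
  and \<open>k\<close> steps further; the two may overlap.\<close>

definition aligned :: "('a \<Rightarrow> 'a) \<Rightarrow> int \<Rightarrow> bool" where
  "aligned g k \<longleftrightarrow> g \<in> \<Gamma> \<and> k \<ge> 0 \<and> btw c0 c1 (g c1) \<and> dist c0 (g c0) = of_int k \<and> dist c0 (g c1) = of_int k + real N"

lemma aligned_id: "aligned id 0"
  by (simp add: aligned_def \<Gamma>_id dist_c)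

lemma dist_gc: "g \<in> \<Gamma> \<Longrightarrow> dist (g c0) (g c1) = real N"
  by (simp add: \<Gamma>_dist dist_c)

lemma aligned_btw: "aligned g k \<Longrightarrow> btw c0 (g c0) (g c1)"
  by (simp add: aligned_def btw_def dist_gc)

lemma c0_neq_c1: "c0 \<noteq> c1"
  using dist_c N_pos by auto

lemma hit_aligned:
  assumes "l \<in> C" "g \<in> \<Gamma>" "k \<ge> 0" "hit l g k"
  shows "aligned g k"
proof -
  note lg = C_geodesic[OF assms(1)]
  have p: "l 0 = c0" "l (of_int (int N)) = c1" "l (of_int k) = g c0" "l (of_int (k + int N)) = g c1"
    using assms by (simp_all add: C_iff hit_def)
  have "dist c0 (g c0) = of_int k" using geodesicsD(1)[OF lg, of 0 "of_int k"] p assms(3) by simp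
  moreover have "dist c0 (g c1) = of_int k + real N"
    using geodesicsD(1)[OF lg, of 0 "of_int (k + int N)"] p assms(3) by simp
  moreover have "dist c1 (g c1) = of_int k"
    using geodesicsD(1)[OF lg, of "of_int (int N)" "of_int (k + int N)"] p assms(3) by simp
  ultimately show ?thesis using assms(2,3) by (simp add: aligned_def btw_def dist_c)
qed

text \<open>The path from \<open>c0\<close> to \<open>s c1\<close> and the translate by
  \<open>s\<close> of the path from \<open>c0\<close> to \<open>g c1\<close> overlap in the
  translate by \<open>s\<close> of the marked path. As this has positive length \<open>N\<close>,
  they concatenate to a geodesic.\<close>

lemma aligned_comp:
  assumes s: "aligned s r" and g: "aligned g k"
  shows "aligned (s \<circ> g) (r + k)" "btw c0 (s c0) (s (g c1))" "btw c0 (s c1) (s (g c1))"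
proof -
  have sG: "s \<in> \<Gamma>" "g \<in> \<Gamma>" using s g by (auto simp: aligned_def)
  have b1: "btw c0 (s c0) (s c1)" by (rule aligned_btw[OF s])
  have b2: "btw (s c0) (s c1) (s (g c1))" using g \<Gamma>_btw[OF sG(1)] by (simp add: aligned_def)
  have ne: "s c0 \<noteq> s c1" using c0_neq_c1 \<Gamma>_dist[OF sG(1), of c0 c1] by auto
  show b3: "btw c0 (s c0) (s (g c1))" by (rule btw_local_global'[OF b1 b2 ne])
  show b4: "btw c0 (s c1) (s (g c1))" by (rule btw_local_global[OF b1 b2 ne])
  have d1: "dist c0 (s (g c1)) = of_int (r + k) + real N"
    using b3 s g \<Gamma>_dist[OF sG(1), of c0 "g c1"] by (simp add: btw_def aligned_def)
  have "btw (s c0) (s (g c0)) (s (g c1))" using aligned_btw[OF g] \<Gamma>_btw[OF sG(1)] by simp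
  then have "btw c0 (s c0) (s (g c0))" using btw_split'(2) b3 by blast
  then have d0: "dist c0 (s (g c0)) = of_int (r + k)"
    using s g \<Gamma>_dist[OF sG(1), of c0 "g c0"] by (simp add: btw_def aligned_def)
  have "btw c0 c1 (s (g c1))" using btw_split(1)[OF b4] s by (simp add: aligned_def)
  then show "aligned (s \<circ> g) (r + k)"
    using d0 d1 s g \<Gamma>_comp[OF sG] by (simp add: aligned_def)
qed

text \<open>The geodesic from \<open>c0\<close> to \<open>g c1\<close> passes through
  \<open>c1\<close> and \<open>g c0\<close> at the right times, so two traversals reduce to
  prescribing the two extreme vertices.\<close>

lemma aligned_cyl:
  assumes "aligned g k"
  shows "{l \<in> C. hit l g k} = cyl 0 c0 (k + int N) (g c1)"
proof (intro equalityI subsetI)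
  fix l assume "l \<in> {l \<in> C. hit l g k}"
  then show "l \<in> cyl 0 c0 (k + int N) (g c1)" by (simp add: C_def cyl_def hit_def)
next
  fix l assume "l \<in> cyl 0 c0 (k + int N) (g c1)"
  then have l: "l \<in> geodesics V" "l 0 = c0" "l (of_int (k + int N)) = g c1" by (auto simp: cyl_def)
  have k: "k \<ge> 0" using assms by (simp add: aligned_def)
  have at: "l t = z" if "btw c0 z (g c1)" "dist c0 z = t" "0 \<le> t" "t \<le> of_int (k + int N)" for z t
  proof (rule segment_unique[OF _ that(1)])
    show "btw c0 (l t) (g c1)" using geodesic_btw[OF l(1) that(3,4)] l by simp
    show "dist c0 (l t) = dist c0 z" using geodesicsD(1)[OF l(1), of 0 t] l that by simp
  qed
  have "l (of_int (int N)) = c1" by (rule at) (use assms dist_c k in \<open>auto simp: aligned_def\<close>)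
  moreover have "l (of_int k) = g c0" by (rule at) (use aligned_btw[OF assms] assms k in \<open>auto simp: aligned_def\<close>)
  ultimately show "l \<in> {l \<in> C. hit l g k}" using l by (simp add: C_def cyl_def hit_def)
qed

section \<open>Measure of aligned cylinders, upstairs and in the quotient\<close>

lemma end_action_meas:
  assumes g: "g \<in> \<Gamma>"
  shows "end_action g \<in> measurable ends_borel ends_borel"
proof (rule measurable_borel_of)
  note a = \<Gamma>_aut[OF g]
  show "end_action g \<in> space ends_borel \<rightarrow> topspace (ends_topology V)"
    using aut_ends[OF a] by (simp add: topspace_ends)
  define S where "S = {{\<xi> \<in> ends. y \<in> ray_to x \<xi>} |x y. x \<in> V \<and> y \<in> V}"
  have top: "ends_topology V = topology_generated_by S" by (simp add: ends_topology_def S_def)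
  have "continuous_map (ends_topology V) (topology_generated_by S) (end_action g)"
    unfolding continuous_on_generated_topo_iff
  proof (intro conjI allI impI)
    fix U assume "U \<in> S"
    then obtain x y where U: "U = shadow x y" "x \<in> V" "y \<in> V" by (auto simp: shadow_def S_def)
    have iff: "end_action g \<xi> \<in> U \<longleftrightarrow> \<xi> \<in> shadow (inv g x) (inv g y)" if "\<xi> \<in> ends" for \<xi>
      using aut_shadow[OF a that, of "inv g x" "inv g y"] unfolding \<Gamma>_inv_eq[OF g] U(1) .
    have "end_action g -` U \<inter> topspace (ends_topology V) = shadow (inv g x) (inv g y)"
    proof (rule set_eqI)
      fix \<xi> show "\<xi> \<in> end_action g -` U \<inter> topspace (ends_topology V) \<longleftrightarrow> \<xi> \<in> shadow (inv g x) (inv g y)"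
        using iff[of \<xi>] subsetD[OF shadow_ends, of \<xi> "inv g x" "inv g y"] unfolding topspace_ends
        by (cases "\<xi> \<in> ends") auto
    qed
    then show "openin (ends_topology V) (end_action g -` U \<inter> topspace (ends_topology V))"
      using openin_shadow[OF \<Gamma>_V[OF \<Gamma>_inv[OF g] U(2)] \<Gamma>_V[OF \<Gamma>_inv[OF g] U(3)]] by simp
  next
    have "end_action g \<xi> \<in> topspace (topology_generated_by S)" if "\<xi> \<in> ends" for \<xi>
      unfolding top[symmetric] topspace_ends by (rule aut_ends[OF a that])
    then show "end_action g ` topspace (ends_topology V) \<subseteq> \<Union> S"
      unfolding topspace_ends topology_generated_by_topspace by blast
  qed
  then have cont: "continuous_map (ends_topology V) (ends_topology V) (end_action g)" by (simp only: top)
  show "end_action g -` U \<inter> space ends_borel \<in> sets ends_borel" if "openin (ends_topology V) U" for U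
  proof -
    have "end_action g -` U \<inter> space ends_borel = {\<xi> \<in> topspace (ends_topology V). end_action g \<xi> \<in> U}"
      by auto
    then show ?thesis using borel_of_open[OF openin_continuous_map_preimage[OF cont that]] by simp
  qed
qed

text \<open>In the product formula the backward shadow is that of \<open>C\<close>. The forward
  shadow is the image under \<open>g\<close> of the forward shadow of \<open>C\<close>; by
  equivariance its measure from \<open>c0\<close> is that of the latter from
  \<open>inv g c0\<close>. This point lies \<open>k\<close> steps behind \<open>c0\<close> on a
  geodesic through the marked path, so conformality gives the factor.\<close>

lemma emeasure_aligned:
  assumes "aligned g k"
  shows "emeasure BM {l \<in> C. hit l g k} = ennreal (exp (- \<delta> * of_int k)) * emeasure BM C"
proof -
  have g: "g \<in> \<Gamma>" "k \<ge> 0" "btw c0 c1 (g c1)" "dist c0 (g c0) = of_int k" "dist c0 (g c1) = of_int k + real N"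
    using assms by (auto simp: aligned_def)
  note b = aligned_btw[OF assms]
  have gne: "g c0 \<noteq> g c1" using dist_gc[OF g(1)] N_pos by auto
  have x: "inv g c0 \<in> V" by (rule \<Gamma>_V[OF \<Gamma>_inv[OF g(1)] c0])
  have gV: "g c0 \<in> V" "g c1 \<in> V" using \<Gamma>_V[OF g(1)] c0 c1 by auto
  have "emeasure BM {l \<in> C. hit l g k} = emeasure (\<mu> c0) (shadow (g c1) c0) * emeasure (\<mu> c0) (shadow c0 (g c1))"
    unfolding aligned_cyl[OF assms] by (rule emeasure_cyl) (use g c0 gV N_pos in auto)
  also have "shadow (g c1) c0 = shadow c1 c0"
  proof (intro equalityI subsetI)
    show "\<xi> \<in> shadow c1 c0" if "\<xi> \<in> shadow (g c1) c0" for \<xi>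
      by (rule shadow_split(2)[OF that]) (use g(3) in \<open>simp add: btw_sym\<close>)
    show "\<xi> \<in> shadow (g c1) c0" if "\<xi> \<in> shadow c1 c0" for \<xi>
      by (rule shadow_extend[OF that]) (use g(3) c0_neq_c1 in \<open>auto simp: btw_sym\<close>)
  qed
  also have "shadow c0 (g c1) = shadow (g c0) (g c1)"
    using shadow_split(2)[OF _ b] shadow_extend[OF _ b gne] by blast
  also have "emeasure (\<mu> c0) (shadow (g c0) (g c1)) = ennreal (exp (- \<delta> * of_int k)) * emeasure (\<mu> c0) (shadow c0 c1)"
  proof -
    have meas: "end_action g \<in> measurable (\<mu> (inv g c0)) ends_borel"
      using end_action_meas[OF g(1)] measurable_cong_sets[OF sets_mu[OF x] refl] by blast
    have "emeasure (\<mu> c0) (shadow (g c0) (g c1)) = emeasure (distr (\<mu> (inv g c0)) ends_borel (end_action g)) (shadow (g c0) (g c1))"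
      using mu_equivariant[OF g(1) x] \<Gamma>_inv_eq[OF g(1)] by simp
    also have "\<dots> = emeasure (\<mu> (inv g c0)) (end_action g -` shadow (g c0) (g c1) \<inter> space (\<mu> (inv g c0)))"
      by (rule emeasure_distr[OF meas shadow_sets[OF gV]])
    also have "end_action g -` shadow (g c0) (g c1) \<inter> space (\<mu> (inv g c0)) = shadow c0 c1"
    proof (rule set_eqI)
      fix \<xi>
      show "\<xi> \<in> end_action g -` shadow (g c0) (g c1) \<inter> space (\<mu> (inv g c0)) \<longleftrightarrow> \<xi> \<in> shadow c0 c1"
        using aut_shadow[OF \<Gamma>_aut[OF g(1)], of \<xi> c0 c1] subsetD[OF shadow_ends, of \<xi> c0 c1]
        unfolding space_mu[OF x] by (cases "\<xi> \<in> ends") auto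
    qed
    also have "emeasure (\<mu> (inv g c0)) (shadow c0 c1) = ennreal (exp (- \<delta> * of_int k)) * emeasure (\<mu> c0) (shadow c0 c1)"
    proof (rule shadow_scaling[OF c0 x shadow_sets[OF c0 c1]])
      fix \<xi> assume xi: "\<xi> \<in> shadow c0 c1"
      have "btw (inv g c0) c0 c1" using \<Gamma>_btw[OF g(1), of "inv g c0" c0 c1] b \<Gamma>_inv_eq[OF g(1)] by simp
      then have "\<xi> \<in> shadow (inv g c0) c1" using shadow_extend[OF xi _ c0_neq_c1] by blast
      from busemann_eq[OF x this xi]
      have "busemann V \<xi> (inv g c0) c0 = dist (inv g c0) c1 - dist c1 c0" .
      also have "dist (inv g c0) c1 = dist c0 (g c1)"
        using \<Gamma>_dist[OF g(1), of "inv g c0" c1] \<Gamma>_inv_eq[OF g(1)] by simp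
      finally show "busemann V \<xi> (inv g c0) c0 = of_int k" using g dist_c by (simp add: dist_commute)
    qed
    finally show ?thesis .
  qed
  also have "emeasure (\<mu> c0) (shadow c1 c0) * (ennreal (exp (- \<delta> * of_int k)) * emeasure (\<mu> c0) (shadow c0 c1)) =
      ennreal (exp (- \<delta> * of_int k)) * (emeasure (\<mu> c0) (shadow c1 c0) * emeasure (\<mu> c0) (shadow c0 c1))"
    by (simp add: ac_simps)
  also have "emeasure (\<mu> c0) (shadow c1 c0) * emeasure (\<mu> c0) (shadow c0 c1) = emeasure BM C"
    unfolding C_def by (rule emeasure_cyl[symmetric]) (use c0 c1 dist_c N_pos in auto)
  finally show ?thesis .
qed

text \<open>An orbit that meets \<open>B\<close> does so for exactly one group element, two of them
  producing two hits at time 0. So the sum defining the quotient measure is an indicator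
  function.\<close>

lemma emeasure_Q_image:
  assumes B: "openin (geodesics_topology V) B" "B \<subseteq> C"
  shows "emeasure Q (orbit \<Gamma> ` B) = emeasure BM B"
proof -
  have Bs: "B \<in> sets BM" using borel_of_open[OF B(1)] by (simp add: sets_BM)
  have "(\<integral>\<^sup>+ l. indicator B l \<partial>BM) = (\<integral>\<^sup>+ q. indicator (orbit \<Gamma> ` B) q \<partial>Q)"
  proof (rule induced_integral)
    fix l assume l: "l \<in> geodesics V"
    show "indicator (orbit \<Gamma> ` B) (orbit \<Gamma> l) = (\<integral>\<^sup>+ g. indicator B (g \<circ> l) \<partial>count_space \<Gamma>)"
    proof (cases "orbit \<Gamma> l \<in> orbit \<Gamma> ` B")
      case True
      then obtain b where b: "b \<in> B" "orbit \<Gamma> l = orbit \<Gamma> b" by blast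
      then obtain g0 where g0: "g0 \<in> \<Gamma>" "b = g0 \<circ> l" using orbit_eq_iff by blast
      have "indicator B (g \<circ> l) = (indicator {g0} g :: ennreal)" if g: "g \<in> \<Gamma>" for g
      proof (cases "g \<circ> l \<in> B")
        case True
        then have "hit (g \<circ> l) id 0" "hit (g0 \<circ> l) id 0" using B(2) C_iff b g0 by blast+
        then have "hit l (inv g) 0" "hit l (inv g0) 0"
          using hit_comp[OF g, of l id 0] hit_comp[OF g0(1), of l id 0] by simp_all
        then have "inv g = inv g0" by (rule hit_unique[OF \<Gamma>_inv[OF g] \<Gamma>_inv[OF g0(1)]])
        then have "inv (inv g) = inv (inv g0)" by simp
        then have "g = g0"
          using inv_inv_eq[OF autD(3)[OF \<Gamma>_aut[OF g]]] inv_inv_eq[OF autD(3)[OF \<Gamma>_aut[OF g0(1)]]] by simp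
        then show ?thesis using True by simp
      next
        case False
        then show ?thesis using g0 b by (auto simp: indicator_def)
      qed
      then have "(\<integral>\<^sup>+ g. indicator B (g \<circ> l) \<partial>count_space \<Gamma>) = (\<integral>\<^sup>+ g. indicator {g0} g \<partial>count_space \<Gamma>)"
        by (intro nn_integral_cong) simp
      also have "\<dots> = 1" using g0 by (subst nn_integral_indicator) auto
      finally show ?thesis using True by simp
    next
      case False
      have "g \<circ> l \<notin> B" if g: "g \<in> \<Gamma>" for g
      proof
        assume "g \<circ> l \<in> B"
        then have "orbit \<Gamma> (g \<circ> l) \<in> orbit \<Gamma> ` B" by (rule imageI)
        then show False using False orbit_comp[OF g, of l] by simp
      qed
      then have "(\<integral>\<^sup>+ g. indicator B (g \<circ> l) \<partial>count_space \<Gamma>) = (\<integral>\<^sup>+ g. 0 \<partial>count_space \<Gamma>)"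
        by (intro nn_integral_cong) simp
      then show ?thesis using False by simp
    qed
  qed (use Bs in measurable)
  then show ?thesis using Bs open_sets_Q[OF open_image[OF B(1)]] by simp
qed

lemma measure_aligned:
  assumes "aligned g k"
  shows "measure Q (sys.X \<inter> orbit \<Gamma> ` {l \<in> C. hit l g k}) = exp (- \<delta> * of_int k) * measure Q A"
proof -
  have op: "openin (geodesics_topology V) {l \<in> C. hit l g k}"
    unfolding aligned_cyl[OF assms] by (rule openin_cyl)
  let ?B = "orbit \<Gamma> ` {l \<in> C. hit l g k}"
  have Bs: "?B \<in> sets Q" by (intro open_sets_Q open_image op)
  have BA: "?B \<subseteq> A" by (auto simp: A_def)
  have "sys.X \<inter> ?B = ?B - (A - sys.X)" using BA by blast
  then have "measure Q (sys.X \<inter> ?B) = measure Q ?B"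
    using measure_Diff_null_set[OF Bs sys.recurrence] by simp
  moreover have "ennreal (measure Q ?B) = ennreal (exp (- \<delta> * of_int k) * measure Q A)"
  proof -
    have "emeasure Q ?B = ennreal (exp (- \<delta> * of_int k)) * emeasure Q A"
      unfolding A_def using emeasure_Q_image[OF op] emeasure_Q_image[OF open_C] emeasure_aligned[OF assms] by simp
    then show ?thesis by (simp add: sys.emeasure_eq_measure ennreal_mult)
  qed
  ultimately show ?thesis by simp
qed

lemma measure_A_pos: "0 < measure Q A"
proof -
  have "0 < emeasure Q A" unfolding A_def using emeasure_Q_image[OF open_C] mass by (simp add: C_def)
  then show ?thesis by (simp add: sys.emeasure_eq_measure)
qed

end

section \<open>Symbols along a return orbit and their independence\<close>

context marked_quotient
begin

abbreviation "symbols \<equiv> \<sigma> ` sys.X"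

lemma X_repE:
  assumes "q \<in> sys.X"
  obtains l where "l \<in> C" "orbit \<Gamma> l = q" "rep q = l"
  using rep_props[of q] subsetD[OF sys.X_subset(1) assms] by blast

lemma symbol_props:
  assumes "s \<in> symbols"
  shows "aligned s (len s)" "s \<in> \<Gamma>" "0 < len s"
    "\<exists>l\<in>C. hit l s (len s) \<and> (\<forall>j. 0 < j \<longrightarrow> j < len s \<longrightarrow> \<not> visit l j)"
proof -
  obtain q where q: "q \<in> sys.X" "s = \<sigma> q" using assms by blast
  obtain l where l: "l \<in> C" "orbit \<Gamma> l = q" using X_repE[OF q(1)] by metis
  have X: "orbit \<Gamma> l \<in> sys.X" using q l by simp
  note r = ret_props[OF l(1) X, unfolded l(2) q(2)[symmetric]]
  show s: "s \<in> \<Gamma>" "0 < len s" using r by simp_all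
  show "aligned s (len s)" by (rule hit_aligned[OF l(1) s(1)]) (use r in simp_all)
  show "\<exists>l\<in>C. hit l s (len s) \<and> (\<forall>j. 0 < j \<longrightarrow> j < len s \<longrightarrow> \<not> visit l j)"
    using r l(1) by (intro bexI[of _ l]) simp_all
qed

text \<open>A first return is decided by the segment up to the end of the translate it reaches.
  \<open>l\<close> is compared with some line \<open>l'\<close> that has \<open>s\<close> as its
  symbol: both run along this segment, so an earlier visit of \<open>l\<close> would be one of
  \<open>l'\<close>.\<close>

lemma first_symbol:
  assumes s: "s \<in> symbols" and g: "aligned g k" and l: "l \<in> C" and X: "orbit \<Gamma> l \<in> sys.X"
    and h: "hit l (s \<circ> g) (len s + k)"
  shows "\<sigma> (orbit \<Gamma> l) = s"
proof -
  note S = symbol_props[OF s]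
  note lg = C_geodesic[OF l]
  note co = aligned_comp[OF S(1) g]
  have k: "k \<ge> 0" using g by (simp add: aligned_def)
  have dS: "dist c0 (s c0) = of_int (len s)" "dist c0 (s c1) = of_int (len s) + real N"
    using S(1) by (simp_all add: aligned_def)
  have l0: "l 0 = c0" using l by (simp add: C_iff hit_def)
  have le: "l (of_int (len s + k + int N)) = s (g c1)" using h by (simp add: hit_def)
  have at: "l t = z" if "btw c0 z (s (g c1))" "dist c0 z = t" "0 \<le> t" "t \<le> of_int (len s + k + int N)" for z t
  proof (rule segment_unique[OF _ that(1)])
    show "btw c0 (l t) (s (g c1))" using geodesic_btw[OF lg that(3,4)] l0 le by simp
    show "dist c0 (l t) = dist c0 z" using geodesicsD(1)[OF lg, of 0 t] l0 that by simp
  qed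
  have "l (of_int (len s)) = s c0" by (rule at[OF co(2)]) (use dS S(3) k in simp_all)
  moreover have e1: "l (of_int (len s + int N)) = s c1" by (rule at[OF co(3)]) (use dS S(3) k in simp_all)
  ultimately have hs: "hit l s (len s)" by (simp add: hit_def)
  obtain l' where l': "l' \<in> C" "hit l' s (len s)" "\<And>j. 0 < j \<Longrightarrow> j < len s \<Longrightarrow> \<not> visit l' j" using S(4) by blast
  \<comment> \<open>The range extends to \<open>len s + int N\<close> because a visit at time
    \<open>j\<close> is recognised only at time \<open>j + int N\<close>, where the translate
    ends.\<close>
  have same: "l (of_int j) = l' (of_int j)" if "0 \<le> j" "j \<le> len s + int N" for j
  proof (rule cyl_agree)
    show "l \<in> cyl 0 c0 (len s + int N) (s c1)" using lg l0 e1 by (simp add: cyl_def)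
    show "l' \<in> cyl 0 c0 (len s + int N) (s c1)" using l' by (simp add: cyl_def C_iff hit_def)
    show "real_of_int 0 \<le> of_int j" "of_int j \<le> real_of_int (len s + int N)" using that by (simp_all del: of_int_add)
  qed
  have nv: "\<not> visit l j" if "0 < j" "j < len s" for j
  proof -
    have "hit l g' j \<longleftrightarrow> hit l' g' j" for g'
      using same[of j] same[of "j + int N"] that unfolding hit_def by simp
    then show ?thesis using l'(3)[OF that] by (simp add: visit_def)
  qed
  have "visit l (len s)" using hs S(2) by (auto simp: visit_def)
  moreover have rp: "0 < ret (orbit \<Gamma> l)" "visit l (ret (orbit \<Gamma> l))"
    "\<And>j. 0 < j \<Longrightarrow> j < ret (orbit \<Gamma> l) \<Longrightarrow> \<not> visit l j"
    using ret_props[OF l X] by (auto simp: visit_def)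
  ultimately have "ret (orbit \<Gamma> l) = len s" using nv S(3) by (meson linorder_neqE_linordered_idom)
  then show ?thesis using \<sigma>_eqI[OF l S(2)] hs by simp
qed

text \<open>Each symbol is read on the pulled-back representative, hence relative to the preceding
  ones: later symbols multiply on the right.\<close>

primrec gprod :: "nat \<Rightarrow> (nat \<Rightarrow> 'a \<Rightarrow> 'a) \<Rightarrow> 'a \<Rightarrow> 'a" where
  "gprod 0 = (\<lambda>a. id)"
| "gprod (Suc n) = (\<lambda>a. a 0 \<circ> gprod n (\<lambda>j. a (Suc j)))"

lemma gprod_aligned:
  "(\<forall>j<n. a j \<in> symbols) \<Longrightarrow> aligned (gprod n a) (\<Sum>j<n. len (a j))"
proof (induction n arbitrary: a)
  case (Suc n)
  have "aligned (a 0 \<circ> gprod n (\<lambda>j. a (Suc j))) (len (a 0) + (\<Sum>j<n. len (a (Suc j))))"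
    by (rule aligned_comp(1)) (use Suc symbol_props in auto)
  then show ?case by (simp add: sum.lessThan_Suc_shift comp_def del: sum.lessThan_Suc)
qed (use aligned_id in \<open>simp add: id_def\<close>)

text \<open>The heart of the independence: \<open>n\<close> conditions on the code amount to one
  traversal by the original line. The first symbol is split off; that a traversal of the product
  already forces this symbol is \<open>first_symbol\<close>, applicable since the product of the
  remaining ones is aligned.\<close>

lemma code_iff_hit:
  "(\<forall>j<n. a j \<in> symbols) \<Longrightarrow> l \<in> C \<Longrightarrow> orbit \<Gamma> l \<in> sys.X \<Longrightarrow>
    (\<forall>j<n. \<sigma> ((sys.F ^^ j) (orbit \<Gamma> l)) = a j) \<longleftrightarrow> hit l (gprod n a) (\<Sum>j<n. len (a j))"
proof (induction n arbitrary: a l)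
  case 0
  then show ?case by (simp add: C_iff id_def)
next
  case (Suc n)
  let ?q = "orbit \<Gamma> l" and ?b = "\<lambda>j. a (Suc j)"
  let ?g = "gprod n ?b" and ?k = "\<Sum>j<n. len (?b j)"
  note r = ret_props[OF Suc.prems(2,3)]
  define l' where "l' = inv (\<sigma> ?q) \<circ> (\<lambda>t. l (t + of_int (ret ?q)))"
  have l': "l' \<in> C" "sys.F ?q = orbit \<Gamma> l'" using r by (simp_all add: l'_def)
  have X': "orbit \<Gamma> l' \<in> sys.X" using sys.F_in_X(1)[OF Suc.prems(3)] l' by simp
  have IH: "(\<forall>j<n. \<sigma> ((sys.F ^^ j) (orbit \<Gamma> l')) = ?b j) \<longleftrightarrow> hit l' ?g ?k"
    by (rule Suc.IH) (use Suc.prems l' X' in auto)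
  have al: "aligned ?g ?k" by (rule gprod_aligned) (use Suc.prems in auto)
  have hit': "hit l' ?g ?k \<longleftrightarrow> hit l (\<sigma> ?q \<circ> ?g) (len (\<sigma> ?q) + ?k)"
    unfolding l'_def hit_comp[OF \<Gamma>_inv[OF r(2)]] hit_shift inv_inv_eq[OF autD(3)[OF \<Gamma>_aut[OF r(2)]]] r(5)
    by (simp add: add.commute)
  have split: "(\<forall>j<Suc n. \<sigma> ((sys.F ^^ j) ?q) = a j) \<longleftrightarrow>
      \<sigma> ?q = a 0 \<and> (\<forall>j<n. \<sigma> ((sys.F ^^ j) (orbit \<Gamma> l')) = ?b j)"
    by (simp add: All_less_Suc2 funpow_swap1 l'(2)[symmetric])
  have "\<sigma> ?q = a 0 \<and> hit l (\<sigma> ?q \<circ> ?g) (len (\<sigma> ?q) + ?k) \<longleftrightarrow> hit l (a 0 \<circ> ?g) (len (a 0) + ?k)"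
    using first_symbol[OF _ al Suc.prems(2,3), of "a 0"] Suc.prems(1) by auto
  then show ?case
    unfolding split IH hit' by (simp add: sum.lessThan_Suc_shift comp_def del: sum.lessThan_Suc)
qed

lemma cylinder_law:
  assumes a: "\<forall>j<n. a j \<in> symbols"
  shows "measure Q {q \<in> sys.X. \<forall>j<n. \<sigma> ((sys.F ^^ j) q) = a j} = (\<Prod>j<n. exp (- \<delta> * of_int (len (a j)))) * measure Q A"
proof -
  let ?g = "gprod n a" and ?k = "\<Sum>j<n. len (a j)"
  have "{q \<in> sys.X. \<forall>j<n. \<sigma> ((sys.F ^^ j) q) = a j} = sys.X \<inter> orbit \<Gamma> ` {l \<in> C. hit l ?g ?k}"
  proof (intro equalityI subsetI)
    fix q assume q: "q \<in> {q \<in> sys.X. \<forall>j<n. \<sigma> ((sys.F ^^ j) q) = a j}"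
    then obtain l where l: "l \<in> C" "orbit \<Gamma> l = q" using X_repE by (metis (no_types, lifting) mem_Collect_eq)
    then show "q \<in> sys.X \<inter> orbit \<Gamma> ` {l \<in> C. hit l ?g ?k}" using code_iff_hit[OF a l(1)] q by auto
  next
    fix q assume "q \<in> sys.X \<inter> orbit \<Gamma> ` {l \<in> C. hit l ?g ?k}"
    then show "q \<in> {q \<in> sys.X. \<forall>j<n. \<sigma> ((sys.F ^^ j) q) = a j}" using code_iff_hit[OF a] by auto
  qed
  then have "measure Q {q \<in> sys.X. \<forall>j<n. \<sigma> ((sys.F ^^ j) q) = a j} = exp (- \<delta> * of_int ?k) * measure Q A"
    using measure_aligned[OF gprod_aligned[OF a]] by simp
  also have "exp (- \<delta> * of_int ?k) = (\<Prod>j<n. exp (- \<delta> * of_int (len (a j))))"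
    by (simp add: exp_sum[symmetric] sum_distrib_left sum_negf)
  finally show ?thesis .
qed

text \<open>Being a first return with symbol \<open>s\<close> can be read off the line between times
  0 and \<open>len s + int N\<close>, so the fibre is the trace on \<open>X\<close> of the image of
  an open set of lines.\<close>

lemma symbol_fibre_sets: "{q \<in> sys.X. \<sigma> q = s} \<in> sets Q"
proof (cases "s \<in> \<Gamma> \<and> 0 < len s")
  case True
  define D where "D = {l \<in> C. hit l s (len s) \<and> (\<forall>j. 0 < j \<and> j < len s \<longrightarrow> \<not> visit l j)}"
  have "openin (geodesics_topology V) D"
    unfolding openin_window
  proof (intro conjI ballI)
    show "D \<subseteq> geodesics V" using C_geodesic by (auto simp: D_def)
    fix l assume l: "l \<in> D"
    have "l' \<in> D" if l': "l' \<in> geodesics V" "agree (nat (len s) + N) l l'" for l'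
    proof -
      have "hit l' g j \<longleftrightarrow> hit l g j" if "0 \<le> j" "j \<le> len s" for g j
        by (rule agree_hit[OF l'(2)]) (use that in simp_all)
      then have "hit l' id 0" "hit l' s (len s)" "\<And>j. 0 < j \<and> j < len s \<Longrightarrow> visit l' j \<longleftrightarrow> visit l j"
        using l True by (simp_all add: D_def C_iff visit_def)
      then show ?thesis using l l'(1) by (simp add: D_def C_iff)
    qed
    then show "\<exists>n. \<forall>l'\<in>geodesics V. agree n l l' \<longrightarrow> l' \<in> D" by blast
  qed
  then have "orbit \<Gamma> ` D \<in> sets Q" by (intro open_sets_Q open_image)
  moreover have "{q \<in> sys.X. \<sigma> q = s} = sys.X \<inter> orbit \<Gamma> ` D"
  proof (intro equalityI subsetI)
    fix q assume q: "q \<in> {q \<in> sys.X. \<sigma> q = s}"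
    then obtain l where l: "l \<in> C" "orbit \<Gamma> l = q" using X_repE by (metis (no_types, lifting) mem_Collect_eq)
    have "l \<in> D" using ret_props[OF l(1)] q l by (auto simp: D_def)
    then show "q \<in> sys.X \<inter> orbit \<Gamma> ` D" using q l by blast
  next
    fix q assume "q \<in> sys.X \<inter> orbit \<Gamma> ` D"
    then obtain l where l: "l \<in> D" "q = orbit \<Gamma> l" "q \<in> sys.X" by blast
    then have lC: "l \<in> C" and h: "hit l s (len s)" and nv: "\<And>j. 0 < j \<and> j < len s \<Longrightarrow> \<not> visit l j"
      by (auto simp: D_def)
    have X: "orbit \<Gamma> l \<in> sys.X" using l by simp
    have v: "visit l (len s)" using h True by (auto simp: visit_def)
    have "visit l (ret q)" using ret_props(2,3)[OF lC X] l(2) by (auto simp: visit_def)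
    then have "ret q = len s"
      using v nv True ret_props(1,4)[OF lC X] l(2) by (meson linorder_neqE_linordered_idom)
    then show "q \<in> {q \<in> sys.X. \<sigma> q = s}" using \<sigma>_eqI[OF lC _ ] h True l by simp
  qed
  ultimately show ?thesis using sys.X_sets by simp
next
  case False
  have "\<sigma> q \<in> \<Gamma> \<and> 0 < len (\<sigma> q)" if "q \<in> sys.X" for q
    using symbol_props[of "\<sigma> q"] that by blast
  then have "{q \<in> sys.X. \<sigma> q = s} = {}" using False by blast
  then show ?thesis by (simp only: sets.empty_sets)
qed

subsection \<open>Reconstruction of a line from its code\<close>

text \<open>\<open>K j\<close> consists of the group element and the time of the \<open>j\<close>-th
  visit of the line with code \<open>s\<close>, for negative \<open>j\<close> too.\<close>

definition path_of :: "(int \<Rightarrow> 'a \<Rightarrow> 'a) \<Rightarrow> (int \<Rightarrow> ('a \<Rightarrow> 'a) \<times> int) \<Rightarrow> bool" where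
  "path_of s K \<longleftrightarrow> K 0 = (id, 0) \<and> (\<forall>j. K (j + 1) = (fst (K j) \<circ> s j, snd (K j) + len (s j)))"

lemma path_exists:
  assumes "\<And>j. s j \<in> \<Gamma>"
  shows "\<exists>K. path_of s K"
proof -
  have bs: "bij (s j)" for j by (rule autD(3)[OF \<Gamma>_aut[OF assms]])
  have "bij (\<lambda>(g, k). (g \<circ> s j, k + len (s j)))" for j
  proof (rule o_bij[where g = "\<lambda>(g, k). (g \<circ> inv (s j), k - len (s j))"])
    show "(\<lambda>(g, k). (g \<circ> inv (s j), k - len (s j))) \<circ> (\<lambda>(g, k). (g \<circ> s j, k + len (s j))) = id"
      using bs[of j] by (auto simp: fun_eq_iff bij_is_surj surj_f_inv_f)
    show "(\<lambda>(g, k). (g \<circ> s j, k + len (s j))) \<circ> (\<lambda>(g, k). (g \<circ> inv (s j), k - len (s j))) = id"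
      using bs[of j] by (auto simp: fun_eq_iff bij_is_inj inv_f_f)
  qed
  from int_recursion[of "\<lambda>j. \<lambda>(g, k). (g \<circ> s j, k + len (s j))" "(id, 0)", OF this]
  show ?thesis unfolding path_of_def by (simp add: case_prod_beta)
qed

lemma path_\<Gamma>:
  assumes K: "path_of s K" and s: "\<And>j. s j \<in> \<Gamma>"
  shows "fst (K j) \<in> \<Gamma>"
proof (induction j rule: int_induct[where k = 0])
  case base show ?case using K \<Gamma>_id by (simp add: path_of_def id_def)
next
  case (step1 i)
  have "fst (K (i + 1)) = fst (K i) \<circ> s i" using K by (simp add: path_of_def)
  then show ?case using \<Gamma>_comp[OF step1(2) s] by (simp only:)
next
  case (step2 i)
  have "fst (K i) = fst (K (i - 1)) \<circ> s (i - 1)"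
    using K unfolding path_of_def by (metis diff_add_cancel fst_conv)
  then have "fst (K (i - 1)) = fst (K i) \<circ> inv (s (i - 1))"
    using \<Gamma>_inv_eq[OF s] by (auto simp: fun_eq_iff)
  then show ?case using \<Gamma>_comp[OF step2(2) \<Gamma>_inv[OF s]] by (simp only:)
qed

text \<open>Return times are at least 1, so the visits leave every bounded interval of times, and
  \<open>m\<close> symbols to either side control the line on \<open>[-m, m]\<close>.\<close>

lemma path_growth:
  assumes K: "path_of s K" and s: "\<And>j. s j \<in> symbols"
  shows "snd (K j) < snd (K (j + 1))" "int n \<le> snd (K (int n))" "snd (K (- int n)) \<le> - int n"
proof -
  have st: "snd (K (j + 1)) = snd (K j) + len (s j)" for j using K by (simp add: path_of_def)
  have p: "0 < len (s j)" for j by (rule symbol_props(3)[OF s])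
  show "snd (K j) < snd (K (j + 1))" using st[of j] p[of j] by simp
  have K0: "snd (K 0) = 0" using K by (simp add: path_of_def)
  show "int n \<le> snd (K (int n))"
  proof (induction n)
    case (Suc n)
    then show ?case using st[of "int n"] p[of "int n"] by (simp add: add.commute)
  qed (simp add: K0)
  show "snd (K (- int n)) \<le> - int n"
  proof (induction n)
    case (Suc n)
    then show ?case using st[of "- int (Suc n)"] p[of "- int (Suc n)"] by simp
  qed (simp add: K0)
qed

lemma path_agree:
  assumes K: "path_of s K" "path_of s' K'" and s: "\<And>j. s j \<in> \<Gamma>"
    and eq: "\<And>j. \<bar>j\<bar> \<le> int m \<Longrightarrow> s j = s' j" and n: "n \<le> m"
  shows "K (int n) = K' (int n)" "K (- int n) = K' (- int n)"
proof -
  have st: "K (j + 1) = (fst (K j) \<circ> s j, snd (K j) + len (s j))"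
    "K' (j + 1) = (fst (K' j) \<circ> s' j, snd (K' j) + len (s' j))" for j
    using K by (simp_all add: path_of_def)
  have K0: "K 0 = K' 0" using K by (simp add: path_of_def)
  show "K (int n) = K' (int n)" using n
  proof (induction n)
    case (Suc n)
    have "K (int n + 1) = K' (int n + 1)"
      unfolding st using Suc eq[of "int n"] by simp
    then show ?case by (simp add: add.commute)
  qed (simp add: K0)
  show "K (- int n) = K' (- int n)" using n
  proof (induction n)
    case (Suc n)
    define j where "j = - int (Suc n)"
    have jn: "- int n = j + 1" by (simp add: j_def)
    have sj: "s j = s' j" using eq[of j] Suc.prems by (simp add: j_def)
    have "K (j + 1) = K' (j + 1)" using Suc jn by simp
    then have e: "fst (K j) \<circ> s j = fst (K' j) \<circ> s j" "snd (K j) = snd (K' j)" unfolding st sj by simp_all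
    have "fst (K j) x = fst (K' j) x" for x
      using fun_cong[OF e(1), of "inv (s j) x"] \<Gamma>_inv_eq[OF s[of j]] by simp
    then show ?case using e(2) unfolding j_def[symmetric] by (simp add: prod_eq_iff fun_eq_iff)
  qed (simp add: K0)
qed

text \<open>Passing from one representative to the next shifts time by \<open>len\<close> of the
  symbol and applies its inverse. Accumulated over \<open>j\<close> steps, this exhibits the marked
  path of the \<open>j\<close>-th representative as a translate traversed by the representative at
  index 0.\<close>

lemma orbit_path:
  assumes h: "sys.orbit_seq h" and K: "path_of (\<lambda>j. \<sigma> (h j)) K"
  shows "hit (rep (h 0)) (fst (K j)) (snd (K j))"
proof -
  let ?s = "\<lambda>j. \<sigma> (h j)"
  define L where "L j = rep (h j)" for j
  have hX: "h j \<in> sys.X" "h (j + 1) = sys.F (h j)" for j using h by (auto simp: sys.orbit_seq_def)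
  have LC: "L j \<in> C" "orbit \<Gamma> (L j) = h j" for j
    using rep_props subsetD[OF sys.X_subset(1) hX(1)] by (auto simp: L_def)
  have s\<Gamma>: "?s j \<in> \<Gamma>" for j using symbol_props(2) hX(1) by blast
  have bs: "bij (?s j)" for j by (rule autD(3)[OF \<Gamma>_aut[OF s\<Gamma>]])
  have Lst: "L (j + 1) = inv (?s j) \<circ> (\<lambda>t. L j (t + of_int (len (?s j))))" for j
  proof -
    have X: "orbit \<Gamma> (L j) \<in> sys.X" using LC hX by simp
    note r = ret_props[OF LC(1) X, unfolded LC(2)]
    have "L (j + 1) = rep (orbit \<Gamma> (inv (?s j) \<circ> (\<lambda>t. L j (t + of_int (ret (h j))))))"
      unfolding L_def[of "j + 1"] hX(2) r(7) ..
    also have "\<dots> = inv (?s j) \<circ> (\<lambda>t. L j (t + of_int (ret (h j))))" by (rule rep_orbit[OF r(6)])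
    finally show ?thesis unfolding r(5) .
  qed
  note g\<Gamma> = path_\<Gamma>[OF K s\<Gamma>]
  have st: "K (j + 1) = (fst (K j) \<circ> ?s j, snd (K j) + len (?s j))" for j using K by (simp add: path_of_def)
  have "L j = inv (fst (K j)) \<circ> (\<lambda>t. L 0 (t + of_int (snd (K j))))" for j
  proof (induction j rule: int_induct[where k = 0])
    case base show ?case using K by (simp add: path_of_def)
  next
    case (step1 i)
    have "inv (fst (K i) \<circ> ?s i) = inv (?s i) \<circ> inv (fst (K i))"
      by (rule o_inv_distrib) (use bs autD(3)[OF \<Gamma>_aut[OF g\<Gamma>]] in auto)
    then show ?case unfolding Lst st by (subst step1(2)) (simp add: fun_eq_iff algebra_simps)
  next
    case (step2 i)
    \<comment> \<open>The step backwards: the relation between consecutive representatives is solved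
      for the earlier one, by cancelling the inverse of the symbol and undoing the time
      shift.\<close>
    define g k where "g = fst (K (i - 1))" and "k = snd (K (i - 1))"
    let ?r = "?s (i - 1)"
    have Ki: "K i = (g \<circ> ?r, k + len ?r)" using st[of "i - 1"] by (simp add: g_def k_def)
    have "inv (g \<circ> ?r) = inv ?r \<circ> inv g"
      by (rule o_inv_distrib) (use bs autD(3)[OF \<Gamma>_aut[OF g\<Gamma>]] in \<open>auto simp: g_def\<close>)
    then have "L i = (inv ?r \<circ> inv g) \<circ> (\<lambda>t. L 0 (t + of_int (k + len ?r)))" 
      using step2(2) unfolding Ki by (simp only: fst_conv snd_conv)
    moreover have "L i = inv ?r \<circ> (\<lambda>t. L (i - 1) (t + of_int (len ?r)))" using Lst[of "i - 1"] by simp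
    ultimately have e: "inv ?r (L (i - 1) (t + of_int (len ?r))) = inv ?r (inv g (L 0 (t + of_int (k + len ?r))))" for t
      by (metis comp_apply)
    have "L (i - 1) t = inv g (L 0 (t + of_int k))" for t
    proof -
      have "?r (inv ?r (L (i - 1) t)) = ?r (inv ?r (inv g (L 0 (t + of_int k))))"
        using e[of "t - of_int (len ?r)"] by (simp add: algebra_simps)
      then show ?thesis unfolding \<Gamma>_inv_eq[OF s\<Gamma>] .
    qed
    then show ?case by (simp add: fun_eq_iff g_def k_def)
  qed
  note Lj = this[of j]
  have "hit (L j) id 0" using LC(1)[of j] unfolding C_iff by blast
  then have "hit (inv (fst (K j)) \<circ> (\<lambda>t. L 0 (t + of_int (snd (K j))))) id 0" unfolding Lj[symmetric] .
  then show ?thesis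
    unfolding hit_comp[OF \<Gamma>_inv[OF g\<Gamma>]] hit_shift inv_inv_eq[OF autD(3)[OF \<Gamma>_aut[OF g\<Gamma>]]]
    by (simp add: L_def)
qed

text \<open>Equal symbols up to index \<open>m\<close> give equal visits at indices
  \<open>- m\<close> and \<open>m\<close>, hence lines that agree in between, in particular on
  \<open>[-m, m]\<close>. This yields both the injectivity of the coding and the continuity of its
  inverse.\<close>

lemma codes_agree:
  assumes h: "sys.orbit_seq h" "sys.orbit_seq h'" and eq: "\<And>j. \<bar>j\<bar> \<le> int m \<Longrightarrow> \<sigma> (h' j) = \<sigma> (h j)" and t: "\<bar>t\<bar> \<le> real m"
  shows "rep (h' 0) t = rep (h 0) t"
proof -
  have S: "\<sigma> (h j) \<in> symbols" "\<sigma> (h' j) \<in> symbols" for j using h by (auto simp: sys.orbit_seq_def)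
  have SG: "\<sigma> (h j) \<in> \<Gamma>" "\<sigma> (h' j) \<in> \<Gamma>" for j using symbol_props(2)[OF S(1)] symbol_props(2)[OF S(2)] by auto
  obtain K where K: "path_of (\<lambda>j. \<sigma> (h j)) K" using path_exists[of "\<lambda>j. \<sigma> (h j)"] SG by blast
  obtain K' where K': "path_of (\<lambda>j. \<sigma> (h' j)) K'" using path_exists[of "\<lambda>j. \<sigma> (h' j)"] SG by blast
  have KK: "K (int m) = K' (int m)" "K (- int m) = K' (- int m)"
    using path_agree[OF K K' SG(1), of m m] eq by auto
  note G = path_growth[OF K S(1)]
  have rC: "rep (h 0) \<in> C" "rep (h' 0) \<in> C"
    using rep_props(1) subsetD[OF sys.X_subset(1)] h by (auto simp: sys.orbit_seq_def)
  let ?a = "snd (K (- int m))" and ?b = "snd (K (int m))"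
  let ?D = "cyl ?a (fst (K (- int m)) c0) ?b (fst (K (int m)) c0)"
  have "rep (h 0) \<in> ?D"
    using orbit_path[OF h(1) K, of "- int m"] orbit_path[OF h(1) K, of "int m"] C_geodesic[OF rC(1)]
    by (simp add: cyl_def hit_def)
  moreover have "rep (h' 0) \<in> ?D"
    using orbit_path[OF h(2) K', of "- int m"] orbit_path[OF h(2) K', of "int m"] C_geodesic[OF rC(2)]
    by (simp add: cyl_def hit_def KK)
  moreover have "of_int ?a \<le> t" "t \<le> of_int ?b"
  proof -
    have "(of_int ?a :: real) \<le> of_int (- int m)" "(of_int (int m) :: real) \<le> of_int ?b"
      unfolding of_int_le_iff by (rule G(3), rule G(2))
    then show "of_int ?a \<le> t" "t \<le> of_int ?b" using t by (simp_all add: abs_le_iff)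
  qed
  ultimately show ?thesis using cyl_agree by blast
qed

text \<open>Partial products of symbols are aligned by \<open>aligned_comp\<close>, so the
  translates of \<open>c0\<close> sit on one line, which traverses each translate of the marked
  path. Pulled back at each visit, this line gives the required orbit.\<close>

lemma code_realised:
  assumes s: "\<And>j. s j \<in> symbols"
  shows "\<exists>h. sys.orbit_seq h \<and> (\<forall>j. \<sigma> (h j) = s j)"
proof -
  have s\<Gamma>: "s j \<in> \<Gamma>" for j by (rule symbol_props(2)[OF s])
  obtain K where K: "path_of s K" using path_exists[of s] s\<Gamma> by blast
  define g k where "g j = fst (K j)" and "k j = snd (K j)" for j
  have g\<Gamma>: "g j \<in> \<Gamma>" for j using path_\<Gamma>[OF K s\<Gamma>] by (simp add: g_def)
  have st: "g (j + 1) = g j \<circ> s j" "k (j + 1) = k j + len (s j)" for j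
    using K by (simp_all add: path_of_def g_def k_def)
  have z: "g 0 = id" "k 0 = 0" using K by (simp_all add: path_of_def g_def k_def)
  note grow = path_growth[OF K s, folded k_def]
  have al: "aligned (inv (g i) \<circ> g (i + int n)) (k (i + int n) - k i)" for i n
  proof (induction n)
    case 0
    have "inv (g i) \<circ> g i = id" using inv_\<Gamma>[OF g\<Gamma>] by auto
    then show ?case using aligned_id by (simp add: id_def)
  next
    case (Suc n)
    have "aligned ((inv (g i) \<circ> g (i + int n)) \<circ> s (i + int n)) (k (i + int n) - k i + len (s (i + int n)))"
      by (rule aligned_comp(1)[OF Suc symbol_props(1)[OF s]])
    moreover have "i + int (Suc n) = i + int n + 1"
      "k (i + int n) + len (s (i + int n)) - k i = k (i + int n) - k i + len (s (i + int n))" by simp_all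
    ultimately show ?case unfolding comp_assoc by (simp only: st)
  qed
  have tr: "dist (g i c0) (g j c0) = of_int (k j - k i) \<and> k i \<le> k j \<and> btw (g i c0) (g i c1) (g j c1) \<and>
      dist (g i c0) (g j c1) = of_int (k j - k i) + real N" if "i \<le> j" for i j
  proof -
    have a: "aligned (inv (g i) \<circ> g j) (k j - k i)" using al[of i "nat (j - i)"] that by simp
    have e: "g i (inv (g i) (g j x)) = g j x" for x by (rule \<Gamma>_inv_eq[OF g\<Gamma>])
    have "btw (g i c0) (g i c1) (g i (inv (g i) (g j c1)))" using a \<Gamma>_btw[OF g\<Gamma>[of i]] by (simp add: aligned_def)
    moreover have "dist (g i c0) (g i (inv (g i) (g j x))) = dist c0 (inv (g i) (g j x))" for x
      by (rule \<Gamma>_dist[OF g\<Gamma>])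
    ultimately show ?thesis using a unfolding e by (simp add: aligned_def)
  qed
  have dd: "dist (g i c0) (g j c0) = \<bar>of_int (k i - k j)\<bar>" for i j
    using tr[of i j] tr[of j i] by (cases "i \<le> j") (auto simp: dist_commute)
  obtain l where l: "l \<in> geodesics V" "\<And>i. l (of_int (k i)) = g i c0"
    using geodesic_of_points[of "\<lambda>i. g i c0" k, OF dd grow(1)] c0 z by auto
  have hit: "hit l (g i) (k i)" for i
  proof -
    \<comment> \<open>The line was built through the translates of \<open>c0\<close> only. An index
      \<open>j\<close> with \<open>k j\<close> at least \<open>k i + int N\<close> puts
      \<open>g i c1\<close> between \<open>g i c0\<close> and \<open>g j c0\<close>, two points
      known to lie on the line; \<open>nat\<close> keeps the index non-negative, where
      \<open>k j \<ge> j\<close>.\<close>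
    define j where "j = max i (int (nat (k i + int N)))"
    have ij: "i \<le> j" by (simp add: j_def)
    have kj: "k i + int N \<le> k j"
    proof -
      have "0 \<le> j" unfolding j_def by (rule order_trans[OF of_nat_0_le_iff max.cobounded2])
      then have "j \<le> k j" using grow(2)[of "nat j"] by simp
      moreover have "k i + int N \<le> j" unfolding j_def by linarith
      ultimately show ?thesis by linarith
    qed
    note t = tr[OF ij]
    have b0: "btw (g i c0) (g j c0) (g j c1)" using t dist_gc[OF g\<Gamma>] by (simp add: btw_def)
    have d1: "dist (g i c0) (g i c1) = real N" by (rule dist_gc[OF g\<Gamma>])
    have "dist (g i c1) (g j c0) = \<bar>real N - of_int (k j - k i)\<bar>"
      using segment_dist[of "g i c0" "g i c1" "g j c1" "g j c0"] t b0 d1 by simp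
    then have b1: "btw (g i c0) (g i c1) (g j c0)" using t d1 kj by (simp add: btw_def)
    have "l (of_int (k i + int N)) = g i c1"
    proof (rule segment_unique[OF _ b1])
      have "btw (l (of_int (k i))) (l (of_int (k i + int N))) (l (of_int (k j)))"
        by (rule geodesic_btw[OF l(1)]) (use kj in \<open>simp_all del: of_int_add\<close>)
      then show "btw (g i c0) (l (of_int (k i + int N))) (g j c0)" unfolding l(2) .
      have "dist (l (of_int (k i))) (l (of_int (k i + int N))) = real N" using geodesicsD(1)[OF l(1)] by simp
      then show "dist (g i c0) (l (of_int (k i + int N))) = dist (g i c0) (g i c1)" unfolding l(2) d1 .
    qed
    then show ?thesis using l(2) by (simp add: hit_def)
  qed
  have vis: "visit l (k i)" for i using hit g\<Gamma> by (auto simp: visit_def)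
  define L where "L j = inv (g j) \<circ> (\<lambda>t. l (t + of_int (k j)))" for j
  have LC: "L j \<in> C" and Lo: "orbit \<Gamma> (L j) = orbit \<Gamma> (\<lambda>t. l (t + of_int (k j)))" for j
    using normalise[OF l(1) g\<Gamma> hit] by (simp_all add: L_def)
  have kge: "j \<le> k j" if "0 \<le> j" for j using grow(2)[of "nat j"] that by simp
  have kle: "k j \<le> j" if "j \<le> 0" for j using grow(3)[of "nat (- j)"] that by simp
  \<comment> \<open>The visit times tend to infinity in both directions, so every code, and not just
    almost every one, gives a recurrent orbit.\<close>
  have LX: "orbit \<Gamma> (L j) \<in> sys.X" for j
    unfolding Lo X_iff[OF geodesic_reparam[OF l(1)]] visit_shift
  proof (intro conjI allI)
    show "visit l (0 + k j)" using vis by simp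
    fix n
    define i where "i = \<bar>k j\<bar> + int n + 1"
    have "i \<le> k i" by (rule kge) (simp add: i_def)
    then have a: "nat (k i - k j) > n" "int (nat (k i - k j)) + k j = k i" by (auto simp: i_def)
    show "\<exists>m>n. visit l (int m + k j)" by (rule exI[of _ "nat (k i - k j)"]) (use a vis in simp)
    have "k (- i) \<le> - i" by (rule kle) (simp add: i_def)
    then have b: "nat (k j - k (- i)) > n" "- int (nat (k j - k (- i))) + k j = k (- i)" by (auto simp: i_def)
    show "\<exists>m>n. visit l (- int m + k j)" by (rule exI[of _ "nat (k j - k (- i))"]) (use b vis in simp)
  qed
  \<comment> \<open>\<open>first_symbol\<close> with the trivial continuation: the visit at index
    \<open>j + 1\<close> cannot be preceded by another one, because \<open>s j\<close> is already
    known to be the symbol of some orbit.\<close>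
  have code: "\<sigma> (orbit \<Gamma> (L j)) = s j" for j
  proof (rule first_symbol[OF s aligned_id LC LX])
    have "g j \<circ> (s j \<circ> id) = g (j + 1)" using st by simp
    then show "hit (L j) (s j \<circ> id) (len (s j) + 0)"
      unfolding L_def hit_comp[OF \<Gamma>_inv[OF g\<Gamma>]] hit_shift inv_inv_eq[OF autD(3)[OF \<Gamma>_aut[OF g\<Gamma>]]]
      using hit[of "j + 1"] st(2)[of j] by (simp add: add.commute)
  qed
  have "sys.F (orbit \<Gamma> (L j)) = orbit \<Gamma> (L (j + 1))" for j
  proof -
    note r = ret_props[OF LC LX, of j, unfolded code]
    have "sys.F (orbit \<Gamma> (L j)) = orbit \<Gamma> (\<lambda>t. L j (t + of_int (len (s j))))"
      unfolding r(7) r(5)[symmetric] by (rule orbit_comp[OF \<Gamma>_inv[OF s\<Gamma>]])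
    also have "(\<lambda>t. L j (t + of_int (len (s j)))) = inv (g j) \<circ> (\<lambda>t. l (t + of_int (k (j + 1))))"
      unfolding L_def st(2) by (simp add: fun_eq_iff algebra_simps)
    also have "orbit \<Gamma> \<dots> = orbit \<Gamma> (L (j + 1))" unfolding Lo by (rule orbit_comp[OF \<Gamma>_inv[OF g\<Gamma>]])
    finally show ?thesis .
  qed
  then have "sys.orbit_seq (\<lambda>j. orbit \<Gamma> (L j))" using LX by (simp add: sys.orbit_seq_def)
  then show ?thesis using code by blast
qed

theorem quotient_loosely_bernoulli: "loosely_bernoulli Q quotient_shift"
proof -
  have "bernoulli_coding Q (translate 1) (translate (- 1)) A \<sigma> (\<lambda>s. exp (- \<delta> * of_int (len s))) {U. openin Qtop U}"
  proof (intro bernoulli_coding.intro bernoulli_coding_axioms.intro sys.invertible_system_axioms)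
    show "mixing Q (translate 1)" using mix_Q by (simp only: quotient_shift_eq)
    show "0 < measure Q A" by (rule measure_A_pos)
    show "countable symbols" by (rule countable_subset[OF _ countable_\<Gamma>]) (use symbol_props(2) in auto)
    show "{q \<in> sys.X. \<sigma> q = s} \<in> sets Q" for s by (rule symbol_fibre_sets)
    show "0 < exp (- \<delta> * of_int (len s)) \<and> exp (- \<delta> * of_int (len s)) < 1" if "s \<in> symbols" for s
      using symbol_props(3)[OF that] delta by (simp add: mult_pos_pos)
    show "measure Q {q \<in> sys.X. \<forall>j<n. \<sigma> ((sys.F ^^ j) q) = a j} = (\<Prod>j<n. exp (- \<delta> * of_int (len (a j)))) * measure Q A"
      if "\<forall>j<n. a j \<in> symbols" for n a by (rule cylinder_law[OF that])
    show "\<exists>h. sys.orbit_seq h \<and> (\<forall>j. \<sigma> (h j) = s j)" if "\<And>j. s j \<in> symbols" for s by (rule code_realised[OF that])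
    show "sets Q = sigma_sets (space Q) {U. openin Qtop U}"
      unfolding sets_Q sets_borel_of space_Q topspace_Qtop ..
    show "{U. openin Qtop U} \<subseteq> Pow (space Q)" using openin_Qtop by (auto simp: space_Q)
    have rX: "rep (h 0) \<in> C" "orbit \<Gamma> (rep (h 0)) = h 0" if "sys.orbit_seq h" for h
      using rep_props[of "h 0"] that sys.X_subset(1) by (auto simp: sys.orbit_seq_def)
    show "h 0 = h' 0" if h: "sys.orbit_seq h" "sys.orbit_seq h'" and eq: "\<And>j. \<sigma> (h j) = \<sigma> (h' j)" for h h'
    proof -
      have "rep (h 0) t = rep (h' 0) t" for t
      proof -
        obtain m where "\<bar>t\<bar> \<le> real m" using real_arch_simple by blast
        then show ?thesis by (intro codes_agree[OF h(2,1), of m t] eq)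
      qed
      then have "rep (h 0) = rep (h' 0)" by (rule ext)
      then show ?thesis using rX(2)[OF h(1)] rX(2)[OF h(2)] by metis
    qed
    show "\<exists>m::nat. \<forall>h'. sys.orbit_seq h' \<longrightarrow> (\<forall>j. \<bar>j\<bar> \<le> int m \<longrightarrow> \<sigma> (h' j) = \<sigma> (h j)) \<longrightarrow> h' 0 \<in> U"
      if U: "U \<in> {U. openin Qtop U}" and h: "sys.orbit_seq h" "h 0 \<in> U" for U h
    proof -
      have "openin (geodesics_topology V) {l \<in> geodesics V. orbit \<Gamma> l \<in> U}" using U openin_Qtop by simp
      moreover have "rep (h 0) \<in> {l \<in> geodesics V. orbit \<Gamma> l \<in> U}"
        unfolding mem_Collect_eq rX(2)[OF h(1)] using C_geodesic[OF rX(1)[OF h(1)]] h(2) by blast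
      ultimately obtain m where m: "\<forall>l'\<in>geodesics V. agree m (rep (h 0)) l' \<longrightarrow> l' \<in> {l \<in> geodesics V. orbit \<Gamma> l \<in> U}"
        unfolding openin_window by blast
      have "h' 0 \<in> U" if h': "sys.orbit_seq h'" "\<forall>j. \<bar>j\<bar> \<le> int m \<longrightarrow> \<sigma> (h' j) = \<sigma> (h j)" for h'
      proof -
        have "agree m (rep (h 0)) (rep (h' 0))" unfolding agree_def
        proof (intro allI impI)
          fix j :: int assume "\<bar>j\<bar> \<le> int m"
          then have "\<bar>of_int j :: real\<bar> \<le> real m" by linarith
          then show "rep (h' 0) (of_int j) = rep (h 0) (of_int j)"
            by (intro codes_agree[OF h(1) h'(1), of m "of_int j"]) (use h'(2) in blast)+
        qed
        then have "orbit \<Gamma> (rep (h' 0)) \<in> U" using m C_geodesic[OF rX(1)[OF h'(1)]] by blast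
        then show ?thesis unfolding rX(2)[OF h'(1)] .
      qed
      then show ?thesis by blast
    qed
  qed
  then show ?thesis unfolding quotient_shift_eq by (rule bernoulli_coding.loosely_bernoulli)
qed

end

theorem mainTheorem1:
  fixes V :: "'a::metric_space set"
    and \<Gamma> :: "('a \<Rightarrow> 'a) set"
    and \<delta> :: real
    and \<mu> :: "'a \<Rightarrow> 'a tree_end measure"
    and y0 :: 'a
    and \<mu>BM :: "(real \<Rightarrow> 'a) set measure"
  assumes "locally_finite_tree V"
    and "discrete_subgroup V \<Gamma>"
    and "non_elementary \<Gamma>"
    and "0 < \<delta>"
    and "patterson_sullivan V \<Gamma> \<delta> \<mu>"
    and "\<And>\<gamma> x. \<gamma> \<in> \<Gamma> \<Longrightarrow> \<gamma> \<noteq> id \<Longrightarrow> elliptic \<gamma> \<Longrightarrow> x \<in> V \<Longrightarrow>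
           {\<xi> \<in> ends. end_action \<gamma> \<xi> = \<xi>} \<in> null_sets (\<mu> x)"
    and "y0 \<in> V"
    and "induced_on_quotient V \<Gamma> (bowen_margulis V \<delta> \<mu> y0) \<mu>BM"
    and "prob_space \<mu>BM"
    and "mixing \<mu>BM quotient_shift"
  shows "loosely_bernoulli \<mu>BM quotient_shift"
proof -
  interpret bm_quotient V \<Gamma> \<delta> \<mu> y0 \<mu>BM
  proof (intro bm_quotient.intro ps_tree.intro lf_tree.intro lf_tree_axioms.intro
      ps_tree_axioms.intro bm_quotient_axioms.intro)
    show "simplicial_tree V" using assms(1) by (simp add: locally_finite_tree_def)
    show "finite {y \<in> V. dist x y = 1}" if "x \<in> V" for x
      using assms(1) that by (simp add: locally_finite_tree_def)
    show "{\<xi> \<in> ends. end_action g \<xi> = \<xi>} \<in> null_sets (\<mu> x)"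
      if "g \<in> \<Gamma>" "g \<noteq> id" "elliptic g" "x \<in> V" for g x
      by (rule assms(6)[OF that])
  qed (rule assms)+
  obtain c0 c1 N where c: "c0 \<in> V" "c1 \<in> V" "0 < N" "dist c0 c1 = real N"
    and rigid: "\<And>g. g \<in> \<Gamma> \<Longrightarrow> g c0 = c0 \<Longrightarrow> g c1 = c1 \<Longrightarrow> g = id"
    and mass: "0 < emeasure BM (cyl 0 c0 (int N) c1)"
    using marked_path by blast
  interpret marked_quotient V \<Gamma> \<delta> \<mu> y0 \<mu>BM c0 c1 N
    by (intro marked_quotient.intro marked_quotient_axioms.intro bm_quotient_axioms c rigid mass)
      (rule bm_quotient_axioms | assumption)+
  show ?thesis by (rule quotient_loosely_bernoulli)
qed

end
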